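(* Let $G$ be a finite group and let $R$ be an integral domain with field of fractions $K$ such that $|G|$ is invertible in $K$. Assume that for every subgroup $U\le G$ and every prime divisor $p$ of $|\mathrm{Out}(U)|$ one has $\{0\}\neq pR\neq R$. Let $\pi$ be the set of prime divisors of $|G|$ which are not invertible in $R$. For each $\pi$-perfect subgroup $V\le G$ put \[\varepsilon_V^{(\pi)}:=\sum_{\substack{V'\in\widetilde{\Sigma}_G\\ V'^{(\pi)}=_G V}} e_{V'}\in KB(G),\] and for $W\in\widehat{\Theta}^{\pi}_G$ put \[\widehat{\varepsilon}_W^{(\pi)}:=\sum_{\substack{V\in\widetilde{\Theta}^{\pi}_G\\ V\cong W}}\varepsilon_V^{(\pi)}.\] Then the elements $\Delta(\widehat{\varepsilon}_W^{(\pi)})$, $W\in\widehat{\Theta}^{\pi}_G$, are primitive, pairwise orthogonal idempotents of the center $Z(RB^\Delta(G,G))$ whose sum is $1$. In particular, the primitive central idempotents of $RB^\Delta(G,G)$ are parametrized by the isomorphism classes of $\pi$-perfect subgroups of $G$.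
   Context: Burnside ring: $B(G)$ is the Grothendieck ring of finite left $G$-sets (sum = disjoint union, product = direct product); for $H\le G$ the mark homomorphism $\Phi_H\colon B(G)\to\mathbb{Z}$ is $\Phi_H([X])=|X^H|$, extended $K$-linearly to $KB(G)=K\otimes_{\mathbb{Z}}B(G)$. For $U\le G$, $e_U\in KB(G)$ is the unique element with $\Phi_{U'}(e_U)=1$ if $U'$ is $G$-conjugate to $U$ and $\Phi_{U'}(e_U)=0$ otherwise. $\widetilde{\Sigma}_G$ is a set of representatives of the conjugacy classes of subgroups of $G$; $=_G$ means $G$-conjugate. A group $U$ is $\pi$-perfect if it has no quotient of prime order $p\in\pi$; $U^{(\pi)}$ is the smallest normal subgroup of $U$ whose quotient is solvable of order divisible only by primes in $\pi$. $\widetilde{\Theta}^\pi_G$ is the set of $\pi$-perfect elements of $\widetilde{\Sigma}_G$, and $\widehat{\Theta}^\pi_G\subseteq\widetilde{\Theta}^\pi_G$ is a set of representatives of the isomorphism classes of $\pi$-perfect subgroups of $G$. Double Burnside ring: a finite $(G,G)$-biset is a finite set with commuting left and right $G$-actions, identified with a left $G\times G$-set via $(g,h)x=gxh^{-1}$. $B(G,G)$ is the Grothendieck group of finite $(G,G)$-bisets with respect to disjoint union, with multiplication induced by $X\times_G Y$ (the set of $G$-orbits of $X\times Y$ under $g(x,y)=(xg^{-1},gy)$). For $L\le G\times G$ put $k_1(L)=\{g\mid (g,1)\in L\}$, $k_2(L)=\{g\mid(1,g)\in L\}$. The bifree double Burnside ring $B^\Delta(G,G)$ is the subring spanned by classes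 of bisets all of whose point stabilizers $L$ satisfy $k_1(L)=k_2(L)=1$; $RB^\Delta(G,G)=R\otimes_{\mathbb{Z}}B^\Delta(G,G)$, viewed inside $KB^\Delta(G,G)$. The map $\Delta\colon B(G)\to B^\Delta(G,G)$, $[G/U]\mapsto[G\times G/\Delta(U)]$ with $\Delta(U)=\{(u,u)\mid u\in U\}$, is a ring homomorphism, extended $K$-linearly. *)

theory Defs
  imports "HOL-Algebra.Bij" "HOL-Algebra.Solvable_Groups" "HOL-Algebra.Coset"
          "HOL-Computational_Algebra.Primes"
begin

definition conj_img :: "('g,'b) monoid_scheme \<Rightarrow> 'g \<Rightarrow> 'g set \<Rightarrow> 'g set" where
  "conj_img G g U = (\<lambda>x. g \<otimes>\<^bsub>G\<^esub> x \<otimes>\<^bsub>G\<^esub> inv\<^bsub>G\<^esub> g) ` U"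

definition conjugate :: "('g,'b) monoid_scheme \<Rightarrow> 'g set \<Rightarrow> 'g set \<Rightarrow> bool" where
  "conjugate G U V \<longleftrightarrow> subgroup U G \<and> subgroup V G \<and> (\<exists>g\<in>carrier G. V = conj_img G g U)"

definition conj_class :: "('g,'b) monoid_scheme \<Rightarrow> 'g set \<Rightarrow> 'g set set" where
  "conj_class G U = {conj_img G g U | g. g \<in> carrier G}"

definition sub_classes :: "('g,'b) monoid_scheme \<Rightarrow> 'g set set set" where
  "sub_classes G = {conj_class G U | U. subgroup U G}"

definition rep :: "'a set \<Rightarrow> 'a" where
  "rep C = (SOME U. U \<in> C)"

definition Inn :: "('g,'b) monoid_scheme \<Rightarrow> 'g set \<Rightarrow> ('g \<Rightarrow> 'g) set" where
  "Inn G U = {(\<lambda>x\<in>U. u \<otimes>\<^bsub>G\<^esub> x \<otimes>\<^bsub>G\<^esub> inv\<^bsub>G\<^esub> u) | u. u \<in> U}"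

definition order_Out :: "('g,'b) monoid_scheme \<Rightarrow> 'g set \<Rightarrow> nat" where
  "order_Out G U = order (AutoGroup (G\<lparr>carrier := U\<rparr>) Mod Inn G U)"

definition pi_perfect :: "('g,'b) monoid_scheme \<Rightarrow> nat set \<Rightarrow> 'g set \<Rightarrow> bool" where
  "pi_perfect G \<pi> U \<longleftrightarrow>
     \<not> (\<exists>N p. normal N (G\<lparr>carrier := U\<rparr>) \<and> prime p \<and> p \<in> \<pi>
             \<and> order (G\<lparr>carrier := U\<rparr> Mod N) = p)"

definition pi_residual :: "('g,'b) monoid_scheme \<Rightarrow> nat set \<Rightarrow> 'g set \<Rightarrow> 'g set" where
  "pi_residual G \<pi> U = \<Inter> {N. normal N (G\<lparr>carrier := U\<rparr>)
       \<and> solvable (G\<lparr>carrier := U\<rparr> Mod N)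
       \<and> (\<forall>p. prime p \<and> p dvd order (G\<lparr>carrier := U\<rparr> Mod N) \<longrightarrow> p \<in> \<pi>)}"

definition lcosets :: "('g,'b) monoid_scheme \<Rightarrow> 'g set \<Rightarrow> 'g set set" where
  "lcosets G U = {g <#\<^bsub>G\<^esub> U | g. g \<in> carrier G}"

definition mark_basis :: "('g,'b) monoid_scheme \<Rightarrow> 'g set \<Rightarrow> 'g set \<Rightarrow> nat" where
  "mark_basis G H U = card {C \<in> lcosets G U. \<forall>h\<in>H. (\<lambda>c. h \<otimes>\<^bsub>G\<^esub> c) ` C = C}"

text \<open>Elements of KB(G): x U is the coefficient of [G/U] (a class function on subgroups)\<close>
definition burnside_space :: "('g,'b) monoid_scheme \<Rightarrow> ('g set \<Rightarrow> 'k::field) set" where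
  "burnside_space G = {x. (\<forall>U. x U \<noteq> 0 \<longrightarrow> subgroup U G)
                          \<and> (\<forall>U V. conjugate G U V \<longrightarrow> x U = x V)}"

definition mark :: "('g,'b) monoid_scheme \<Rightarrow> 'g set \<Rightarrow> ('g set \<Rightarrow> 'k::field) \<Rightarrow> 'k" where
  "mark G H x = (\<Sum>C\<in>sub_classes G. x (rep C) * of_nat (mark_basis G H (rep C)))"

definition burnside_idem :: "('g,'b) monoid_scheme \<Rightarrow> 'g set \<Rightarrow> ('g set \<Rightarrow> 'k::field)" where
  "burnside_idem G U = (THE x. x \<in> burnside_space G \<and>
      (\<forall>H. subgroup H G \<longrightarrow> mark G H x = (if conjugate G H U then 1 else 0)))"

definition diag :: "'g set \<Rightarrow> ('g \<times> 'g) set" where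
  "diag U = {(u, u) | u. u \<in> U}"

definition bifree :: "('g,'b) monoid_scheme \<Rightarrow> ('g \<times> 'g) set \<Rightarrow> bool" where
  "bifree G L \<longleftrightarrow> subgroup L (G \<times>\<times> G)
     \<and> {g \<in> carrier G. (g, \<one>\<^bsub>G\<^esub>) \<in> L} = {\<one>\<^bsub>G\<^esub>}
     \<and> {g \<in> carrier G. (\<one>\<^bsub>G\<^esub>, g) \<in> L} = {\<one>\<^bsub>G\<^esub>}"

definition bd_classes :: "('g,'b) monoid_scheme \<Rightarrow> ('g \<times> 'g) set set set" where
  "bd_classes G = {conj_class (G \<times>\<times> G) L | L. bifree G L}"

text \<open>Elements of KB^Delta(G,G): a L is the coefficient of [G x G / L]\<close>
definition bd_space :: "('g,'b) monoid_scheme \<Rightarrow> (('g \<times> 'g) set \<Rightarrow> 'k::field) set" where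
  "bd_space G = {a. (\<forall>L. a L \<noteq> 0 \<longrightarrow> bifree G L)
                    \<and> (\<forall>L M. conjugate (G \<times>\<times> G) L M \<longrightarrow> a L = a M)}"

definition bd_R :: "('g,'b) monoid_scheme \<Rightarrow> 'k set \<Rightarrow> (('g \<times> 'g) set \<Rightarrow> 'k::field) set" where
  "bd_R G R = {a \<in> bd_space G. \<forall>L. a L \<in> R}"

definition cact :: "('g,'b) monoid_scheme \<Rightarrow> 'g \<times> 'g \<Rightarrow> ('g \<times> 'g) set \<Rightarrow> ('g \<times> 'g) set" where
  "cact G a C = (\<lambda>c. a \<otimes>\<^bsub>G \<times>\<times> G\<^esub> c) ` C"

text \<open>G-orbit of (x,y) in X x Y under g(x,y) = (x g^-1, g y)\<close>
definition tensor_orbit :: "('g,'b) monoid_scheme \<Rightarrow> ('g \<times> 'g) set \<Rightarrow> ('g \<times> 'g) set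
     \<Rightarrow> (('g \<times> 'g) set \<times> ('g \<times> 'g) set) set" where
  "tensor_orbit G C D = {(cact G (\<one>\<^bsub>G\<^esub>, g) C, cact G (g, \<one>\<^bsub>G\<^esub>) D) | g. g \<in> carrier G}"

definition tensor_set :: "('g,'b) monoid_scheme \<Rightarrow> ('g \<times> 'g) set \<Rightarrow> ('g \<times> 'g) set
     \<Rightarrow> (('g \<times> 'g) set \<times> ('g \<times> 'g) set) set set" where
  "tensor_set G L M = {tensor_orbit G C D | C D. C \<in> lcosets (G \<times>\<times> G) L \<and> D \<in> lcosets (G \<times>\<times> G) M}"

text \<open>(a,b)[x,y] = [a x, y b^-1]\<close>
definition tact :: "('g,'b) monoid_scheme \<Rightarrow> 'g \<times> 'g
     \<Rightarrow> (('g \<times> 'g) set \<times> ('g \<times> 'g) set) set \<Rightarrow> (('g \<times> 'g) set \<times> ('g \<times> 'g) set) set" where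
  "tact G a Ob = (\<lambda>(C, D). (cact G (fst a, \<one>\<^bsub>G\<^esub>) C, cact G (\<one>\<^bsub>G\<^esub>, snd a) D)) ` Ob"

definition tstab :: "('g,'b) monoid_scheme \<Rightarrow> (('g \<times> 'g) set \<times> ('g \<times> 'g) set) set \<Rightarrow> ('g \<times> 'g) set" where
  "tstab G Ob = {a \<in> carrier (G \<times>\<times> G). tact G a Ob = Ob}"

definition torbit :: "('g,'b) monoid_scheme \<Rightarrow> (('g \<times> 'g) set \<times> ('g \<times> 'g) set) set
     \<Rightarrow> (('g \<times> 'g) set \<times> ('g \<times> 'g) set) set set" where
  "torbit G Ob = {tact G a Ob | a. a \<in> carrier (G \<times>\<times> G)}"

text \<open>Multiplicity of [G x G / N] in [G x G / L] x_G [G x G / M]\<close>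
definition tensor_coeff :: "('g,'b) monoid_scheme \<Rightarrow> ('g \<times> 'g) set \<Rightarrow> ('g \<times> 'g) set \<Rightarrow> ('g \<times> 'g) set \<Rightarrow> nat" where
  "tensor_coeff G L M N = card {\<Omega> \<in> {torbit G Ob | Ob. Ob \<in> tensor_set G L M}.
        \<exists>Ob\<in>\<Omega>. conjugate (G \<times>\<times> G) (tstab G Ob) N}"

definition bd_mult :: "('g,'b) monoid_scheme \<Rightarrow> (('g \<times> 'g) set \<Rightarrow> 'k::field)
     \<Rightarrow> (('g \<times> 'g) set \<Rightarrow> 'k) \<Rightarrow> (('g \<times> 'g) set \<Rightarrow> 'k)" where
  "bd_mult G a b = (\<lambda>N. \<Sum>C\<in>bd_classes G. \<Sum>D\<in>bd_classes G.
       a (rep C) * b (rep D) * of_nat (tensor_coeff G (rep C) (rep D) N))"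

definition bd_one :: "('g,'b) monoid_scheme \<Rightarrow> (('g \<times> 'g) set \<Rightarrow> 'k::field)" where
  "bd_one G = (\<lambda>L. if conjugate (G \<times>\<times> G) (diag (carrier G)) L then 1 else 0)"

text \<open>Delta : KB(G) -> KB^Delta(G,G), [G/U] |-> [G x G / Delta(U)], K-linearly\<close>
definition Delta :: "('g,'b) monoid_scheme \<Rightarrow> ('g set \<Rightarrow> 'k::field) \<Rightarrow> (('g \<times> 'g) set \<Rightarrow> 'k)" where
  "Delta G x = (\<lambda>L. if \<exists>U. subgroup U G \<and> conjugate (G \<times>\<times> G) (diag U) L
       then x (SOME U. subgroup U G \<and> conjugate (G \<times>\<times> G) (diag U) L) else 0)"

definition bd_center :: "('g,'b) monoid_scheme \<Rightarrow> 'k set \<Rightarrow> (('g \<times> 'g) set \<Rightarrow> 'k::field) set" where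
  "bd_center G R = {a \<in> bd_R G R. \<forall>b\<in>bd_R G R. bd_mult G a b = bd_mult G b a}"

definition bd_idem :: "('g,'b) monoid_scheme \<Rightarrow> (('g \<times> 'g) set \<Rightarrow> 'k::field) \<Rightarrow> bool" where
  "bd_idem G e \<longleftrightarrow> bd_mult G e e = e"

definition prim_idem :: "('g,'b) monoid_scheme \<Rightarrow> (('g \<times> 'g) set \<Rightarrow> 'k::field) set
      \<Rightarrow> (('g \<times> 'g) set \<Rightarrow> 'k) \<Rightarrow> bool" where
  "prim_idem G Z e \<longleftrightarrow> e \<in> Z \<and> bd_idem G e \<and> e \<noteq> (\<lambda>_. 0) \<and>
     \<not> (\<exists>f\<in>Z. \<exists>g\<in>Z. bd_idem G f \<and> bd_idem G g \<and> f \<noteq> (\<lambda>_. 0) \<and> g \<noteq> (\<lambda>_. 0)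
          \<and> bd_mult G f g = (\<lambda>_. 0) \<and> e = (\<lambda>L. f L + g L))"

definition eps_pi :: "('g,'b) monoid_scheme \<Rightarrow> nat set \<Rightarrow> 'g set set \<Rightarrow> 'g set \<Rightarrow> ('g set \<Rightarrow> 'k::field)" where
  "eps_pi G \<pi> Sig V = (\<lambda>U. \<Sum>V'\<in>{V' \<in> Sig. conjugate G (pi_residual G \<pi> V') V}.
                          burnside_idem G V' U)"

definition eps_hat :: "('g,'b) monoid_scheme \<Rightarrow> nat set \<Rightarrow> 'g set set \<Rightarrow> 'g set \<Rightarrow> ('g set \<Rightarrow> 'k::field)" where
  "eps_hat G \<pi> Sig W = (\<lambda>U. \<Sum>V\<in>{V \<in> Sig. pi_perfect G \<pi> V
                          \<and> G\<lparr>carrier := V\<rparr> \<cong> G\<lparr>carrier := W\<rparr>}. eps_pi G \<pi> Sig V U)"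

end

(* A bifree biset is determined by its marks, and the marks of a tensor product are a convolution over
   the isomorphisms between subgroups of G, so K B^Delta(G,G) is the algebra of functions on these isomorphisms
   that are invariant under conjugation by G x G. A central idempotent e commutes with the elements Delta(e_U),
   hence is supported on isomorphisms between G-conjugate subgroups. On the automorphisms of U it acts as an
   idempotent on K[Aut(U)/Aut_G(U)], whose rank r is an integer; since C_G(U) acts freely on the Delta(U)-fixed
   points of a bifree biset, integrality of e makes r / |Aut(U) : Aut_G(U)| an element of R. No prime divisor
   of |Out(U)| is invertible in R, so the quotient is 0 or 1 and e = Delta(x) for an x with marks 0 and 1.
   Commuting with all isomorphisms makes these marks invariant under isomorphism of subgroups.
   Finally x has coefficients in R iff its marks agree on U and its pi-residual (Dress): congruences between
   marks along normal inclusions of prime index give one direction, and Cauchy-Frobenius counting for Sylow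
   subgroups of N_G(U)/U, descending through the subgroup lattice, gives the other. *)

theory Submission
  imports Defs "HOL-Algebra.Sylow" "HOL-Algebra.Group_Action"
begin

section \<open>Conjugation and finite group actions\<close>

text \<open>\<open>K\<close> may have positive characteristic, where a trace does not determine a
  rank. The rank is therefore carried along as a natural number r: its image in \<open>K\<close> is
  the trace, it is at most the number of distinct nonzero rows, and r = 0 forces the matrix to
  vanish. There are at most n distinct rows, where n = |Aut(U) : Aut_G(U)| divides |Out(U)|, so r /
  n is an integer fraction between 0 and 1. The condition pR \<noteq> {0} allows cancelling |Out(U)|
  in \<open>K\<close>, and pR \<noteq> R excludes a proper fraction by Bezout. The quotient 0 kills
  e over U. The quotient 1 only describes e at the identity of U; the same argument for 1 - e, whose
  quotient is then 0, determines e on all isomorphisms from U. Centrality is a condition against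
  elements with coefficients in \<open>R\<close>, but it is used against indicators with
  coefficients in \<open>K\<close>; clearing denominators bridges the two. The delicate half of the
  integrality criterion is the construction of coefficients from marks: it divides by |N_G(U) : U|,
  and this division is justified one prime at a time.\<close>

lemma card_eq_sum_fibres:
  assumes "finite A" "finite B" "f ` A \<subseteq> B"
  shows "card A = (\<Sum>b\<in>B. card {a \<in> A. f a = b})"
  using sum_fun_comp[OF assms, of "\<lambda>_. 1::nat"] by simp

lemma card_fibres:
  assumes "finite A" "f ` A = B" "\<And>b. b \<in> B \<Longrightarrow> card {a \<in> A. f a = b} = k"
  shows "card A = k * card B"
proof -
  have "card A = (\<Sum>b\<in>B. card {a \<in> A. f a = b})"
    using assms(1,2) by (intro card_eq_sum_fibres) auto
  also have "\<dots> = k * card B" using assms(3) by simp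
  finally show ?thesis .
qed

locale fin_group = group +
  assumes fin [simp]: "finite (carrier G)"

context group
begin

lemma conj_img_one: "U \<subseteq> carrier G \<Longrightarrow> conj_img G \<one> U = U"
  unfolding conj_img_def by (force simp: image_iff subset_iff)

lemma conj_img_mult:
  assumes "U \<subseteq> carrier G" "g \<in> carrier G" "h \<in> carrier G"
  shows "conj_img G g (conj_img G h U) = conj_img G (g \<otimes> h) U"
proof -
  have "g \<otimes> (h \<otimes> x \<otimes> inv h) \<otimes> inv g = g \<otimes> h \<otimes> x \<otimes> inv (g \<otimes> h)" if "x \<in> U" for x
    using assms that by (simp add: inv_mult_group m_assoc subsetD)
  then show ?thesis unfolding conj_img_def image_image by (intro image_cong) auto
qed

lemma conj_img_carrier:
  assumes "U \<subseteq> carrier G" "g \<in> carrier G"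
  shows "conj_img G g U \<subseteq> carrier G"
  using assms unfolding conj_img_def by auto

lemma conj_img_cancel:
  assumes "U \<subseteq> carrier G" "g \<in> carrier G"
  shows "conj_img G (inv g) (conj_img G g U) = U" "conj_img G g (conj_img G (inv g) U) = U"
  using assms by (simp_all add: conj_img_mult conj_img_one)

lemma conj_img_mono: "U \<subseteq> V \<Longrightarrow> conj_img G g U \<subseteq> conj_img G g V"
  unfolding conj_img_def by auto

lemma conj_img_mono_iff:
  assumes "U \<subseteq> carrier G" "V \<subseteq> carrier G" "g \<in> carrier G"
  shows "conj_img G g U \<subseteq> conj_img G g V \<longleftrightarrow> U \<subseteq> V"
  using conj_img_mono[of "conj_img G g U" "conj_img G g V" "inv g"] conj_img_mono[of U V g]
    conj_img_cancel assms by metis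

lemma conj_img_subset_iff:
  assumes "U \<subseteq> carrier G" "V \<subseteq> carrier G" "g \<in> carrier G"
  shows "conj_img G (inv g) U \<subseteq> V \<longleftrightarrow> U \<subseteq> conj_img G g V"
  using conj_img_mono_iff[of "conj_img G (inv g) U" V g] conj_img_cancel assms conj_img_carrier
  by (metis inv_closed)

lemma mem_conj_img:
  assumes "U \<subseteq> carrier G" "g \<in> carrier G" "x \<in> carrier G"
  shows "x \<in> conj_img G g U \<longleftrightarrow> inv g \<otimes> x \<otimes> g \<in> U"
proof
  assume "x \<in> conj_img G g U"
  then obtain u where u: "u \<in> U" "x = g \<otimes> u \<otimes> inv g" unfolding conj_img_def by auto
  have uc: "u \<in> carrier G" using u assms by auto
  have "inv g \<otimes> x \<otimes> g = u" using assms(2) uc unfolding u(2)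
    by (metis inv_closed inv_solve_left inv_solve_right' m_closed m_assoc)
  then show "inv g \<otimes> x \<otimes> g \<in> U" using u by simp
next
  assume a: "inv g \<otimes> x \<otimes> g \<in> U"
  have "x = g \<otimes> (inv g \<otimes> x \<otimes> g) \<otimes> inv g"
    using assms by (metis inv_closed inv_solve_left inv_solve_right' m_closed m_assoc)
  then show "x \<in> conj_img G g U" using a unfolding conj_img_def by auto
qed

lemma conj_img_subgroup:
  assumes "subgroup U G" "g \<in> carrier G"
  shows "subgroup (conj_img G g U) G"
proof (rule subgroupI)
  have sub: "U \<subseteq> carrier G" using assms(1) by (rule subgroup.subset)
  show c: "conj_img G g U \<subseteq> carrier G" using conj_img_carrier[OF sub assms(2)] .
  show "conj_img G g U \<noteq> {}" using subgroup.one_closed[OF assms(1)] unfolding conj_img_def by auto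
  fix a assume a: "a \<in> conj_img G g U"
  then obtain u where u: "u \<in> U" "a = g \<otimes> u \<otimes> inv g" unfolding conj_img_def by auto
  have uc: "u \<in> carrier G" using u sub by auto
  have "inv a = g \<otimes> inv u \<otimes> inv g" unfolding u(2) using uc assms(2)
    by (simp add: inv_mult_group m_assoc)
  then show "inv a \<in> conj_img G g U" using subgroup.m_inv_closed[OF assms(1) u(1)]
    unfolding conj_img_def by auto
  fix b assume b: "b \<in> conj_img G g U"
  then obtain v where v: "v \<in> U" "b = g \<otimes> v \<otimes> inv g" unfolding conj_img_def by auto
  have vc: "v \<in> carrier G" using v sub by auto
  have "inv g \<otimes> (g \<otimes> (v \<otimes> inv g)) = v \<otimes> inv g" using vc assms(2)
    by (simp add: m_assoc[symmetric])
  then have "a \<otimes> b = g \<otimes> (u \<otimes> v) \<otimes> inv g" unfolding u(2) v(2) using uc vc assms(2)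
    by (simp add: m_assoc)
  then show "a \<otimes> b \<in> conj_img G g U" using subgroup.m_closed[OF assms(1) u(1) v(1)]
    unfolding conj_img_def by auto
qed

lemma inj_on_conj: "g \<in> carrier G \<Longrightarrow> inj_on (\<lambda>x. g \<otimes> x \<otimes> inv g) (carrier G)"
  by (auto simp: inj_on_def)

lemma card_conj_img:
  assumes "U \<subseteq> carrier G" "g \<in> carrier G"
  shows "card (conj_img G g U) = card U"
  unfolding conj_img_def using inj_on_subset[OF inj_on_conj[OF assms(2)] assms(1)]
  by (rule card_image)

lemma conjugateI:
  "subgroup U G \<Longrightarrow> g \<in> carrier G \<Longrightarrow> conjugate G U (conj_img G g U)"
  unfolding conjugate_def using conj_img_subgroup by auto

lemma conjugate_refl: "subgroup U G \<Longrightarrow> conjugate G U U"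
  using conjugateI[of U \<one>] conj_img_one[OF subgroup.subset] by simp

lemma conjugate_sym: assumes "conjugate G U V" shows "conjugate G V U"
proof -
  obtain g where g: "subgroup U G" "subgroup V G" "g \<in> carrier G" "V = conj_img G g U"
    using assms unfolding conjugate_def by auto
  then show ?thesis unfolding conjugate_def
    using conj_img_cancel[of U g] subgroup.subset by (intro conjI bexI[of _ "inv g"]) auto
qed

lemma conjugate_trans: assumes "conjugate G U V" "conjugate G V W" shows "conjugate G U W"
proof -
  obtain g h where g: "subgroup U G" "g \<in> carrier G" "V = conj_img G g U"
     "subgroup W G" "h \<in> carrier G" "W = conj_img G h V"
    using assms unfolding conjugate_def by auto
  then show ?thesis unfolding conjugate_def
    using conj_img_mult[of U h g] subgroup.subset by (intro conjI bexI[of _ "h \<otimes> g"]) auto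
qed

lemma conjugate_subgroup: "conjugate G U V \<Longrightarrow> subgroup U G" "conjugate G U V \<Longrightarrow> subgroup V G"
  unfolding conjugate_def by auto

lemma conj_class_alt: "subgroup U G \<Longrightarrow> conj_class G U = {V. conjugate G U V}"
  unfolding conj_class_def conjugate_def using conj_img_subgroup by auto

lemma conj_class_eq:
  assumes "conjugate G U V" shows "conj_class G U = conj_class G V"
proof -
  have "conj_class G U = {W. conjugate G U W}" "conj_class G V = {W. conjugate G V W}"
    using conj_class_alt conjugate_subgroup[OF assms] by auto
  then show ?thesis using assms conjugate_trans conjugate_sym by blast
qed

lemma rep_conj_class:
  assumes "subgroup U G" shows "conjugate G U (rep (conj_class G U))"
proof -
  have "rep {V. conjugate G U V} \<in> {V. conjugate G U V}"
    unfolding rep_def by (rule someI[of "\<lambda>V. V \<in> {V. conjugate G U V}" U]) (simp add: conjugate_refl[OF assms])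
  then show ?thesis using conj_class_alt[OF assms] by simp
qed

definition normalizer_of :: "'a set \<Rightarrow> 'a set" where
  "normalizer_of L = {g \<in> carrier G. conj_img G g L = L}"

end

context fin_group
begin

lemma fin_subgroup: "subgroup U G \<Longrightarrow> finite U"
  using fin finite_subset subgroup.subset by metis

lemma card_subgroup_pos: "subgroup U G \<Longrightarrow> card U > 0"
  using fin_subgroup subgroup.one_closed card_gt_0_iff by blast

lemma fin_subgroups: "finite {U. subgroup U G}"
  by (rule finite_subset[of _ "Pow (carrier G)"]) (auto dest: subgroup.subset)

lemma subgroup_fin_group: "subgroup U G \<Longrightarrow> fin_group (G\<lparr>carrier := U\<rparr>)"
  unfolding fin_group_def fin_group_axioms_def
  using subgroup.subgroup_is_group fin_subgroup is_group by auto

lemma order_pos: "order G > 0"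
  using card_subgroup_pos[OF subgroup_self] unfolding order_def .

lemma card_subgroup_dvd: "subgroup U G \<Longrightarrow> card U dvd order G"
  using lagrange by (metis dvd_triv_right)

lemma conj_img_eqI:
  assumes "U \<subseteq> carrier G" "g \<in> carrier G" "V \<subseteq> carrier G" "conj_img G g U \<subseteq> V" "card V = card U"
  shows "conj_img G g U = V"
  using assms card_conj_img by (metis card_subset_eq fin finite_subset)

lemma normalizer_of_subgroup: assumes "U \<subseteq> carrier G" shows "subgroup (normalizer_of U) G"
proof (rule subgroupI)
  show "normalizer_of U \<subseteq> carrier G" unfolding normalizer_of_def by auto
  show "normalizer_of U \<noteq> {}" unfolding normalizer_of_def using conj_img_one assms by blast
  show "inv a \<in> normalizer_of U" if "a \<in> normalizer_of U" for a
    using that conj_img_cancel(1)[OF assms, of a] unfolding normalizer_of_def by simp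
  show "a \<otimes> b \<in> normalizer_of U" if "a \<in> normalizer_of U" "b \<in> normalizer_of U" for a b
    using that conj_img_mult[OF assms, of a b] unfolding normalizer_of_def by simp
qed

lemma subset_normalizer_of: assumes "subgroup U G" shows "U \<subseteq> normalizer_of U"
proof
  fix g assume g: "g \<in> U"
  have "conj_img G g U \<subseteq> U" unfolding conj_img_def
    using g assms by (auto intro!: subgroup.m_closed[OF assms] subgroup.m_inv_closed[OF assms])
  then show "g \<in> normalizer_of U" unfolding normalizer_of_def
    using conj_img_eqI[of U g U] subgroup.subset[OF assms] g by auto
qed

text \<open>The fibre is the left coset of \<open>normalizer_of U\<close> through g.\<close>

lemma card_conj_fibre:
  assumes "U \<subseteq> carrier G" "g \<in> carrier G"
  shows "card {h \<in> carrier G. conj_img G h U = conj_img G g U} = card (normalizer_of U)"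
proof (rule bij_betw_same_card[symmetric])
  show "bij_betw (\<lambda>h. g \<otimes> h) (normalizer_of U) {h \<in> carrier G. conj_img G h U = conj_img G g U}"
  proof (rule bij_betwI[where g = "\<lambda>h. inv g \<otimes> h"])
    show "(\<lambda>h. g \<otimes> h) \<in> normalizer_of U \<rightarrow> {h \<in> carrier G. conj_img G h U = conj_img G g U}"
      using assms conj_img_mult[symmetric] unfolding normalizer_of_def by auto
    show "(\<lambda>h. inv g \<otimes> h) \<in> {h \<in> carrier G. conj_img G h U = conj_img G g U} \<rightarrow> normalizer_of U"
      using assms conj_img_mult[symmetric] unfolding normalizer_of_def by (auto simp: conj_img_cancel)
  qed (use assms in \<open>auto simp: normalizer_of_def m_assoc[symmetric]\<close>)
qed

lemma card_conj_class:
  assumes "U \<subseteq> carrier G"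
  shows "card (normalizer_of U) * card (conj_class G U) = order G"
proof -
  have "card (carrier G) = card (normalizer_of U) * card (conj_class G U)"
    by (rule card_fibres[where f = "\<lambda>g. conj_img G g U"])
       (auto simp: conj_class_def card_conj_fibre[OF assms])
  then show ?thesis unfolding order_def by simp
qed

text \<open>Both orders are the quotient of |G| by the size of the common conjugacy class.\<close>

lemma card_normalizer_of_conj:
  assumes "conjugate G U V" shows "card (normalizer_of V) = card (normalizer_of U)"
proof -
  have "conj_class G U = conj_class G V" using assms by (rule conj_class_eq)
  moreover have "U \<subseteq> carrier G" "V \<subseteq> carrier G" using assms conjugate_subgroup subgroup.subset by blast+
  ultimately have "card (normalizer_of U) * card (conj_class G V) = order G"
     "card (normalizer_of V) * card (conj_class G V) = order G" using card_conj_class by metis+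
  then show ?thesis using order_pos by (metis mult_cancel2 mult_is_0 less_numeral_extra(3))
qed

lemma conjugate_card: assumes "conjugate G U V" shows "card V = card U"
  using assms card_conj_img subgroup.subset unfolding conjugate_def by metis

end

section \<open>Orbits and stabilisers of finite actions\<close>

locale fin_action = fin_group +
  fixes X :: "'x set" and act :: "'a \<Rightarrow> 'x \<Rightarrow> 'x"
  assumes finX: "finite X"
    and act_closed: "\<And>g x. g \<in> carrier G \<Longrightarrow> x \<in> X \<Longrightarrow> act g x \<in> X"
    and act_one: "\<And>x. x \<in> X \<Longrightarrow> act \<one> x = x"
    and act_mult: "\<And>g h x. g \<in> carrier G \<Longrightarrow> h \<in> carrier G \<Longrightarrow> x \<in> X \<Longrightarrow> act (g \<otimes> h) x = act g (act h x)"
begin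

definition stab :: "'x \<Rightarrow> 'a set" where "stab x = {g \<in> carrier G. act g x = x}"
definition orb :: "'x \<Rightarrow> 'x set" where "orb x = {act g x | g. g \<in> carrier G}"
definition orbs :: "'x set set" where "orbs = {orb x | x. x \<in> X}"

lemma act_inv: "g \<in> carrier G \<Longrightarrow> x \<in> X \<Longrightarrow> act (inv g) (act g x) = x"
  using act_mult[of "inv g" g x] act_one by simp

lemma stab_act: assumes "x \<in> X" "g \<in> carrier G" shows "stab (act g x) = conj_img G g (stab x)"
proof -
  have "h \<in> stab (act g x) \<longleftrightarrow> h \<in> conj_img G g (stab x)" if h: "h \<in> carrier G" for h
  proof -
    have "act h (act g x) = act g (act (inv g \<otimes> h \<otimes> g) x)"
      using assms h by (simp add: act_mult[symmetric] m_assoc[symmetric])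
    moreover have "act g (act (inv g \<otimes> h \<otimes> g) x) = act g x \<longleftrightarrow> act (inv g \<otimes> h \<otimes> g) x = x"
      using act_inv assms h act_closed by (metis inv_closed m_closed)
    moreover have "stab x \<subseteq> carrier G" unfolding stab_def by auto
    ultimately show ?thesis using mem_conj_img[of "stab x" g h] h assms unfolding stab_def by auto
  qed
  moreover have "conj_img G g (stab x) \<subseteq> carrier G" "stab (act g x) \<subseteq> carrier G"
    using conj_img_carrier[of "stab x" g] assms unfolding stab_def by auto
  ultimately show ?thesis by blast
qed

lemma card_act_fibre:
  assumes "x \<in> X" "h \<in> carrier G"
  shows "card {g \<in> carrier G. act g x = act h x} = card (stab x)"
proof (rule bij_betw_same_card[symmetric])
  show "bij_betw (\<lambda>g. h \<otimes> g) (stab x) {g \<in> carrier G. act g x = act h x}"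
    by (rule bij_betwI[where g = "\<lambda>g. inv h \<otimes> g"])
       (use assms in \<open>auto simp: stab_def act_mult act_inv m_assoc[symmetric]\<close>)
qed

lemma orbit_stab: assumes "x \<in> X" shows "card (orb x) * card (stab x) = order G"
proof -
  have "card (carrier G) = card (stab x) * card (orb x)"
    by (rule card_fibres[where f = "\<lambda>g. act g x"]) (use assms in \<open>auto simp: orb_def card_act_fibre\<close>)
  then show ?thesis unfolding order_def by simp
qed

lemma orb_self: "x \<in> X \<Longrightarrow> x \<in> orb x"
  unfolding orb_def by (rule CollectI, rule exI[of _ \<one>]) (simp add: act_one)

lemma orb_sub: "x \<in> X \<Longrightarrow> orb x \<subseteq> X" unfolding orb_def using act_closed by auto

lemma orb_eq: assumes "x \<in> X" "y \<in> orb x" shows "orb y = orb x"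
proof -
  obtain g where g: "g \<in> carrier G" "y = act g x" using assms unfolding orb_def by auto
  have "act h y = act (h \<otimes> g) x" "act h x = act (h \<otimes> inv g) y" if "h \<in> carrier G" for h
    using g that assms by (auto simp: act_mult act_inv act_closed)
  then show ?thesis unfolding orb_def using g by (metis (no_types, opaque_lifting) inv_closed m_closed)
qed

lemma orb_in_orbs_iff: assumes "x \<in> X" "\<Omega> \<in> orbs" shows "orb x = \<Omega> \<longleftrightarrow> x \<in> \<Omega>"
  using assms orb_eq orb_self unfolding orbs_def by blast

lemma fin_orbs: "finite orbs" unfolding orbs_def using finX by auto

lemma orbs_sub: "\<Omega> \<in> orbs \<Longrightarrow> \<Omega> \<subseteq> X" unfolding orbs_def using orb_sub by auto

text \<open>Stabilisers along an orbit are conjugate, so every orbit contributes orbit length times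
  stabiliser order, which is |G|.\<close>

lemma card_orbs: "card orbs * order G = (\<Sum>x\<in>X. card (stab x))"
proof -
  have "(\<Sum>x\<in>X. card (stab x)) = (\<Sum>\<Omega>\<in>orbs. \<Sum>x\<in>{x \<in> X. orb x = \<Omega>}. card (stab x))"
    by (rule sum.group[symmetric]) (auto simp: finX fin_orbs, auto simp: orbs_def)
  also have "\<dots> = (\<Sum>\<Omega>\<in>orbs. order G)"
  proof (rule sum.cong[OF refl])
    fix \<Omega> assume O: "\<Omega> \<in> orbs"
    then obtain y where y: "y \<in> X" "\<Omega> = orb y" unfolding orbs_def by auto
    have eq: "{x \<in> X. orb x = \<Omega>} = \<Omega>" using orb_in_orbs_iff O orbs_sub by blast
    have "card (stab x) = card (stab y)" if xO: "x \<in> \<Omega>" for x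
    proof -
      obtain g where g: "g \<in> carrier G" "x = act g y" using xO y(2) unfolding orb_def by auto
      then show ?thesis using stab_act[OF y(1) g(1)] card_conj_img[of "stab y" g]
        unfolding stab_def by auto
    qed
    then have "(\<Sum>x\<in>{x \<in> X. orb x = \<Omega>}. card (stab x)) = card (orb y) * card (stab y)"
      unfolding eq using y(2) by simp
    then show "(\<Sum>x\<in>{x \<in> X. orb x = \<Omega>}. card (stab x)) = order G"
      using orbit_stab[OF y(1)] by simp
  qed
  finally show ?thesis by simp
qed

lemma cauchy_frobenius: "(\<Sum>g\<in>carrier G. card {x \<in> X. act g x = x}) = card orbs * order G"
proof -
  have "(\<Sum>g\<in>carrier G. card {x \<in> X. act g x = x}) = (\<Sum>x\<in>X. card {g \<in> carrier G. act g x = x})"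
    by (rule sum_multicount_gen) (auto simp: finX)
  then show ?thesis using card_orbs unfolding stab_def by simp
qed

text \<open>Inside an orbit that meets the conjugates of N, the points with stabiliser exactly N
  form one orbit of the normalizer of N, on which each stabiliser is N. There are |N_G(N) : N| of
  them. This trades the multiplicity of a transitive set for a count of points.\<close>

lemma card_stab_eq:
  assumes "subgroup N G"
  shows "card {x \<in> X. stab x = N} * card N
       = card (normalizer_of N) * card {\<Omega> \<in> orbs. \<exists>x\<in>\<Omega>. conjugate G (stab x) N}"
proof -
  have "card {x \<in> X. stab x = N} = (\<Sum>\<Omega>\<in>orbs. card {x \<in> {x \<in> X. stab x = N}. orb x = \<Omega>})"
    using finX fin_orbs by (intro card_eq_sum_fibres) (auto simp: orbs_def)
  also have "\<dots> = (\<Sum>\<Omega>\<in>orbs. card {x \<in> \<Omega>. stab x = N})"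
    using orb_in_orbs_iff orbs_sub by (intro sum.cong refl arg_cong[where f = card]) blast
  finally have 1: "card {x \<in> X. stab x = N} * card N = (\<Sum>\<Omega>\<in>orbs. card {x \<in> \<Omega>. stab x = N} * card N)"
    by (simp add: sum_distrib_right)
  have 2: "card {x \<in> \<Omega>. stab x = N} * card N
         = (if \<exists>x\<in>\<Omega>. conjugate G (stab x) N then card (normalizer_of N) else 0)" if O: "\<Omega> \<in> orbs" for \<Omega>
  proof (cases "\<exists>x\<in>\<Omega>. conjugate G (stab x) N")
    case False
    then have "{x \<in> \<Omega>. stab x = N} = {}" using conjugate_refl[OF assms] by auto
    then show ?thesis using False by (metis card.empty mult_zero_left)
  next
    case True
    then obtain x g where x: "x \<in> \<Omega>" "g \<in> carrier G" "N = conj_img G g (stab x)"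
      unfolding conjugate_def by auto
    \<comment> \<open>A point of the same orbit whose stabiliser is N itself and not just a
      conjugate of it.\<close>
    define y where "y = act g x"
    have xX: "x \<in> X" using x O orbs_sub by auto
    have Ox: "\<Omega> = orb x" using orb_in_orbs_iff[OF xX O] x by simp
    have y: "y \<in> X" "stab y = N" "y \<in> orb x" using x xX act_closed stab_act unfolding y_def orb_def by auto
    have Oy: "\<Omega> = orb y" using orb_eq[OF xX y(3)] Ox by simp
    have "card (normalizer_of N) = card N * card {x \<in> \<Omega>. stab x = N}"
    proof (rule card_fibres[where f = "\<lambda>g. act g y"])
      show "finite (normalizer_of N)" using normalizer_of_subgroup[OF subgroup.subset[OF assms]] by (rule fin_subgroup)
      show im: "(\<lambda>g. act g y) ` normalizer_of N = {x \<in> \<Omega>. stab x = N}"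
        using y(1,2) stab_act[OF y(1)] unfolding Oy orb_def normalizer_of_def by auto
      fix b assume "b \<in> {x \<in> \<Omega>. stab x = N}"
      then obtain h where h: "h \<in> normalizer_of N" "b = act h y" unfolding im[symmetric] by auto
      then have hc: "h \<in> carrier G" and hN: "conj_img G h N = N" unfolding normalizer_of_def by auto
      have "conj_img G a N = N" if "a \<in> carrier G" "act a y = act h y" for a
        using that stab_act[OF y(1)] hc hN unfolding y(2) by metis
      then have "{a \<in> normalizer_of N. act a y = b} = {a \<in> carrier G. act a y = act h y}"
        unfolding normalizer_of_def h(2) by blast
      then show "card {a \<in> normalizer_of N. act a y = b} = card N"
        using card_act_fibre[OF y(1) hc] y(2) by simp
    qed
    then show ?thesis using True by simp
  qed
  have "card {x \<in> X. stab x = N} * card N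
      = (\<Sum>\<Omega>\<in>orbs. if \<exists>x\<in>\<Omega>. conjugate G (stab x) N then card (normalizer_of N) else 0)"
    unfolding 1 using 2 by (intro sum.cong) auto
  also have "\<dots> = (\<Sum>\<Omega>\<in>{\<Omega> \<in> orbs. \<exists>x\<in>\<Omega>. conjugate G (stab x) N}. card (normalizer_of N))"
    using fin_orbs by (rule sum.inter_filter[symmetric])
  finally show ?thesis by simp
qed

end

section \<open>Marks on a family of subgroups\<close>

text \<open>Treats both Burnside rings at once. The family is all subgroups of G for B(G), and all
  bifree subgroups of G x G for the bifree double Burnside ring; the sublocales \<open>S\<close> and
  \<open>D\<close> below are these two instances.\<close>

locale group_family = fin_group +
  fixes F :: "'a set set"
  assumes F_subgroup: "\<And>L. L \<in> F \<Longrightarrow> subgroup L G"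
    and F_conj: "\<And>L g. L \<in> F \<Longrightarrow> g \<in> carrier G \<Longrightarrow> conj_img G g L \<in> F"
begin

lemma finF: "finite F"
  using fin_subgroups by (rule finite_subset[rotated]) (auto dest: F_subgroup)

lemma F_sub: "L \<in> F \<Longrightarrow> L \<subseteq> carrier G"
  using F_subgroup subgroup.subset by blast

lemma F_conjugate: "L \<in> F \<Longrightarrow> conjugate G L M \<Longrightarrow> M \<in> F"
  unfolding conjugate_def using F_conj by auto

lemma card_conj_over:
  assumes "U \<in> F" "H \<subseteq> carrier G"
  shows "card {g \<in> carrier G. H \<subseteq> conj_img G g U}
       = card (normalizer_of U) * card {M \<in> conj_class G U. H \<subseteq> M}"
proof (rule card_fibres[where f = "\<lambda>g. conj_img G g U"])
  show im: "(\<lambda>g. conj_img G g U) ` {g \<in> carrier G. H \<subseteq> conj_img G g U} = {M \<in> conj_class G U. H \<subseteq> M}"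
    unfolding conj_class_def by auto
  fix b assume b: "b \<in> {M \<in> conj_class G U. H \<subseteq> M}"
  then obtain g where g: "g \<in> carrier G" "b = conj_img G g U" unfolding conj_class_def by auto
  have "{a \<in> {g \<in> carrier G. H \<subseteq> conj_img G g U}. conj_img G a U = b}
      = {a \<in> carrier G. conj_img G a U = conj_img G g U}" using b g by auto
  then show "card {a \<in> {g \<in> carrier G. H \<subseteq> conj_img G g U}. conj_img G a U = b} = card (normalizer_of U)"
    using card_conj_fibre[OF F_sub[OF assms(1)] g(1)] by simp
qed simp

lemma lcos_fixed_iff:
  assumes "U \<in> F" "g \<in> carrier G" "h \<in> carrier G"
  shows "(\<lambda>c. h \<otimes> c) ` (g <# U) = g <# U \<longleftrightarrow> h \<in> conj_img G g U"
proof -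
  have sg: "subgroup U G" and sub: "U \<subseteq> carrier G" using assms F_subgroup F_sub by auto
  have eq: "g <# U = (\<lambda>u. g \<otimes> u) ` U" unfolding l_coset_def by auto
  have im: "(\<lambda>c. h \<otimes> c) ` (g <# U) = (\<lambda>u. h \<otimes> g \<otimes> u) ` U"
    unfolding eq image_image using assms sub by (intro image_cong refl) (simp add: m_assoc subset_iff)
  show ?thesis
  proof
    assume a: "(\<lambda>c. h \<otimes> c) ` (g <# U) = g <# U"
    have "h \<otimes> g \<otimes> \<one> \<in> (\<lambda>u. h \<otimes> g \<otimes> u) ` U" using subgroup.one_closed[OF sg] by (rule imageI)
    then have "h \<otimes> g \<otimes> \<one> \<in> (\<lambda>u. g \<otimes> u) ` U" using a[unfolded im, unfolded eq] by simp
    then obtain u where "u \<in> U" "h \<otimes> g = g \<otimes> u" using assms by auto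
    then have "inv g \<otimes> h \<otimes> g = u" using assms sub by (simp add: m_assoc subset_iff) (simp add: m_assoc[symmetric])
    then show "h \<in> conj_img G g U" using mem_conj_img[OF sub assms(2,3)] \<open>u \<in> U\<close> by simp
  next
    assume "h \<in> conj_img G g U"
    then obtain u where u: "u \<in> U" "h = g \<otimes> u \<otimes> inv g" unfolding conj_img_def by auto
    have "h \<otimes> g \<otimes> v = g \<otimes> (u \<otimes> v)" if "v \<in> U" for v
      unfolding u(2) using u assms sub that by (simp add: m_assoc subset_iff)
    then have "(\<lambda>u. h \<otimes> g \<otimes> u) ` U = (\<lambda>v. g \<otimes> v) ` ((\<lambda>v. u \<otimes> v) ` U)"
      unfolding image_image by (intro image_cong) auto
    also have "(\<lambda>v. u \<otimes> v) ` U = U"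
    proof
      show "(\<lambda>v. u \<otimes> v) ` U \<subseteq> U" using subgroup.m_closed[OF sg u(1)] by auto
      show "U \<subseteq> (\<lambda>v. u \<otimes> v) ` U"
      proof
        fix v assume v: "v \<in> U"
        have "v = u \<otimes> (inv u \<otimes> v)" using u(1) v sub by (simp add: m_assoc[symmetric] subset_iff)
        then show "v \<in> (\<lambda>v. u \<otimes> v) ` U"
          using subgroup.m_closed[OF sg subgroup.m_inv_closed[OF sg u(1)] v] by blast
      qed
    qed
    finally show "(\<lambda>c. h \<otimes> c) ` (g <# U) = g <# U" unfolding im unfolding eq .
  qed
qed

lemma card_lcos_fibre:
  assumes "subgroup U G" "g \<in> carrier G"
  shows "card {h \<in> carrier G. h <# U = g <# U} = card U"
proof -
  have "{h \<in> carrier G. h <# U = g <# U} = g <# U"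
  proof (rule subset_antisym; rule subsetI)
    fix h assume h: "h \<in> {h \<in> carrier G. h <# U = g <# U}"
    have "h \<otimes> \<one> \<in> h <# U" using subgroup.one_closed[OF assms(1)] unfolding l_coset_def by auto
    then show "h \<in> g <# U" using h by simp
  next
    fix h assume h: "h \<in> g <# U"
    then have "h \<in> carrier G" using l_coset_subset_G[OF subgroup.subset[OF assms(1)] assms(2)] by auto
    then show "h \<in> {h \<in> carrier G. h <# U = g <# U}"
      using l_repr_independence[OF h assms(2,1)] by simp
  qed
  moreover have "card (g <# U) = card U"
  proof -
    have "g <# U = (\<lambda>u. g \<otimes> u) ` U" unfolding l_coset_def by auto
    moreover have "inj_on (\<lambda>u. g \<otimes> u) U" using assms subgroup.subset[OF assms(1)]
      by (auto simp: inj_on_def subset_iff)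
    ultimately show ?thesis using card_image by metis
  qed
  ultimately show ?thesis by simp
qed

lemma fin_lcosets: "finite (lcosets G U)"
  unfolding lcosets_def setcompr_eq_image by simp

text \<open>Double count of the g in G with H inside the g-conjugate of U. Sorted by the coset gU
  they fall into fibres of size |U|, sorted by the conjugate into fibres of size |N_G(U)|.\<close>

lemma mark_basis_card:
  assumes "U \<in> F" "H \<subseteq> carrier G"
  shows "mark_basis G H U * card U = card (normalizer_of U) * card {M \<in> conj_class G U. H \<subseteq> M}"
proof -
  have sg: "subgroup U G" using assms F_subgroup by auto
  have iff: "(\<forall>h\<in>H. (\<lambda>c. h \<otimes> c) ` (g <# U) = g <# U) \<longleftrightarrow> H \<subseteq> conj_img G g U"
    if "g \<in> carrier G" for g using lcos_fixed_iff[OF assms(1) that] assms(2) by blast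
  have "card {g \<in> carrier G. H \<subseteq> conj_img G g U} = card U * mark_basis G H U"
    unfolding mark_basis_def
  proof (rule card_fibres[where f = "\<lambda>g. g <# U"])
    show im: "(\<lambda>g. g <# U) ` {g \<in> carrier G. H \<subseteq> conj_img G g U}
        = {C \<in> lcosets G U. \<forall>h\<in>H. (\<lambda>c. h \<otimes> c) ` C = C}"
      unfolding lcosets_def using iff by auto
    fix b assume "b \<in> {C \<in> lcosets G U. \<forall>h\<in>H. (\<lambda>c. h \<otimes> c) ` C = C}"
    then have "b \<in> (\<lambda>g. g <# U) ` {g \<in> carrier G. H \<subseteq> conj_img G g U}" unfolding im .
    then obtain g where g: "g \<in> carrier G" "H \<subseteq> conj_img G g U" "b = g <# U" by auto
    have "H \<subseteq> conj_img G a U" if "a \<in> carrier G" "a <# U = g <# U" for a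
      using iff[OF that(1)] iff[OF g(1)] g(2) that(2) by simp
    then have "{a \<in> {g \<in> carrier G. H \<subseteq> conj_img G g U}. a <# U = b} = {a \<in> carrier G. a <# U = g <# U}"
      unfolding g(3) by blast
    then show "card {a \<in> {g \<in> carrier G. H \<subseteq> conj_img G g U}. a <# U = b} = card U"
      using card_lcos_fibre[OF sg g(1)] by simp
  qed simp
  then show ?thesis using card_conj_over[OF assms] by simp
qed

lemma conj_class_mem: "U \<in> F \<Longrightarrow> M \<in> conj_class G U \<longleftrightarrow> conjugate G U M"
  using conj_class_alt[OF F_subgroup] by simp

definition fclasses :: "'a set set set" where "fclasses = {conj_class G U | U. U \<in> F}"

lemma fclasses_rep:
  assumes "C \<in> fclasses" shows "rep C \<in> F" "C = conj_class G (rep C)"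
proof -
  obtain U where U: "U \<in> F" "C = conj_class G U" using assms unfolding fclasses_def by auto
  have c: "conjugate G U (rep C)" using rep_conj_class[OF F_subgroup[OF U(1)]] U(2) by simp
  show "rep C \<in> F" using F_conjugate[OF U(1) c] .
  show "C = conj_class G (rep C)" using conj_class_eq[OF c] U(2) by simp
qed

lemma fin_fclasses: "finite fclasses" unfolding fclasses_def using finF by auto

lemma fclass_sub: "C \<in> fclasses \<Longrightarrow> C \<subseteq> F"
  using fclasses_rep F_conjugate conj_class_mem by blast

text \<open>Passes from sums over conjugacy classes, as in the definitions of marks and products, to
  sums over single subgroups.\<close>

lemma sum_fclasses: "(\<Sum>C\<in>fclasses. \<Sum>M\<in>{M \<in> C. P M}. f M) = (\<Sum>M\<in>{M \<in> F. P M}. f M)"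
proof -
  have "(\<Sum>M\<in>{M \<in> F. P M}. f M) = (\<Sum>C\<in>fclasses. \<Sum>M\<in>{M \<in> {M \<in> F. P M}. conj_class G M = C}. f M)"
    by (rule sum.group[symmetric]) (use finF fin_fclasses in \<open>auto simp: fclasses_def\<close>)
  moreover have "{M \<in> {M \<in> F. P M}. conj_class G M = C} = {M \<in> C. P M}" if C: "C \<in> fclasses" for C
  proof -
    note r = fclasses_rep[OF C]
    have "M \<in> F \<and> conj_class G M = C \<longleftrightarrow> M \<in> C" for M
    proof
      assume a: "M \<in> F \<and> conj_class G M = C"
      then show "M \<in> C" using conj_class_mem[of M M] conjugate_refl[OF F_subgroup] by blast
    next
      assume M: "M \<in> C"
      then have "conjugate G (rep C) M" using r conj_class_mem by metis
      then show "M \<in> F \<and> conj_class G M = C" using conj_class_eq r fclass_sub[OF C] M by blast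
    qed
    then show ?thesis by auto
  qed
  ultimately show ?thesis by simp
qed

end

section \<open>The triangular system of marks over a field in which |G| is nonzero\<close>

locale group_family_inv = group_family +
  fixes K :: "'k::field itself"
  assumes ord_inv: "(of_nat (order G) :: 'k) \<noteq> 0"
begin

text \<open>Sums run over all subgroups of the family instead of over their classes: the mark of \<open>G/M\<close> at \<open>L\<close>
  is \<open>weight M\<close> times the number of conjugates of \<open>M\<close> containing \<open>L\<close>.\<close>

definition weight :: "'a set \<Rightarrow> 'k" where
  "weight M = of_nat (card (normalizer_of M)) / of_nat (card M)"

definition fmark :: "('a set \<Rightarrow> 'k) \<Rightarrow> 'a set \<Rightarrow> 'k" where
  "fmark x L = (\<Sum>M\<in>{M \<in> F. L \<subseteq> M}. x M * weight M)"

definition fspace :: "('a set \<Rightarrow> 'k) set" where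
  "fspace = {x. (\<forall>L. x L \<noteq> 0 \<longrightarrow> L \<in> F) \<and> (\<forall>L M. conjugate G L M \<longrightarrow> x L = x M)}"

lemma weight_conj: "conjugate G L M \<Longrightarrow> weight M = weight L"
  unfolding weight_def by (simp add: conjugate_card card_normalizer_of_conj)

lemma fspace_supp: "x \<in> fspace \<Longrightarrow> L \<notin> F \<Longrightarrow> x L = 0"
  unfolding fspace_def by auto

lemma fspace_conj: "x \<in> fspace \<Longrightarrow> conjugate G L M \<Longrightarrow> x L = x M"
  unfolding fspace_def by auto

lemma card_subgroup_nz: "subgroup U G \<Longrightarrow> (of_nat (card U) :: 'k) \<noteq> 0"
  using ord_inv card_subgroup_dvd by (metis dvd_def mult_zero_left of_nat_mult)

lemma weight_nz: "L \<in> F \<Longrightarrow> (weight L :: 'k) \<noteq> 0"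
  unfolding weight_def using card_subgroup_nz F_subgroup normalizer_of_subgroup F_sub by simp

lemma mark_basis_weight:
  assumes "U \<in> F" "H \<subseteq> carrier G"
  shows "(of_nat (mark_basis G H U) :: 'k) = (\<Sum>M\<in>{M \<in> conj_class G U. H \<subseteq> M}. weight M)"
proof -
  have "(\<Sum>M\<in>{M \<in> conj_class G U. H \<subseteq> M}. weight M :: 'k) = (\<Sum>M\<in>{M \<in> conj_class G U. H \<subseteq> M}. weight U)"
    by (intro sum.cong refl) (simp add: conj_class_mem[OF assms(1)] weight_conj)
  also have "\<dots> = of_nat (card {M \<in> conj_class G U. H \<subseteq> M}) * weight U" by simp
  also have "\<dots> * of_nat (card U) = of_nat (mark_basis G H U * card U)"
    unfolding mark_basis_card[OF assms] weight_def using card_subgroup_nz[OF F_subgroup[OF assms(1)]] by simp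
  finally show ?thesis using card_subgroup_nz[OF F_subgroup[OF assms(1)]] by simp
qed

lemma fmark_classes:
  assumes "x \<in> fspace" "H \<subseteq> carrier G"
  shows "fmark x H = (\<Sum>C\<in>fclasses. x (rep C) * (of_nat (mark_basis G H (rep C)) :: 'k))"
proof -
  have "x (rep C) * (of_nat (mark_basis G H (rep C)) :: 'k) = (\<Sum>M\<in>{M \<in> C. H \<subseteq> M}. x M * weight M)"
    if C: "C \<in> fclasses" for C
  proof -
    note r = fclasses_rep[OF C]
    have "x (rep C) * of_nat (mark_basis G H (rep C)) = (\<Sum>M\<in>{M \<in> C. H \<subseteq> M}. x (rep C) * weight M)"
      using mark_basis_weight[OF r(1) assms(2)] r(2) by (simp add: sum_distrib_left)
    also have "\<dots> = (\<Sum>M\<in>{M \<in> C. H \<subseteq> M}. x M * weight M)"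
    proof (intro sum.cong refl)
      fix M assume "M \<in> {M \<in> C. H \<subseteq> M}"
      then have "conjugate G (rep C) M" using r conj_class_mem by blast
      then show "x (rep C) * weight M = x M * weight M" using fspace_conj[OF assms(1)] by simp
    qed
    finally show ?thesis .
  qed
  then show ?thesis unfolding fmark_def sum_fclasses[symmetric] by simp
qed

lemma fmark_conj:
  assumes "x \<in> fspace" "L \<subseteq> carrier G" "g \<in> carrier G"
  shows "fmark x (conj_img G g L) = (fmark x L :: 'k)"
  unfolding fmark_def
proof (rule sum.reindex_bij_witness[where i = "\<lambda>M. conj_img G g M" and j = "\<lambda>M. conj_img G (inv g) M"])
  fix M assume M: "M \<in> {M \<in> F. conj_img G g L \<subseteq> M}"
  have Mc: "M \<subseteq> carrier G" using M F_sub by auto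
  show "conj_img G g (conj_img G (inv g) M) = M" using conj_img_cancel Mc assms by auto
  show "conj_img G (inv g) M \<in> {M \<in> F. L \<subseteq> M}"
    using M F_conj conj_img_subset_iff[OF assms(2) Mc, of "inv g"] assms by simp
  have c: "conjugate G M (conj_img G (inv g) M)" using conjugateI F_subgroup M assms by simp
  show "x (conj_img G (inv g) M) * weight (conj_img G (inv g) M) = x M * weight M"
    using fspace_conj[OF assms(1) c] weight_conj[OF c] by simp
next
  fix M assume M: "M \<in> {M \<in> F. L \<subseteq> M}"
  have Mc: "M \<subseteq> carrier G" using M F_sub by auto
  show "conj_img G (inv g) (conj_img G g M) = M" using conj_img_cancel Mc assms by auto
  show "conj_img G g M \<in> {M \<in> F. conj_img G g L \<subseteq> M}"
    using M F_conj conj_img_mono assms by simp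
qed

text \<open>The table of marks is triangular with invertible diagonal \<open>weight L\<close>. This
  recursion gives injectivity of the marks, the elements with prescribed marks, and later the
  descent that proves integrality.\<close>

lemma fmark_rec:
  assumes "L \<in> F"
  shows "fmark x L = x L * weight L + (\<Sum>M\<in>{M \<in> F. L \<subset> M}. x M * (weight M :: 'k))"
proof -
  have "{M \<in> F. L \<subseteq> M} = insert L {M \<in> F. L \<subset> M}" using assms by auto
  then show ?thesis unfolding fmark_def using finF by simp
qed

text \<open>Induction from large members of the family to small ones, the direction in which the
  recursion for marks is solved.\<close>

lemma F_top_induct [consumes 1, case_names step]:
  assumes "L \<in> F" and step: "\<And>L. L \<in> F \<Longrightarrow> (\<And>M. M \<in> F \<Longrightarrow> L \<subset> M \<Longrightarrow> P M) \<Longrightarrow> P L"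
  shows "P L"
  using assms(1)
proof (induction "order G - card L" arbitrary: L rule: less_induct)
  case less
  show ?case
  proof (rule step[OF less.prems])
    fix M assume M: "M \<in> F" "L \<subset> M"
    have "card L < card M" using M psubset_card_mono[OF fin_subgroup[OF F_subgroup]] by simp
    moreover have "card M \<le> order G" unfolding order_def using M F_sub card_mono[OF fin] by simp
    ultimately have "order G - card M < order G - card L" by arith
    then show "P M" using less.hyps M by simp
  qed
qed

lemma fmark_inj:
  assumes "x \<in> fspace" "y \<in> fspace" "\<And>L. L \<in> F \<Longrightarrow> fmark x L = (fmark y L :: 'k)"
  shows "x = y"
proof
  fix L show "x L = y L"
  proof (cases "L \<in> F")
    case True then show ?thesis
    proof (induction rule: F_top_induct)
      case (step L)
      have "(\<Sum>M\<in>{M \<in> F. L \<subset> M}. x M * (weight M :: 'k)) = (\<Sum>M\<in>{M \<in> F. L \<subset> M}. y M * weight M)"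
        using step(2) by (intro sum.cong) auto
      then have "x L * weight L = y L * weight L"
        using fmark_rec[OF step(1), of x] fmark_rec[OF step(1), of y] assms(3)[OF step(1)]
        by (metis add_right_imp_eq)
      then show ?case using weight_nz[OF step(1)] by simp
    qed
  next
    case False then show ?thesis using assms(1,2) fspace_supp by metis
  qed
qed

text \<open>Solves the triangular recursion for the coefficient at L, given the values m that the
  marks shall take. The value 0 off \<open>F\<close> is the support condition of
  \<open>fspace\<close>.\<close>

function of_marks :: "('a set \<Rightarrow> 'k) \<Rightarrow> 'a set \<Rightarrow> 'k" where
  "of_marks m L = (if L \<in> F then (m L - (\<Sum>M\<in>{M \<in> F. L \<subset> M}. of_marks m M * weight M)) / weight L else 0)"
  by auto
termination
proof (relation "Wellfounded.measure (\<lambda>(m, L). order G - card L)")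
  fix m :: "'a set \<Rightarrow> 'k" and L M assume "L \<in> F" and M: "M \<in> {M \<in> F. L \<subset> M}"
  have "card L < card M" using M psubset_card_mono[OF fin_subgroup[OF F_subgroup]] by simp
  moreover have "card M \<le> order G" unfolding order_def using M F_sub card_mono[OF fin] by simp
  ultimately show "((m, M), m, L) \<in> Wellfounded.measure (\<lambda>(m, L). order G - card L)" by simp
qed simp

declare of_marks.simps [simp del]

lemma fmark_of_marks: "L \<in> F \<Longrightarrow> fmark (of_marks m) L = m L"
  by (subst fmark_rec, simp, subst of_marks.simps) (simp add: weight_nz)

text \<open>Conjugation by g maps the members above L bijectively to those above the conjugate of L
  and preserves weights, so the recursion propagates invariance downwards.\<close>

lemma of_marks_fspace:
  assumes "\<And>L g. L \<in> F \<Longrightarrow> g \<in> carrier G \<Longrightarrow> m (conj_img G g L) = m L"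
  shows "of_marks m \<in> fspace"
proof -
  have inv: "\<forall>g\<in>carrier G. of_marks m (conj_img G g L) = of_marks m L" if "L \<in> F" for L
    using that
  proof (induction rule: F_top_induct)
    case (step L)
    show ?case
    proof
      fix g assume g: "g \<in> carrier G"
      have "(\<Sum>M\<in>{M \<in> F. conj_img G g L \<subset> M}. of_marks m M * weight M) = (\<Sum>M\<in>{M \<in> F. L \<subset> M}. of_marks m M * weight M)"
      proof (rule sum.reindex_bij_witness[where i = "\<lambda>M. conj_img G g M" and j = "\<lambda>M. conj_img G (inv g) M"])
        fix M assume M: "M \<in> {M \<in> F. conj_img G g L \<subset> M}"
        have Mc: "M \<subseteq> carrier G" using M F_sub by auto
        show 1: "conj_img G g (conj_img G (inv g) M) = M" using conj_img_cancel Mc g by auto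
        have "L \<subseteq> conj_img G (inv g) M"
          using M conj_img_subset_iff[OF F_sub[OF step(1)] Mc, of "inv g"] g by auto
        then have L: "L \<subset> conj_img G (inv g) M" using 1 M by auto
        then show "conj_img G (inv g) M \<in> {M \<in> F. L \<subset> M}" using M F_conj g by simp
        have M': "conj_img G (inv g) M \<in> F" using M F_conj g by simp
        have "of_marks m M = of_marks m (conj_img G (inv g) M)" using step(2)[OF M' L] g 1 by metis
        moreover have "weight (conj_img G (inv g) M) = (weight M :: 'k)"
          using weight_conj conjugateI F_subgroup M g by simp
        ultimately show "of_marks m (conj_img G (inv g) M) * weight (conj_img G (inv g) M) = of_marks m M * weight M" by simp
      next
        fix M assume M: "M \<in> {M \<in> F. L \<subset> M}"
        have Mc: "M \<subseteq> carrier G" using M F_sub by auto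
        show 1: "conj_img G (inv g) (conj_img G g M) = M" using conj_img_cancel Mc g by auto
        have "conj_img G g L \<subseteq> conj_img G g M" using conj_img_mono M by auto
        moreover have "conj_img G g L \<noteq> conj_img G g M"
          using M conj_img_cancel(1)[OF F_sub[OF step(1)] g] 1 by (metis mem_Collect_eq psubset_eq)
        ultimately show "conj_img G g M \<in> {M \<in> F. conj_img G g L \<subset> M}"
          using M F_conj g by auto
      qed
      moreover have "weight (conj_img G g L) = (weight L :: 'k)" using weight_conj conjugateI F_subgroup step(1) g by simp
      ultimately show "of_marks m (conj_img G g L) = of_marks m L"
        using assms[OF step(1) g] F_conj[OF step(1) g] step(1) by (subst (1 2) of_marks.simps) simp
    qed
  qed
  show ?thesis unfolding fspace_def
  proof (intro CollectI conjI allI impI)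
    fix L assume "of_marks m L \<noteq> 0" then show "L \<in> F" by (subst (asm) of_marks.simps) (auto split: if_splits)
  next
    fix L M assume c: "conjugate G L M"
    show "of_marks m L = of_marks m M"
    proof (cases "L \<in> F")
      case True
      then show ?thesis using inv c unfolding conjugate_def by auto
    next
      case False
      then have "M \<notin> F" using F_conjugate conjugate_sym[OF c] by blast
      then show ?thesis using False by (simp add: of_marks.simps)
    qed
  qed
qed

text \<open>The Cauchy--Frobenius formula for the group \<open>Q\<close> acting on the \<open>N\<close>-fixed points of \<open>G/U\<close>.\<close>

lemma sum_mark_basis:
  assumes U: "U \<in> F" and Q: "subgroup Q G" and N: "N \<subseteq> Q"
    and norm: "\<And>q n. q \<in> Q \<Longrightarrow> n \<in> N \<Longrightarrow> inv q \<otimes> n \<otimes> q \<in> N"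
  shows "\<exists>t. (\<Sum>q\<in>Q. mark_basis G (insert q N) U) = t * card Q"
proof -
  have sQ: "Q \<subseteq> carrier G" and sU: "U \<subseteq> carrier G" using Q subgroup.subset U F_sub by auto
  define X where "X = {C \<in> lcosets G U. \<forall>h\<in>N. (\<lambda>c. h \<otimes> c) ` C = C}"
  have Xc: "C \<subseteq> carrier G" if "C \<in> X" for C
    using that l_coset_subset_G[OF sU] unfolding X_def lcosets_def by auto
  have lc: "(\<lambda>c. h \<otimes> c) ` (g <# U) = (h \<otimes> g) <# U" if "h \<in> carrier G" "g \<in> carrier G" for h g
  proof -
    have "g <# U = (\<lambda>u. g \<otimes> u) ` U" "(h \<otimes> g) <# U = (\<lambda>u. h \<otimes> g \<otimes> u) ` U"
      unfolding l_coset_def by auto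
    then show ?thesis unfolding image_image
      using that sU by (simp add: image_image, intro image_cong refl) (simp add: m_assoc subset_iff)
  qed
  interpret Qa: fin_action "G\<lparr>carrier := Q\<rparr>" X "\<lambda>q C. (\<lambda>c. q \<otimes> c) ` C"
  proof (intro fin_action.intro fin_action_axioms.intro)
    show "fin_group (G\<lparr>carrier := Q\<rparr>)" using subgroup_fin_group[OF Q] .
    show "finite X" unfolding X_def lcosets_def by simp
    show "(\<lambda>c. \<one>\<^bsub>G\<lparr>carrier := Q\<rparr>\<^esub> \<otimes> c) ` C = C" if "C \<in> X" for C
      using Xc[OF that] by (force simp: image_iff subset_iff)
    fix q C assume q': "q \<in> carrier (G\<lparr>carrier := Q\<rparr>)" and C: "C \<in> X"
    then have q: "q \<in> Q" "q \<in> carrier G" using sQ by auto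
    obtain g where g: "g \<in> carrier G" "C = g <# U" using C unfolding X_def lcosets_def by auto
    have "(\<lambda>c. n \<otimes> c) ` (\<lambda>c. q \<otimes> c) ` C = (\<lambda>c. q \<otimes> c) ` C" if n: "n \<in> N" for n
    proof -
      have nc: "n \<in> carrier G" using n N sQ by auto
      \<comment> \<open>\<open>Q\<close> preserves the set of \<open>N\<close>-fixed cosets because
        it normalises \<open>N\<close>: n acts on q C as q n' does on C, with n' again in
        \<open>N\<close>.\<close>
      define n' where "n' = inv q \<otimes> n \<otimes> q"
      have n': "n' \<in> N" "n' \<in> carrier G" unfolding n'_def using norm[OF q(1) n] q nc by auto
      have "n \<otimes> (q \<otimes> c) = q \<otimes> (n' \<otimes> c)" if "c \<in> C" for c
      proof -
        have c: "c \<in> carrier G" using that Xc[OF C] by auto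
        have "q \<otimes> n' = n \<otimes> q" unfolding n'_def using q nc by (simp add: m_assoc[symmetric])
        then have "q \<otimes> n' \<otimes> c = n \<otimes> q \<otimes> c" by simp
        then show ?thesis using c q nc n' by (simp add: m_assoc)
      qed
      then have "(\<lambda>c. n \<otimes> c) ` (\<lambda>c. q \<otimes> c) ` C = (\<lambda>c. q \<otimes> c) ` (\<lambda>c. n' \<otimes> c) ` C"
        unfolding image_image by (intro image_cong) auto
      then show ?thesis using C n' unfolding X_def by simp
    qed
    moreover have "(\<lambda>c. q \<otimes> c) ` C \<in> lcosets G U"
      unfolding g(2) lc[OF q(2) g(1)] lcosets_def using q g by auto
    ultimately show "(\<lambda>c. q \<otimes> c) ` C \<in> X" unfolding X_def by simp
    fix h assume h: "h \<in> carrier (G\<lparr>carrier := Q\<rparr>)"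
    then have "h \<in> carrier G" using sQ by auto
    then have "q \<otimes> h \<otimes> c = q \<otimes> (h \<otimes> c)" if "c \<in> C" for c
      using that Xc[OF C] q by (simp add: m_assoc subset_iff)
    then show "(\<lambda>c. q \<otimes>\<^bsub>G\<lparr>carrier := Q\<rparr>\<^esub> h \<otimes> c) ` C = (\<lambda>c. q \<otimes> c) ` (\<lambda>c. h \<otimes> c) ` C"
      unfolding image_image by (intro image_cong) auto
  qed
  have "{C \<in> X. (\<lambda>c. q \<otimes> c) ` C = C} = {C \<in> lcosets G U. \<forall>h\<in>insert q N. (\<lambda>c. h \<otimes> c) ` C = C}" for q
    unfolding X_def by auto
  then have "(\<Sum>q\<in>Q. mark_basis G (insert q N) U) = card Qa.orbs * card Q"
    using Qa.cauchy_frobenius unfolding mark_basis_def order_def by simp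
  then show ?thesis by blast
qed

text \<open>The orbit count extended linearly from transitive sets to elements with coefficients in
  \<open>R\<close>; the integrality congruences below are instances of it. \<open>insert q N\<close>
  is a mere set, but the points it fixes are those fixed by the subgroup it generates.\<close>

lemma sum_fmark_integral:
  assumes x: "x \<in> fspace" "\<And>L. x L \<in> R"
    and R: "(0::'k) \<in> R" "1 \<in> R" "\<And>a b. a \<in> R \<Longrightarrow> b \<in> R \<Longrightarrow> a + b \<in> R" "\<And>a b. a \<in> R \<Longrightarrow> b \<in> R \<Longrightarrow> a * b \<in> R"
    and Q: "subgroup Q G" and N: "N \<subseteq> Q"
    and norm: "\<And>q n. q \<in> Q \<Longrightarrow> n \<in> N \<Longrightarrow> inv q \<otimes> n \<otimes> q \<in> N"
  shows "\<exists>r\<in>R. (\<Sum>q\<in>Q. fmark x (insert q N)) = of_nat (card Q) * r"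
proof -
  have nR: "of_nat n \<in> R" for n by (induction n) (use R in auto)
  have sQ: "Q \<subseteq> carrier G" using Q by (rule subgroup.subset)
  have "\<forall>C\<in>fclasses. \<exists>t. (\<Sum>q\<in>Q. mark_basis G (insert q N) (rep C)) = t * card Q"
    using sum_mark_basis[OF fclasses_rep(1) Q N norm] by blast
  then obtain t where t: "\<And>C. C \<in> fclasses \<Longrightarrow> (\<Sum>q\<in>Q. mark_basis G (insert q N) (rep C)) = t C * card Q"
    by metis
  have "(\<Sum>q\<in>Q. fmark x (insert q N))
      = (\<Sum>q\<in>Q. \<Sum>C\<in>fclasses. x (rep C) * (of_nat (mark_basis G (insert q N) (rep C)) :: 'k))"
    using N sQ by (intro sum.cong refl fmark_classes[OF x(1)]) auto
  also have "\<dots> = (\<Sum>C\<in>fclasses. x (rep C) * of_nat (\<Sum>q\<in>Q. mark_basis G (insert q N) (rep C)))"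
    by (subst sum.swap) (simp add: sum_distrib_left)
  also have "\<dots> = (\<Sum>C\<in>fclasses. of_nat (card Q) * (x (rep C) * of_nat (t C)))"
    using t by (intro sum.cong) (auto simp: algebra_simps)
  also have "\<dots> = of_nat (card Q) * (\<Sum>C\<in>fclasses. x (rep C) * of_nat (t C))"
    by (simp add: sum_distrib_left)
  finally have eq: "(\<Sum>q\<in>Q. fmark x (insert q N)) = of_nat (card Q) * (\<Sum>C\<in>fclasses. x (rep C) * of_nat (t C))" .
  have "(\<Sum>C\<in>A. x (rep C) * of_nat (t C)) \<in> R" if "finite A" for A
    using that by induction (use R x nR in auto)
  then show ?thesis using eq fin_fclasses by blast
qed

end

section \<open>Bifree subgroups and the ghost product\<close>

context fin_group
begin

abbreviation GG where "GG \<equiv> G \<times>\<times> G"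

lemma GG_fin_group: "fin_group GG"
  unfolding fin_group_def fin_group_axioms_def using DirProd_group[OF is_group is_group] by simp

lemma order_GG: "order GG = order G * order G"
  unfolding order_def by simp

lemma conj_img_GG:
  assumes "g \<in> carrier G" "h \<in> carrier G"
  shows "conj_img GG (g, h) L = (\<lambda>(a, b). (g \<otimes> a \<otimes> inv g, h \<otimes> b \<otimes> inv h)) ` L"
  unfolding conj_img_def inv_DirProd[OF is_group is_group assms]
  by (rule image_cong[OF refl]) (simp split: prod.split)

lemma GG_subgroupI:
  assumes "L \<subseteq> carrier G \<times> carrier G" "(\<one>, \<one>) \<in> L"
    "\<And>a b c d. (a, b) \<in> L \<Longrightarrow> (c, d) \<in> L \<Longrightarrow> (a \<otimes> c, b \<otimes> d) \<in> L"
    "\<And>a b. (a, b) \<in> L \<Longrightarrow> (inv a, inv b) \<in> L"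
  shows "subgroup L GG"
proof -
  interpret D: fin_group GG by (rule GG_fin_group)
  show ?thesis
  proof (rule D.subgroupI)
    fix p q assume "p \<in> L" "q \<in> L"
    then show "p \<otimes>\<^bsub>GG\<^esub> q \<in> L" using assms(3) by (cases p, cases q) simp
  next
    fix p assume p: "p \<in> L"
    then have "inv\<^bsub>GG\<^esub> p = (inv (fst p), inv (snd p))"
      using inv_DirProd[OF is_group is_group] assms(1) by (cases p) auto
    then show "inv\<^bsub>GG\<^esub> p \<in> L" using p assms(4) by (cases p) simp
  qed (use assms in auto)
qed

lemma GG_subgroupD:
  assumes "subgroup L GG"
  shows "(a, b) \<in> L \<Longrightarrow> a \<in> carrier G" "(a, b) \<in> L \<Longrightarrow> b \<in> carrier G" "(\<one>, \<one>) \<in> L"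
    "(a, b) \<in> L \<Longrightarrow> (c, d) \<in> L \<Longrightarrow> (a \<otimes> c, b \<otimes> d) \<in> L"
    "(a, b) \<in> L \<Longrightarrow> (inv a, inv b) \<in> L"
proof -
  show c: "a \<in> carrier G" "b \<in> carrier G" if "(a, b) \<in> L" for a b
    using subgroup.subset[OF assms] that by auto
  show "(\<one>, \<one>) \<in> L" using subgroup.one_closed[OF assms] by simp
  show "(a \<otimes> c, b \<otimes> d) \<in> L" if "(a, b) \<in> L" "(c, d) \<in> L"
    using subgroup.m_closed[OF assms that] by simp
  show "(inv a, inv b) \<in> L" if "(a, b) \<in> L"
    using subgroup.m_inv_closed[OF assms that] inv_DirProd[OF is_group is_group c[OF that]] by simp
qed

text \<open>Triviality of k_2(L) is single-valuedness and triviality of k_1(L) is injectivity. Thus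
  a bifree subgroup is the graph of an isomorphism from \<open>Domain L\<close> onto
  \<open>Range L\<close>, and all further arguments treat it as a relation.\<close>

lemma bifree_iff:
  "bifree G L \<longleftrightarrow> subgroup L GG \<and> (\<forall>a b b'. (a, b) \<in> L \<longrightarrow> (a, b') \<in> L \<longrightarrow> b = b')
     \<and> (\<forall>a a' b. (a, b) \<in> L \<longrightarrow> (a', b) \<in> L \<longrightarrow> a = a')" (is "_ \<longleftrightarrow> ?r")
proof
  assume L: "bifree G L"
  then have sg: "subgroup L GG" unfolding bifree_def by auto
  note D = GG_subgroupD[OF sg]
  have "b = b'" if "(a, b) \<in> L" "(a, b') \<in> L" for a b b'
  proof -
    have "(inv a \<otimes> a, inv b \<otimes> b') \<in> L" using D(4)[OF D(5)[OF that(1)] that(2)] .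
    then have "inv b \<otimes> b' \<in> {g \<in> carrier G. (\<one>, g) \<in> L}" using D(1,2) that by simp
    then have "inv b \<otimes> b' = \<one>" using L unfolding bifree_def by auto
    then show ?thesis using D(2)[OF that(1)] D(2)[OF that(2)] by (metis inv_solve_left one_closed r_one)
  qed
  moreover have "a = a'" if "(a, b) \<in> L" "(a', b) \<in> L" for a a' b
  proof -
    have "(inv a \<otimes> a', inv b \<otimes> b) \<in> L" using D(4)[OF D(5)[OF that(1)] that(2)] .
    then have "inv a \<otimes> a' \<in> {g \<in> carrier G. (g, \<one>) \<in> L}" using D(1,2) that by simp
    then have "inv a \<otimes> a' = \<one>" using L unfolding bifree_def by auto
    then show ?thesis using D(1)[OF that(1)] D(1)[OF that(2)] by (metis inv_solve_left one_closed r_one)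
  qed
  ultimately show ?r using sg by blast
next
  assume r: ?r
  then have "(\<one>, \<one>) \<in> L" using GG_subgroupD(3) by blast
  then show "bifree G L" unfolding bifree_def using r by auto
qed

lemma bifree_subgroup: "bifree G L \<Longrightarrow> subgroup L GG"
  unfolding bifree_def by auto

lemma bifree_mono: "bifree G L \<Longrightarrow> subgroup M GG \<Longrightarrow> M \<subseteq> L \<Longrightarrow> bifree G M"
  unfolding bifree_iff by blast

lemma bifree_converse: assumes "bifree G L" shows "bifree G (L\<inverse>)"
proof -
  note D = GG_subgroupD[OF bifree_subgroup[OF assms]]
  have "subgroup (L\<inverse>) GG" by (rule GG_subgroupI) (use D in auto)
  then show ?thesis using assms unfolding bifree_iff by blast
qed

text \<open>This is the star product of subgroups of G x G: the composite isomorphism on the largest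
  subgroup where it is defined.\<close>

lemma bifree_comp: assumes "bifree G L" "bifree G M" shows "bifree G (L O M)"
proof -
  note D = GG_subgroupD[OF bifree_subgroup[OF assms(1)]]
  note E = GG_subgroupD[OF bifree_subgroup[OF assms(2)]]
  have "subgroup (L O M) GG"
  proof (rule GG_subgroupI)
    show "L O M \<subseteq> carrier G \<times> carrier G" using D(1) E(2) by blast
    show "(\<one>, \<one>) \<in> L O M" using D(3) E(3) by blast
    show "(a \<otimes> c, b \<otimes> d) \<in> L O M" if "(a, b) \<in> L O M" "(c, d) \<in> L O M" for a b c d
      using that D(4) E(4) by blast
    show "(inv a, inv b) \<in> L O M" if "(a, b) \<in> L O M" for a b
      using that D(5) E(5) by blast
  qed
  then show ?thesis using assms unfolding bifree_iff by blast
qed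

lemma Domain_subgroup: assumes "subgroup L GG" shows "subgroup (Domain L) G"
proof (rule subgroupI)
  note D = GG_subgroupD[OF assms]
  show "Domain L \<subseteq> carrier G" "Domain L \<noteq> {}" using D by auto
  show "inv a \<in> Domain L" if "a \<in> Domain L" for a using that D(5) by blast
  show "a \<otimes> b \<in> Domain L" if "a \<in> Domain L" "b \<in> Domain L" for a b using that D(4) by blast
qed

lemma Range_subgroup: assumes "subgroup L GG" shows "subgroup (Range L) G"
proof (rule subgroupI)
  note D = GG_subgroupD[OF assms]
  show "Range L \<subseteq> carrier G" "Range L \<noteq> {}" using D by auto
  show "inv a \<in> Range L" if "a \<in> Range L" for a using that D(5) by blast
  show "a \<otimes> b \<in> Range L" if "a \<in> Range L" "b \<in> Range L" for a b using that D(4) by blast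
qed

lemma bifree_conj: assumes "bifree G L" "p \<in> carrier GG" shows "bifree G (conj_img GG p L)"
proof -
  interpret D: fin_group GG by (rule GG_fin_group)
  obtain g h where p: "p = (g, h)" "g \<in> carrier G" "h \<in> carrier G" using assms(2) by (cases p) auto
  have sg: "subgroup (conj_img GG p L) GG" using D.conj_img_subgroup[OF bifree_subgroup] assms by blast
  note D = GG_subgroupD[OF bifree_subgroup[OF assms(1)]]
  show ?thesis unfolding bifree_iff
  proof (intro conjI allI impI)
    fix a b b' assume "(a, b) \<in> conj_img GG p L" "(a, b') \<in> conj_img GG p L"
    then obtain x y x' y' where "(x, y) \<in> L" "(x', y') \<in> L" "a = g \<otimes> x \<otimes> inv g" "a = g \<otimes> x' \<otimes> inv g"
      "b = h \<otimes> y \<otimes> inv h" "b' = h \<otimes> y' \<otimes> inv h" unfolding p(1) conj_img_GG[OF p(2,3)] by auto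
    moreover from this have "x = x'" using inj_onD[OF inj_on_conj[OF p(2)]] D(1) by metis
    ultimately show "b = b'" using assms(1) unfolding bifree_iff by blast
  next
    fix a a' b assume "(a, b) \<in> conj_img GG p L" "(a', b) \<in> conj_img GG p L"
    then obtain x y x' y' where "(x, y) \<in> L" "(x', y') \<in> L" "a = g \<otimes> x \<otimes> inv g" "a' = g \<otimes> x' \<otimes> inv g"
      "b = h \<otimes> y \<otimes> inv h" "b = h \<otimes> y' \<otimes> inv h" unfolding p(1) conj_img_GG[OF p(2,3)] by auto
    moreover from this have "y = y'" using inj_onD[OF inj_on_conj[OF p(3)]] D(2) by metis
    ultimately show "a = a'" using assms(1) unfolding bifree_iff by blast
  qed (rule sg)
qed

text \<open>Index set of the convolution: the possible first factors when the isomorphism L is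
  factored as A followed by the inverse of A and L.\<close>

definition same_dom :: "('a \<times> 'a) set \<Rightarrow> ('a \<times> 'a) set set" where
  "same_dom L = {A. bifree G A \<and> Domain A = Domain L}"

lemma fin_bifree: "finite {L. bifree G L}"
proof -
  interpret D: fin_group GG by (rule GG_fin_group)
  show ?thesis by (rule finite_subset[OF _ D.fin_subgroups]) (auto dest: bifree_subgroup)
qed

lemma fin_same_dom: "finite (same_dom L)"
  unfolding same_dom_def by (rule finite_subset[OF _ fin_bifree]) auto

text \<open>A point \<open>[x, y]\<close> of \<open>X \<times>\<^sub>G Y\<close> has stabilizer \<open>Stab(x) O Stab(y)\<close>, and it is fixed by \<open>L\<close> iff
  \<open>L = A O (A\<inverse> O L)\<close> with \<open>A\<close> fixing \<open>x\<close> and \<open>A\<inverse> O L\<close> fixing \<open>y\<close> for some \<open>A\<close>, which is then unique.\<close>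

lemma same_dom_fac:
  assumes "bifree G L" "bifree G S" "bifree G T"
  shows "{A \<in> same_dom L. A \<subseteq> S \<and> A\<inverse> O L \<subseteq> T}
       = (if L \<subseteq> S O T then {{(a, b). (a, b) \<in> S \<and> a \<in> Domain L}} else {})"
proof -
  \<comment> \<open>The restriction of S to the source of L. As S is single-valued, a first factor
    inside S with this source can only be \<open>A0\<close>.\<close>
  define A0 where "A0 = {(a, b). (a, b) \<in> S \<and> a \<in> Domain L}"
  note D = GG_subgroupD[OF bifree_subgroup[OF assms(1)]]
  note E = GG_subgroupD[OF bifree_subgroup[OF assms(2)]]
  have sS: "\<And>a b b'. (a, b) \<in> S \<Longrightarrow> (a, b') \<in> S \<Longrightarrow> b = b'" using assms(2) unfolding bifree_iff by blast
  have A0: "bifree G A0"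
  proof (rule bifree_mono[OF assms(2)])
    show "A0 \<subseteq> S" unfolding A0_def by auto
    show "subgroup A0 GG"
    proof (rule GG_subgroupI)
      show "A0 \<subseteq> carrier G \<times> carrier G" using E(1,2) unfolding A0_def by blast
      show "(\<one>, \<one>) \<in> A0" using D(3) E(3) unfolding A0_def by blast
      show "(a \<otimes> c, b \<otimes> d) \<in> A0" if "(a, b) \<in> A0" "(c, d) \<in> A0" for a b c d
        using that D(4) E(4) unfolding A0_def by blast
      show "(inv a, inv b) \<in> A0" if "(a, b) \<in> A0" for a b
        using that D(5) E(5) unfolding A0_def by blast
    qed
  qed
  have 1: "A = A0 \<and> L \<subseteq> S O T" if A: "Domain A = Domain L" "A \<subseteq> S" "A\<inverse> O L \<subseteq> T" for A
  proof
    show "A = A0"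
    proof (rule subset_antisym)
      show "A \<subseteq> A0" unfolding A0_def using A by blast
      show "A0 \<subseteq> A"
      proof clarify
        fix a b assume ab: "(a, b) \<in> A0"
        then have "a \<in> Domain A" using A(1) unfolding A0_def by simp
        then obtain b' where b': "(a, b') \<in> A" by blast
        then have "b = b'" using sS[of a b b'] ab A(2) unfolding A0_def by blast
        then show "(a, b) \<in> A" using b' by simp
      qed
    qed
    show "L \<subseteq> S O T"
    proof clarify
      fix a c assume ac: "(a, c) \<in> L"
      then have "a \<in> Domain A" using A(1) by auto
      then obtain b where b: "(a, b) \<in> A" by blast
      then have "(b, c) \<in> T" using ac A(3) by blast
      then show "(a, c) \<in> S O T" using b A(2) by blast
    qed
  qed
  have 2: "Domain A0 = Domain L \<and> A0 \<subseteq> S \<and> A0\<inverse> O L \<subseteq> T" if LS: "L \<subseteq> S O T"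
  proof (intro conjI)
    show "Domain A0 = Domain L" using LS unfolding A0_def by blast
    show "A0 \<subseteq> S" unfolding A0_def by auto
    show "A0\<inverse> O L \<subseteq> T"
    proof clarify
      fix b a c assume "(a, b) \<in> A0" "(a, c) \<in> L"
      then obtain b' where "(a, b') \<in> S" "(b', c) \<in> T" "(a, b) \<in> S" using LS unfolding A0_def by blast
      then show "(b, c) \<in> T" using sS by metis
    qed
  qed
  show ?thesis
  proof (cases "L \<subseteq> S O T")
    case True
    have "{A \<in> same_dom L. A \<subseteq> S \<and> A\<inverse> O L \<subseteq> T} = {A0}"
      unfolding same_dom_def using 1 2[OF True] A0 by blast
    then show ?thesis using True unfolding A0_def by simp
  next
    case False
    have "\<not> (A \<subseteq> S \<and> A\<inverse> O L \<subseteq> T)" if "A \<in> same_dom L" for A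
      using 1[of A] that False unfolding same_dom_def by blast
    then have "{A \<in> same_dom L. A \<subseteq> S \<and> A\<inverse> O L \<subseteq> T} = {}" by simp
    then show ?thesis using False by simp
  qed
qed

section \<open>Cosets of G x G and their tensor products\<close>

lemma cact_mult:
  assumes "C \<subseteq> carrier GG" "p \<in> carrier GG" "q \<in> carrier GG"
  shows "cact G p (cact G q C) = cact G (p \<otimes>\<^bsub>GG\<^esub> q) C"
proof -
  interpret D: fin_group GG by (rule GG_fin_group)
  show ?thesis unfolding cact_def image_image
    by (intro image_cong refl D.m_assoc[symmetric] assms subsetD[OF assms(1)])
qed

lemma cact_one: assumes "C \<subseteq> carrier GG" shows "cact G (\<one>, \<one>) C = C"
proof -
  interpret D: fin_group GG by (rule GG_fin_group)
  have "\<one>\<^bsub>GG\<^esub> \<otimes>\<^bsub>GG\<^esub> c = c" if "c \<in> C" for c using that assms by (intro D.l_one) auto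
  then show ?thesis unfolding cact_def by (force simp: image_iff)
qed

definition cstab :: "('a \<times> 'a) set \<Rightarrow> ('a \<times> 'a) set" where
  "cstab C = {p \<in> carrier GG. cact G p C = C}"

end

locale double_burnside = fin_group +
  fixes K :: "'k::field itself"
  assumes ord_inv: "(of_nat (order G) :: 'k) \<noteq> 0"
begin

sublocale S: group_family_inv G "{U. subgroup U G}" K
  by (intro group_family_inv.intro group_family.intro fin_group_axioms group_family_axioms.intro
      group_family_inv_axioms.intro) (simp_all add: conj_img_subgroup ord_inv)

sublocale D: group_family_inv GG "{L. bifree G L}" K
  by (intro group_family_inv.intro group_family.intro GG_fin_group group_family_axioms.intro
      group_family_inv_axioms.intro)
    (simp_all add: bifree_subgroup bifree_conj order_GG ord_inv del: carrier_DirProd)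

lemma lcosets_GG_sub: "bifree G L \<Longrightarrow> C \<in> lcosets GG L \<Longrightarrow> C \<subseteq> carrier GG"
  unfolding lcosets_def using D.l_coset_subset_G[OF D.F_sub] by blast

lemma cact_lcosets:
  assumes "bifree G L" "C \<in> lcosets GG L" "p \<in> carrier GG"
  shows "cact G p C \<in> lcosets GG L"
proof -
  obtain q where q: "q \<in> carrier GG" "C = q <#\<^bsub>GG\<^esub> L" using assms(2) unfolding lcosets_def by auto
  have "cact G p C = (p \<otimes>\<^bsub>GG\<^esub> q) <#\<^bsub>GG\<^esub> L"
  proof -
    have eq: "r <#\<^bsub>GG\<^esub> L = (\<lambda>l. r \<otimes>\<^bsub>GG\<^esub> l) ` L" for r unfolding l_coset_def by auto
    show ?thesis unfolding cact_def q(2) eq image_image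
      using subsetD[OF D.F_sub[of L]] assms q by (intro image_cong refl D.m_assoc[symmetric]) auto
  qed
  then show ?thesis unfolding lcosets_def using D.m_closed[OF assms(3) q(1)] by blast
qed

lemma cstab_bifree: assumes "bifree G L" "C \<in> lcosets GG L" shows "bifree G (cstab C)"
proof -
  obtain q where q: "q \<in> carrier GG" "C = q <#\<^bsub>GG\<^esub> L" using assms(2) unfolding lcosets_def by auto
  have "cstab C = {p \<in> carrier GG. p \<in> conj_img GG q L}"
    unfolding cstab_def cact_def q(2) using D.lcos_fixed_iff[of L q] assms q by blast
  also have "\<dots> = conj_img GG q L" using D.conj_img_carrier[OF D.F_sub[of L] q(1)] assms by auto
  finally show ?thesis using bifree_conj[OF assms(1) q(1)] by simp
qed

lemma mark_basis_cstab:
  assumes "A \<subseteq> carrier GG"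
  shows "mark_basis GG A L = card {C \<in> lcosets GG L. A \<subseteq> cstab C}"
  unfolding mark_basis_def cstab_def cact_def[symmetric]
  using assms by (intro arg_cong[where f = card]) blast

text \<open>With bisets read as G x G-sets, x g^-1 is (1, g) x and g y is (g, 1) y. The orbits of
  this action are therefore the points of the tensor product.\<close>

lemma pair_action:
  assumes L: "bifree G L" and M: "bifree G M"
  shows "fin_action G (lcosets GG L \<times> lcosets GG M) (\<lambda>g (C, D). (cact G (\<one>, g) C, cact G (g, \<one>) D))"
proof (intro fin_action.intro fin_action_axioms.intro, goal_cases)
  case 1 show ?case by (rule fin_group_axioms)
next
  case 2 show ?case using D.fin_lcosets by simp
next
  case (3 g x) then show ?case using cact_lcosets[OF L] cact_lcosets[OF M] by (cases x) auto
next
  case (4 x) then show ?case using cact_one lcosets_GG_sub[OF L] lcosets_GG_sub[OF M] by (cases x) auto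
next
  case (5 g h x)
  then obtain C D where x: "x = (C, D)" "C \<subseteq> carrier GG" "D \<subseteq> carrier GG"
    using lcosets_GG_sub[OF L] lcosets_GG_sub[OF M] by (cases x) auto
  then show ?case using cact_mult 5 by simp
qed

lemma tensor_orbit_alt:
  "tensor_orbit G C D = {(\<lambda>(C, D). (cact G (\<one>, g) C, cact G (g, \<one>) D)) (C, D) | g. g \<in> carrier G}"
  unfolding tensor_orbit_def by simp

text \<open>The outer left and right actions commute with the middle action that is divided out, so
  they can be computed on representatives.\<close>

lemma tact_tensor_orbit:
  assumes "C \<subseteq> carrier GG" "D \<subseteq> carrier GG" "p \<in> carrier GG"
  shows "tact G p (tensor_orbit G C D) = tensor_orbit G (cact G (fst p, \<one>) C) (cact G (\<one>, snd p) D)"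
proof -
  have "cact G (fst p, \<one>) (cact G (\<one>, g) C) = cact G (\<one>, g) (cact G (fst p, \<one>) C)"
       "cact G (\<one>, snd p) (cact G (g, \<one>) D) = cact G (g, \<one>) (cact G (\<one>, snd p) D)"
    if "g \<in> carrier G" for g
    using that assms by (auto simp: cact_mult mem_Times_iff)
  then show ?thesis unfolding tact_def tensor_orbit_def setcompr_eq_image image_image
    by (intro image_cong) auto
qed

lemma tensor_orbit_eq_iff:
  assumes L: "bifree G L" and M: "bifree G M"
    and "C \<in> lcosets GG L" "C' \<in> lcosets GG L" "D \<in> lcosets GG M" "D' \<in> lcosets GG M"
  shows "tensor_orbit G C D = tensor_orbit G C' D'
     \<longleftrightarrow> (\<exists>g\<in>carrier G. C' = cact G (\<one>, g) C \<and> D' = cact G (g, \<one>) D)"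
proof -
  interpret P: fin_action G "lcosets GG L \<times> lcosets GG M" "\<lambda>g (C, D). (cact G (\<one>, g) C, cact G (g, \<one>) D)"
    using pair_action[OF L M] .
  have to: "tensor_orbit G C D = P.orb (C, D)" for C D
    unfolding P.orb_def tensor_orbit_alt ..
  have "P.orb (C, D) = P.orb (C', D') \<longleftrightarrow> (C', D') \<in> P.orb (C, D)"
    using P.orb_eq[of "(C, D)" "(C', D')"] P.orb_self[of "(C', D')"] assms by auto
  then show ?thesis unfolding to unfolding P.orb_def by auto
qed

text \<open>(a, b) fixes the orbit of (C, D) iff a single g in G compensates both changes, that is,
  (a, g^-1) fixes C and (g^-1, b) fixes D.\<close>

lemma tstab_eq:
  assumes L: "bifree G L" and M: "bifree G M"
    and C: "C \<in> lcosets GG L" and D: "D \<in> lcosets GG M"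
  shows "tstab G (tensor_orbit G C D) = cstab C O cstab D"
proof -
  have Cc: "C \<subseteq> carrier GG" and Dc: "D \<subseteq> carrier GG" using C D L M lcosets_GG_sub by auto
  have *: "tact G (a, b) (tensor_orbit G C D) = tensor_orbit G C D \<longleftrightarrow> (a, b) \<in> cstab C O cstab D"
    if ab: "a \<in> carrier G" "b \<in> carrier G" for a b
  proof -
    have e1: "cact G (a, \<one>) C = cact G (\<one>, g) C \<longleftrightarrow> cact G (a, inv g) C = C" if "g \<in> carrier G" for g
    proof -
      have "cact G (\<one>, inv g) (cact G (a, \<one>) C) = cact G (a, inv g) C"
        "cact G (\<one>, inv g) (cact G (\<one>, g) C) = C"
        "cact G (\<one>, g) (cact G (a, inv g) C) = cact G (a, \<one>) C"
        using that ab Cc by (simp_all add: cact_mult cact_one)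
      then show ?thesis by metis
    qed
    have e2: "cact G (\<one>, b) D = cact G (g, \<one>) D \<longleftrightarrow> cact G (inv g, b) D = D" if "g \<in> carrier G" for g
    proof -
      have "cact G (inv g, \<one>) (cact G (\<one>, b) D) = cact G (inv g, b) D"
        "cact G (inv g, \<one>) (cact G (g, \<one>) D) = D"
        "cact G (g, \<one>) (cact G (inv g, b) D) = cact G (\<one>, b) D"
        using that ab Dc by (simp_all add: cact_mult cact_one)
      then show ?thesis by metis
    qed
    have "tact G (a, b) (tensor_orbit G C D) = tensor_orbit G C D
      \<longleftrightarrow> tensor_orbit G C D = tensor_orbit G (cact G (a, \<one>) C) (cact G (\<one>, b) D)"
      using tact_tensor_orbit[OF Cc Dc, of "(a, b)"] ab by auto
    also have "\<dots> \<longleftrightarrow> (\<exists>g\<in>carrier G. cact G (a, \<one>) C = cact G (\<one>, g) C \<and> cact G (\<one>, b) D = cact G (g, \<one>) D)"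
      using ab C D by (intro tensor_orbit_eq_iff[OF L M] cact_lcosets L M) auto
    also have "\<dots> \<longleftrightarrow> (\<exists>g\<in>carrier G. cact G (a, inv g) C = C \<and> cact G (inv g, b) D = D)"
      using e1 e2 by auto
    also have "\<dots> \<longleftrightarrow> (\<exists>g\<in>carrier G. cact G (a, g) C = C \<and> cact G (g, b) D = D)"
      by (metis inv_closed inv_inv)
    also have "\<dots> \<longleftrightarrow> (a, b) \<in> cstab C O cstab D" unfolding cstab_def using ab by auto
    finally show ?thesis .
  qed
  have "p \<in> tstab G (tensor_orbit G C D) \<longleftrightarrow> p \<in> cstab C O cstab D" for p
  proof (cases p)
    case (Pair a b)
    show ?thesis using *[of a b] unfolding tstab_def Pair cstab_def by auto
  qed
  then show ?thesis by blast
qed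

lemma tensor_action:
  assumes L: "bifree G L" and M: "bifree G M"
  shows "fin_action GG (tensor_set G L M) (tact G)"
proof (intro fin_action.intro fin_action_axioms.intro)
  show "fin_group GG" by (rule GG_fin_group)
  have "tensor_set G L M = (\<lambda>(C, D). tensor_orbit G C D) ` (lcosets GG L \<times> lcosets GG M)"
    unfolding tensor_set_def by auto
  then show "finite (tensor_set G L M)" using D.fin_lcosets by simp
  fix x assume "x \<in> tensor_set G L M"
  then obtain C D where x: "C \<in> lcosets GG L" "D \<in> lcosets GG M" "x = tensor_orbit G C D"
    unfolding tensor_set_def by auto
  have Cc: "C \<subseteq> carrier GG" and Dc: "D \<subseteq> carrier GG" using x L M lcosets_GG_sub by auto
  show "tact G \<one>\<^bsub>GG\<^esub> x = x"
    unfolding x(3) using tact_tensor_orbit[OF Cc Dc D.one_closed] cact_one Cc Dc by simp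
  fix g assume g: "g \<in> carrier GG"
  have g1: "(fst g, \<one>) \<in> carrier GG" "(\<one>, snd g) \<in> carrier GG" using g by auto
  show "tact G g x \<in> tensor_set G L M"
    unfolding x(3) tact_tensor_orbit[OF Cc Dc g] tensor_set_def
    using cact_lcosets[OF L x(1) g1(1)] cact_lcosets[OF M x(2) g1(2)] by blast
  fix h assume h: "h \<in> carrier GG"
  have h1: "(fst h, \<one>) \<in> carrier GG" "(\<one>, snd h) \<in> carrier GG" using h by auto
  have c1: "cact G (fst h, \<one>) C \<subseteq> carrier GG" "cact G (\<one>, snd h) D \<subseteq> carrier GG"
    using lcosets_GG_sub[OF L cact_lcosets[OF L x(1) h1(1)]] lcosets_GG_sub[OF M cact_lcosets[OF M x(2) h1(2)]] by auto
  have gh: "g \<otimes>\<^bsub>GG\<^esub> h \<in> carrier GG" using D.m_closed[OF g h] .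
  show "tact G (g \<otimes>\<^bsub>GG\<^esub> h) x = tact G g (tact G h x)"
    unfolding x(3) tact_tensor_orbit[OF Cc Dc gh] tact_tensor_orbit[OF Cc Dc h]
      tact_tensor_orbit[OF c1 g] cact_mult[OF Cc g1(1) h1(1)] cact_mult[OF Dc g1(2) h1(2)]
    by (simp add: mult_DirProd')
qed

lemma tstab_stab:
  assumes L: "bifree G L" and M: "bifree G M"
  shows "fin_action.stab GG (tact G) = tstab G"
proof -
  interpret T: fin_action GG "tensor_set G L M" "tact G" using tensor_action[OF L M] .
  show ?thesis unfolding T.stab_def tstab_def by simp
qed

lemma tstab_bifree:
  assumes L: "bifree G L" and M: "bifree G M" and "x \<in> tensor_set G L M"
  shows "bifree G (tstab G x)"
proof -
  obtain C D where x: "C \<in> lcosets GG L" "D \<in> lcosets GG M" "x = tensor_orbit G C D"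
    using assms(3) unfolding tensor_set_def by auto
  show ?thesis unfolding x(3) tstab_eq[OF L M x(1,2)]
    using bifree_comp cstab_bifree L M x(1,2) by blast
qed

text \<open>\<open>tensor_coeff\<close> counts the G x G-orbits with stabilisers conjugate to N, and
  each of these contains |N_{GxG}(N) : N| points with stabiliser exactly N, which is the
  weight.\<close>

lemma tensor_coeff_weight:
  assumes L: "bifree G L" and M: "bifree G M" and N: "bifree G N"
  shows "of_nat (tensor_coeff G L M N) * D.weight N = (of_nat (card {x \<in> tensor_set G L M. tstab G x = N}) :: 'k)"
proof -
  interpret T: fin_action GG "tensor_set G L M" "tact G" using tensor_action[OF L M] .
  have "tensor_coeff G L M N = card {\<Omega> \<in> T.orbs. \<exists>x\<in>\<Omega>. conjugate GG (T.stab x) N}"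
    unfolding tensor_coeff_def T.orbs_def T.orb_def torbit_def tstab_stab[OF L M] ..
  then have "card {x \<in> tensor_set G L M. tstab G x = N} * card N = card (D.normalizer_of N) * tensor_coeff G L M N"
    using T.card_stab_eq[OF bifree_subgroup[OF N]] unfolding tstab_stab[OF L M] by simp
  then have "(of_nat (card {x \<in> tensor_set G L M. tstab G x = N} * card N) :: 'k)
      = of_nat (card (D.normalizer_of N) * tensor_coeff G L M N)"
    by (rule arg_cong)
  then show ?thesis unfolding D.weight_def using D.card_subgroup_nz[OF bifree_subgroup[OF N]]
    by (simp add: divide_eq_eq eq_divide_eq mult.commute)
qed

lemma tensor_coeff_bifree:
  assumes L: "bifree G L" and M: "bifree G M" and N: "tensor_coeff G L M N \<noteq> 0"
  shows "bifree G N"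
proof -
  interpret T: fin_action GG "tensor_set G L M" "tact G" using tensor_action[OF L M] .
  have "{\<Omega> \<in> {torbit G Ob | Ob. Ob \<in> tensor_set G L M}. \<exists>Ob\<in>\<Omega>. conjugate GG (tstab G Ob) N} \<noteq> {}"
    using N unfolding tensor_coeff_def by (metis card.empty)
  then obtain x y where x: "x \<in> tensor_set G L M" "y \<in> torbit G x" "conjugate GG (tstab G y) N" by blast
  have "y \<in> tensor_set G L M" using x(1,2) T.act_closed unfolding torbit_def by auto
  then have "bifree G (tstab G y)" using tstab_bifree[OF L M] by blast
  then show ?thesis using D.F_conjugate[of "tstab G y" N] x(3) by simp
qed

lemma tensor_coeff_conj:
  assumes "conjugate GG N N'" shows "tensor_coeff G L M N = tensor_coeff G L M N'"
proof -
  have "conjugate GG V N \<longleftrightarrow> conjugate GG V N'" for V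
    using assms D.conjugate_trans D.conjugate_sym by blast
  then show ?thesis unfolding tensor_coeff_def by simp
qed

text \<open>The middle action of G on pairs of cosets is free: if g fixes C, then (1, g) lies in a
  bifree stabiliser, so g = 1. Hence every point of the tensor product comes from |G| pairs. The
  pairs over Q-fixed points are then counted through the factorisations of Q, exactly one A
  belonging to each such pair by \<open>same_dom_fac\<close>.\<close>

lemma card_tensor_fixed:
  assumes L: "bifree G L" and M: "bifree G M" and Q: "bifree G Q"
  shows "card {x \<in> tensor_set G L M. Q \<subseteq> tstab G x} * order G
       = (\<Sum>A\<in>same_dom Q. mark_basis GG A L * mark_basis GG (A\<inverse> O Q) M)"
proof -
  define X where "X = lcosets GG L \<times> lcosets GG M"
  interpret P: fin_action G X "\<lambda>g (C, D). (cact G (\<one>, g) C, cact G (g, \<one>) D)"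
    unfolding X_def using pair_action[OF L M] .
  have to: "tensor_orbit G C D = P.orb (C, D)" for C D unfolding P.orb_def tensor_orbit_alt ..
  have ts: "tensor_set G L M = P.orbs" unfolding tensor_set_def P.orbs_def to by (auto simp: X_def)
  have orb_card: "card (P.orb x) = order G" if x: "x \<in> X" for x
  proof -
    obtain C D where CD: "x = (C, D)" "C \<in> lcosets GG L" "D \<in> lcosets GG M" using x unfolding X_def by auto
    have "P.stab x = {\<one>}"
    proof
      show "P.stab x \<subseteq> {\<one>}"
      proof
        fix g assume g: "g \<in> P.stab x"
        then have "(\<one>, g) \<in> cstab C" unfolding P.stab_def CD cstab_def by auto
        moreover have "(\<one>, \<one>) \<in> cstab C"
          using GG_subgroupD(3)[OF bifree_subgroup[OF cstab_bifree[OF L CD(2)]]] .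
        ultimately show "g \<in> {\<one>}" using cstab_bifree[OF L CD(2)] unfolding bifree_iff by blast
      qed
      show "{\<one>} \<subseteq> P.stab x" using P.act_one[OF x] unfolding P.stab_def by simp
    qed
    then show ?thesis using P.orbit_stab[OF x] by simp
  qed
  define Y where "Y = {(C, D) \<in> X. Q \<subseteq> cstab C O cstab D}"
  have "card Y = order G * card {x \<in> tensor_set G L M. Q \<subseteq> tstab G x}"
  proof (rule card_fibres[where f = "\<lambda>(C, D). tensor_orbit G C D"])
    show "finite Y" unfolding Y_def by (rule finite_subset[OF _ P.finX]) auto
    show im: "(\<lambda>(C, D). tensor_orbit G C D) ` Y = {x \<in> tensor_set G L M. Q \<subseteq> tstab G x}"
      (is "?l = ?r")
    proof (rule subset_antisym)
      show "?l \<subseteq> ?r" unfolding Y_def X_def tensor_set_def using tstab_eq[OF L M] by auto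
      show "?r \<subseteq> ?l"
      proof
        fix x assume x: "x \<in> ?r"
        then obtain C D where CD: "C \<in> lcosets GG L" "D \<in> lcosets GG M" "x = tensor_orbit G C D"
          unfolding tensor_set_def by auto
        then have "(C, D) \<in> Y" unfolding Y_def X_def using tstab_eq[OF L M] x by simp
        then show "x \<in> ?l" using CD(3) by force
      qed
    qed
    fix b assume b: "b \<in> {x \<in> tensor_set G L M. Q \<subseteq> tstab G x}"
    then have bO: "b \<in> P.orbs" using ts by simp
    then obtain x where x: "x \<in> X" "b = P.orb x" unfolding P.orbs_def by auto
    have "{a \<in> Y. (case a of (C, D) \<Rightarrow> tensor_orbit G C D) = b} = b"
    proof (rule subset_antisym)
      show "{a \<in> Y. (case a of (C, D) \<Rightarrow> tensor_orbit G C D) = b} \<subseteq> b"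
        using P.orb_in_orbs_iff[OF _ bO] unfolding Y_def to by auto
      show "b \<subseteq> {a \<in> Y. (case a of (C, D) \<Rightarrow> tensor_orbit G C D) = b}"
      proof
        fix a assume a: "a \<in> b"
        then have aX: "a \<in> X" using P.orbs_sub[OF bO] by auto
        obtain C D where CD: "a = (C, D)" by (cases a)
        have "tensor_orbit G C D = b" using P.orb_in_orbs_iff[OF aX bO] a unfolding to CD by simp
        then show "a \<in> {a \<in> Y. (case a of (C, D) \<Rightarrow> tensor_orbit G C D) = b}"
          using b aX tstab_eq[OF L M, of C D] unfolding Y_def CD X_def by auto
      qed
    qed
    then show "card {a \<in> Y. (case a of (C, D) \<Rightarrow> tensor_orbit G C D) = b} = order G"
      using orb_card[OF x(1)] x(2) by simp
  qed
  moreover have "card Y = (\<Sum>A\<in>same_dom Q. mark_basis GG A L * mark_basis GG (A\<inverse> O Q) M)"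
  proof -
    define P where "P = (\<lambda>A x. A \<subseteq> cstab (fst x) \<and> A\<inverse> O Q \<subseteq> cstab (snd x))"
    have "(\<Sum>A\<in>same_dom Q. mark_basis GG A L * mark_basis GG (A\<inverse> O Q) M)
        = (\<Sum>A\<in>same_dom Q. card {x \<in> X. P A x})"
    proof (rule sum.cong[OF refl])
      fix A assume "A \<in> same_dom Q"
      then have A: "bifree G A" unfolding same_dom_def by simp
      have "A \<subseteq> carrier GG" "A\<inverse> O Q \<subseteq> carrier GG"
        using A bifree_comp[OF bifree_converse[OF A] Q] D.F_sub by simp_all
      moreover have "{x \<in> X. P A x} = {C \<in> lcosets GG L. A \<subseteq> cstab C} \<times> {D \<in> lcosets GG M. A\<inverse> O Q \<subseteq> cstab D}"
        unfolding X_def P_def by auto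
      ultimately show "mark_basis GG A L * mark_basis GG (A\<inverse> O Q) M = card {x \<in> X. P A x}"
        by (simp add: mark_basis_cstab card_cartesian_product)
    qed
    also have "\<dots> = (\<Sum>x\<in>X. card {A \<in> same_dom Q. P A x})"
      by (rule sum_multicount_gen) (auto simp: fin_same_dom P.finX)
    also have "\<dots> = (\<Sum>x\<in>X. if x \<in> Y then 1 else 0)"
    proof (rule sum.cong[OF refl])
      fix x assume x: "x \<in> X"
      then have b: "bifree G (cstab (fst x))" "bifree G (cstab (snd x))"
        unfolding X_def using cstab_bifree[OF L] cstab_bifree[OF M] by auto
      show "card {A \<in> same_dom Q. P A x} = (if x \<in> Y then 1 else 0)"
        unfolding P_def same_dom_fac[OF Q b] Y_def using x by (cases x) simp
    qed
    also have "\<dots> = card {x \<in> X. x \<in> Y}" using P.finX by (simp add: sum.inter_filter[symmetric])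
    also have "{x \<in> X. x \<in> Y} = Y" unfolding Y_def by auto
    finally show ?thesis by simp
  qed
  ultimately show ?thesis by (simp add: mult.commute)
qed

section \<open>From marks of the tensor product to a convolution\<close>

lemma bd_classes_eq: "bd_classes G = D.fclasses"
  unfolding bd_classes_def D.fclasses_def by simp

lemma bd_space_eq: "bd_space G = D.fspace"
  unfolding bd_space_def D.fspace_def by simp

lemma rep_bifree: "C \<in> bd_classes G \<Longrightarrow> bifree G (rep C)"
  using D.fclasses_rep(1) unfolding bd_classes_eq by simp

lemma bd_mult_space: "bd_mult G a b \<in> bd_space G" for a :: "('a \<times> 'a) set \<Rightarrow> 'k"
proof -
  have "bifree G L" if "bd_mult G a b L \<noteq> 0" for L
  proof (rule ccontr)
    assume "\<not> bifree G L"
    then have "tensor_coeff G (rep C) (rep D) L = 0" if "C \<in> bd_classes G" "D \<in> bd_classes G" for C D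
      using tensor_coeff_bifree rep_bifree that by blast
    then show False using that unfolding bd_mult_def by simp
  qed
  moreover have "bd_mult G a b L = bd_mult G a b M" if "conjugate GG L M" for L M
    unfolding bd_mult_def using tensor_coeff_conj[OF that] by simp
  ultimately show ?thesis unfolding bd_space_def by simp
qed

text \<open>With marks divided by \<open>|G|\<close>, the product becomes convolution in the groupoid of isomorphisms
  between subgroups of \<open>G\<close>.\<close>

definition ghost :: "(('a \<times> 'a) set \<Rightarrow> 'k) \<Rightarrow> ('a \<times> 'a) set \<Rightarrow> 'k" where
  "ghost a L = D.fmark a L / of_nat (order G)"

definition ghost_mult :: "(('a \<times> 'a) set \<Rightarrow> 'k) \<Rightarrow> (('a \<times> 'a) set \<Rightarrow> 'k) \<Rightarrow> ('a \<times> 'a) set \<Rightarrow> 'k" where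
  "ghost_mult f h L = (\<Sum>A\<in>same_dom L. f A * h (A\<inverse> O L))"

text \<open>The points fixed by Q are sorted by their exact stabiliser N.\<close>

lemma sum_tensor_coeff_weight:
  assumes L: "bifree G L" and M: "bifree G M"
  shows "(\<Sum>N\<in>{N \<in> {L. bifree G L}. Q \<subseteq> N}. of_nat (tensor_coeff G L M N) * D.weight N)
       = (of_nat (card {x \<in> tensor_set G L M. Q \<subseteq> tstab G x}) :: 'k)"
proof -
  interpret T: fin_action GG "tensor_set G L M" "tact G" using tensor_action[OF L M] .
  have "card {x \<in> tensor_set G L M. Q \<subseteq> tstab G x}
      = (\<Sum>N\<in>{N \<in> {L. bifree G L}. Q \<subseteq> N}. card {a \<in> {x \<in> tensor_set G L M. Q \<subseteq> tstab G x}. tstab G a = N})"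
    using T.finX tstab_bifree[OF L M] by (intro card_eq_sum_fibres) (auto simp: fin_bifree)
  also have "\<dots> = (\<Sum>N\<in>{N \<in> {L. bifree G L}. Q \<subseteq> N}. card {x \<in> tensor_set G L M. tstab G x = N})"
    by (intro sum.cong refl arg_cong[where f = card]) auto
  finally show ?thesis using tensor_coeff_weight[OF L M] by simp
qed

text \<open>By bilinearity the claim reduces to transitive bisets, where
  \<open>card_tensor_fixed\<close> says that |G| times the mark of a product is a sum of products of
  marks. Dividing every mark by |G| absorbs this factor.\<close>

lemma ghost_mult:
  assumes a: "a \<in> bd_space G" and b: "b \<in> bd_space G" and Q: "bifree G Q"
  shows "ghost (bd_mult G a b) Q = ghost_mult (ghost a) (ghost b) Q"
proof -
  let ?cl = "bd_classes G" and ?n = "of_nat (order G) :: 'k"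
  have "D.fmark (bd_mult G a b) Q * ?n
     = (\<Sum>N\<in>{N \<in> {L. bifree G L}. Q \<subseteq> N}. \<Sum>C\<in>?cl. \<Sum>D\<in>?cl.
          a (rep C) * b (rep D) * (of_nat (tensor_coeff G (rep C) (rep D) N) * D.weight N)) * ?n"
    unfolding D.fmark_def bd_mult_def by (simp add: sum_distrib_right mult.assoc)
  also have "\<dots> = (\<Sum>C\<in>?cl. \<Sum>D\<in>?cl. \<Sum>N\<in>{N \<in> {L. bifree G L}. Q \<subseteq> N}.
          a (rep C) * b (rep D) * (of_nat (tensor_coeff G (rep C) (rep D) N) * D.weight N)) * ?n"
    by (subst sum.swap, subst (2) sum.swap) simp
  also have "\<dots> = (\<Sum>C\<in>?cl. \<Sum>D\<in>?cl. a (rep C) * b (rep D) *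
       of_nat (card {x \<in> tensor_set G (rep C) (rep D). Q \<subseteq> tstab G x} * order G))"
    unfolding sum_distrib_left[symmetric] sum_distrib_right
    by (intro sum.cong refl, subst sum_tensor_coeff_weight[OF rep_bifree rep_bifree]) (simp_all add: mult.assoc)
  also have "\<dots> = (\<Sum>C\<in>?cl. \<Sum>D\<in>?cl. \<Sum>A\<in>same_dom Q.
       (a (rep C) * of_nat (mark_basis GG A (rep C))) * (b (rep D) * of_nat (mark_basis GG (A\<inverse> O Q) (rep D))))"
    by (intro sum.cong refl) (simp add: card_tensor_fixed[OF rep_bifree rep_bifree Q] sum_distrib_left mult.assoc mult.left_commute)
  also have "\<dots> = (\<Sum>A\<in>same_dom Q. (\<Sum>C\<in>?cl. \<Sum>D\<in>?cl.
       (a (rep C) * of_nat (mark_basis GG A (rep C))) * (b (rep D) * of_nat (mark_basis GG (A\<inverse> O Q) (rep D)))))"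
    by (subst sum.swap[of _ ?cl "same_dom Q", symmetric], subst (2) sum.swap) simp
  also have "\<dots> = (\<Sum>A\<in>same_dom Q. D.fmark a A * D.fmark b (A\<inverse> O Q))"
  proof (rule sum.cong[OF refl])
    fix A assume "A \<in> same_dom Q"
    then have A: "bifree G A" unfolding same_dom_def by simp
    have "A \<subseteq> carrier GG" "A\<inverse> O Q \<subseteq> carrier GG"
      using A bifree_comp[OF bifree_converse[OF A] Q] D.F_sub by simp_all
    then show "(\<Sum>C\<in>?cl. \<Sum>D\<in>?cl.
       (a (rep C) * of_nat (mark_basis GG A (rep C))) * (b (rep D) * of_nat (mark_basis GG (A\<inverse> O Q) (rep D))))
      = D.fmark a A * D.fmark b (A\<inverse> O Q)"
      using a b unfolding bd_space_eq bd_classes_eq by (simp add: D.fmark_classes sum_product)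
  qed
  finally have "D.fmark (bd_mult G a b) Q * ?n = (\<Sum>A\<in>same_dom Q. D.fmark a A * D.fmark b (A\<inverse> O Q))" .
  then have "D.fmark (bd_mult G a b) Q / ?n = (\<Sum>A\<in>same_dom Q. D.fmark a A * D.fmark b (A\<inverse> O Q)) / (?n * ?n)"
    using ord_inv by (simp add: field_simps)
  then show ?thesis unfolding ghost_def ghost_mult_def by (simp add: sum_divide_distrib)
qed

end

section \<open>The diagonal map in ghost coordinates\<close>

context fin_group
begin

lemma inv_mult_cancel:
  assumes "g \<in> carrier G" "x \<in> carrier G"
  shows "inv g \<otimes> (g \<otimes> x) = x" "g \<otimes> (inv g \<otimes> x) = x"
  using assms by (simp_all add: m_assoc[symmetric])

text \<open>The isomorphism U -> kUk^-1 given by conjugation with k. As subgroups of G x G these are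
  exactly the conjugates of diagonals (\<open>conj_graph_conj_diag\<close>,
  \<open>conjugate_diag_twist\<close>), hence the support of the image of
  \<open>Delta\<close>.\<close>

definition conj_graph :: "'a \<Rightarrow> 'a set \<Rightarrow> ('a \<times> 'a) set" where
  "conj_graph k U = (\<lambda>u. (u, k \<otimes> u \<otimes> inv k)) ` U"

definition centralizer :: "'a set \<Rightarrow> 'a set" where
  "centralizer U = {c \<in> carrier G. \<forall>u\<in>U. c \<otimes> u = u \<otimes> c}"

lemma Domain_conj_graph [simp]: "Domain (conj_graph k U) = U" and Range_conj_graph: "Range (conj_graph k U) = conj_img G k U"
  unfolding conj_graph_def conj_img_def by auto

lemma conj_graph_one: "U \<subseteq> carrier G \<Longrightarrow> conj_graph \<one> U = diag U"
  unfolding conj_graph_def diag_def by (auto simp: subset_iff image_iff)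

lemma conj_cancel:
  assumes "g \<in> carrier G" "x \<in> carrier G"
  shows "inv g \<otimes> (g \<otimes> x \<otimes> inv g) \<otimes> g = x" "g \<otimes> (inv g \<otimes> x \<otimes> g) \<otimes> inv g = x"
  using assms by (metis inv_closed inv_solve_left inv_solve_right' m_closed m_assoc)+

lemma conj_img_conj_graph:
  assumes "U \<subseteq> carrier G" "g \<in> carrier G" "h \<in> carrier G" "k \<in> carrier G"
  shows "conj_img GG (g, h) (conj_graph k U) = conj_graph (h \<otimes> k \<otimes> inv g) (conj_img G g U)"
proof -
  have "h \<otimes> (k \<otimes> u \<otimes> inv k) \<otimes> inv h = h \<otimes> k \<otimes> inv g \<otimes> (g \<otimes> u \<otimes> inv g) \<otimes> inv (h \<otimes> k \<otimes> inv g)"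
    if "u \<in> U" for u
  proof -
    have u: "u \<in> carrier G" using assms that by auto
    show ?thesis using assms u by (simp add: inv_mult_group m_assoc inv_mult_cancel)
  qed
  then show ?thesis unfolding conj_img_GG[OF assms(2,3)] unfolding conj_graph_def conj_img_def image_image
    by (intro image_cong refl) simp
qed

lemma conj_graph_conj_diag:
  "U \<subseteq> carrier G \<Longrightarrow> k \<in> carrier G \<Longrightarrow> conj_graph k U = conj_img GG (\<one>, k) (diag U)"
  using conj_img_conj_graph[of U \<one> k \<one>] conj_img_one[of U] conj_graph_one[of U] by simp

lemma diag_bifree: assumes "subgroup U G" shows "bifree G (diag U)"
proof -
  have "subgroup (diag U) GG"
    by (rule GG_subgroupI) (use subgroup.subset[OF assms] subgroup.one_closed[OF assms]
        subgroup.m_closed[OF assms] subgroup.m_inv_closed[OF assms] in \<open>auto simp: diag_def\<close>)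
  then show ?thesis unfolding bifree_iff diag_def by auto
qed

lemma conj_graph_bifree: "subgroup U G \<Longrightarrow> k \<in> carrier G \<Longrightarrow> bifree G (conj_graph k U)"
  using bifree_conj[OF diag_bifree, of U "(\<one>, k)"] conj_graph_conj_diag[of U k] subgroup.subset[of U G] by simp

text \<open>Two elements conjugate U in the same way iff they lie in the same left coset of its
  centralizer.\<close>

lemma card_centralizer_fibre:
  assumes "U \<subseteq> carrier G" "a \<in> carrier G"
  shows "card {b \<in> carrier G. \<forall>u\<in>U. b \<otimes> u \<otimes> inv b = a \<otimes> u \<otimes> inv a} = card (centralizer U)"
proof (rule bij_betw_same_card[symmetric])
  have *: "(a \<otimes> c) \<otimes> u \<otimes> inv (a \<otimes> c) = a \<otimes> u \<otimes> inv a \<longleftrightarrow> c \<otimes> u = u \<otimes> c"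
    if "u \<in> U" "c \<in> carrier G" for u c
  proof -
    have u: "u \<in> carrier G" using that assms by auto
    have "(a \<otimes> c) \<otimes> u \<otimes> inv (a \<otimes> c) = a \<otimes> (c \<otimes> u \<otimes> inv c) \<otimes> inv a"
      using u that assms by (simp add: inv_mult_group m_assoc)
    then have "(a \<otimes> c) \<otimes> u \<otimes> inv (a \<otimes> c) = a \<otimes> u \<otimes> inv a \<longleftrightarrow> c \<otimes> u \<otimes> inv c = u"
      using u that assms by simp
    also have "\<dots> \<longleftrightarrow> c \<otimes> u = u \<otimes> c" using u that
      by (metis inv_closed inv_solve_right m_closed)
    finally show ?thesis .
  qed
  show "bij_betw (\<lambda>c. a \<otimes> c) (centralizer U) {b \<in> carrier G. \<forall>u\<in>U. b \<otimes> u \<otimes> inv b = a \<otimes> u \<otimes> inv a}"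
  proof (rule bij_betwI[where g = "\<lambda>b. inv a \<otimes> b"])
    show "(\<lambda>c. a \<otimes> c) \<in> centralizer U \<rightarrow> {b \<in> carrier G. \<forall>u\<in>U. b \<otimes> u \<otimes> inv b = a \<otimes> u \<otimes> inv a}"
      using * assms unfolding centralizer_def by auto
    show "(\<lambda>b. inv a \<otimes> b) \<in> {b \<in> carrier G. \<forall>u\<in>U. b \<otimes> u \<otimes> inv b = a \<otimes> u \<otimes> inv a} \<rightarrow> centralizer U"
    proof
      fix b assume b: "b \<in> {b \<in> carrier G. \<forall>u\<in>U. b \<otimes> u \<otimes> inv b = a \<otimes> u \<otimes> inv a}"
      then have "a \<otimes> (inv a \<otimes> b) = b" using assms by (simp add: m_assoc[symmetric])
      then show "inv a \<otimes> b \<in> centralizer U" using *[of _ "inv a \<otimes> b"] b assms unfolding centralizer_def by simp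
    qed
  qed (use assms in \<open>auto simp: centralizer_def m_assoc[symmetric]\<close>)
qed

lemma conj_graph_eq_iff: "conj_graph k U = conj_graph k' U \<longleftrightarrow> (\<forall>u\<in>U. k \<otimes> u \<otimes> inv k = k' \<otimes> u \<otimes> inv k')"
  unfolding conj_graph_def by (auto simp: image_iff)

lemma card_conj_graph_fibre:
  assumes "U \<subseteq> carrier G" "k \<in> carrier G"
  shows "card {k' \<in> carrier G. conj_graph k' U = conj_graph k U} = card (centralizer U)"
  unfolding conj_graph_eq_iff using card_centralizer_fibre[OF assms] .

lemma centralizer_subgroup: assumes "U \<subseteq> carrier G" shows "subgroup (centralizer U) G"
proof (rule subgroupI)
  show "centralizer U \<noteq> {}" using assms unfolding centralizer_def by (auto simp: subset_iff intro!: exI[of _ \<one>])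
  show "inv a \<in> centralizer U" if a: "a \<in> centralizer U" for a
  proof -
    have "inv a \<otimes> u = u \<otimes> inv a" if "u \<in> U" for u
    proof -
      have u: "u \<in> carrier G" and ac: "a \<in> carrier G" and c: "a \<otimes> u = u \<otimes> a"
        using a that assms unfolding centralizer_def by auto
      have "inv a \<otimes> (a \<otimes> u) \<otimes> inv a = u \<otimes> inv a" "inv a \<otimes> (u \<otimes> a) \<otimes> inv a = inv a \<otimes> u"
        using u ac by (simp_all add: m_assoc inv_mult_cancel)
      then show ?thesis using c by simp
    qed
    then show ?thesis using a unfolding centralizer_def by simp
  qed
  show "a \<otimes> b \<in> centralizer U" if a: "a \<in> centralizer U" and b: "b \<in> centralizer U" for a b
  proof -
    have "a \<otimes> b \<otimes> u = u \<otimes> (a \<otimes> b)" if "u \<in> U" for u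
    proof -
      have u: "u \<in> carrier G" "a \<in> carrier G" "b \<in> carrier G" "a \<otimes> u = u \<otimes> a" "b \<otimes> u = u \<otimes> b"
        using a b that assms unfolding centralizer_def by auto
      have "a \<otimes> b \<otimes> u = a \<otimes> u \<otimes> b" using u(1-3,5) by (simp add: m_assoc)
      also have "\<dots> = u \<otimes> (a \<otimes> b)" unfolding u(4) using u(1-3) by (simp add: m_assoc)
      finally show ?thesis .
    qed
    then show ?thesis using a b unfolding centralizer_def by simp
  qed
qed (auto simp: centralizer_def)

lemma conj_graph_sub_iff:
  assumes "L \<subseteq> carrier GG"
  shows "L \<subseteq> conj_graph k V \<longleftrightarrow> Domain L \<subseteq> V \<and> L = conj_graph k (Domain L)"
proof
  assume a: "L \<subseteq> conj_graph k V"
  have "L = conj_graph k (Domain L)"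
  proof (rule Set.set_eqI)
    fix p show "p \<in> L \<longleftrightarrow> p \<in> conj_graph k (Domain L)"
    proof (cases p)
      case (Pair a b) then show ?thesis using a unfolding conj_graph_def by auto
    qed
  qed
  then show "Domain L \<subseteq> V \<and> L = conj_graph k (Domain L)" using a unfolding conj_graph_def by auto
next
  assume "Domain L \<subseteq> V \<and> L = conj_graph k (Domain L)"
  then show "L \<subseteq> conj_graph k V" unfolding conj_graph_def by blast
qed

text \<open>Conjugating L by (k, 1) or (1, k) composes the isomorphism with a conjugation at its
  source or at its target. The first two clauses determine the factorisations of L in which the
  first, respectively the second, factor is conjugation by k; they collapse the convolution with the
  identity on either side.\<close>

lemma conj_img_cases:
  assumes "bifree G L" "k \<in> carrier G"
  shows "(conj_graph k (Domain L))\<inverse> O L = conj_img GG (k, \<one>) L"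
    and "A \<subseteq> carrier GG \<Longrightarrow> Domain A = Domain L \<Longrightarrow> bifree G A \<Longrightarrow>
      A\<inverse> O L = conj_graph k (Range A) \<longleftrightarrow> A = conj_img GG (\<one>, inv k) L"
    and "Domain (conj_img GG (\<one>, k) L) = Domain L"
    and "Range (conj_img GG (\<one>, k) L) = conj_img G k (Range L)"
proof -
  note D = GG_subgroupD[OF bifree_subgroup[OF assms(1)]]
  have cL: "conj_img GG (k, \<one>) L = (\<lambda>(a, b). (k \<otimes> a \<otimes> inv k, b)) ` L"
    unfolding conj_img_GG[OF assms(2) one_closed]
    by (rule image_cong[OF refl]) (clarsimp simp: D(2))
  show "(conj_graph k (Domain L))\<inverse> O L = conj_img GG (k, \<one>) L"
    unfolding cL conj_graph_def by (auto simp: image_iff)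
  have cR: "conj_img GG (\<one>, h) L = (\<lambda>(a, b). (a, h \<otimes> b \<otimes> inv h)) ` L" if "h \<in> carrier G" for h
    unfolding conj_img_GG[OF one_closed that]
    by (rule image_cong[OF refl]) (clarsimp simp: D(1))
  show "Domain (conj_img GG (\<one>, k) L) = Domain L" "Range (conj_img GG (\<one>, k) L) = conj_img G k (Range L)"
    unfolding cR[OF assms(2)] by (force simp: conj_img_def)+
  assume A: "A \<subseteq> carrier GG" "Domain A = Domain L" "bifree G A"
  have ik: "inv k \<in> carrier G" using assms(2) by simp
  show "A\<inverse> O L = conj_graph k (Range A) \<longleftrightarrow> A = conj_img GG (\<one>, inv k) L"
  proof
    assume e: "A\<inverse> O L = conj_graph k (Range A)"
    have *: "b = inv k \<otimes> c \<otimes> k" if "(a, b) \<in> A" "(a, c) \<in> L" for a b c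
    proof -
      have "(b, c) \<in> conj_graph k (Range A)" using that e by blast
      then have "c = k \<otimes> b \<otimes> inv k" unfolding conj_graph_def by auto
      then show ?thesis using conj_cancel(1)[of k b] assms(2) A(1) that by auto
    qed
    show "A = conj_img GG (\<one>, inv k) L"
    proof (rule Set.set_eqI)
      fix p show "p \<in> A \<longleftrightarrow> p \<in> conj_img GG (\<one>, inv k) L"
      proof
        assume "p \<in> A"
        then obtain a b where p: "p = (a, b)" "(a, b) \<in> A" by (cases p) auto
        then obtain c where "(a, c) \<in> L" using A(2) by blast
        then show "p \<in> conj_img GG (\<one>, inv k) L"
          unfolding cR[OF ik] using * p assms(2) by (auto simp: image_iff intro!: bexI[of _ "(a, c)"])
      next
        assume "p \<in> conj_img GG (\<one>, inv k) L"
        then obtain a c where p: "p = (a, inv k \<otimes> c \<otimes> k)" "(a, c) \<in> L"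
          unfolding cR[OF ik] using assms(2) by auto
        then obtain b where b: "(a, b) \<in> A" using A(2) by blast
        show "p \<in> A" using *[OF b p(2)] b p(1) by simp
      qed
    qed
  next
    assume e: "A = conj_img GG (\<one>, inv k) L"
    have AL: "(a, b) \<in> A \<Longrightarrow> \<exists>c. (a, c) \<in> L \<and> b = inv k \<otimes> c \<otimes> k \<and> c = k \<otimes> b \<otimes> inv k" for a b
      unfolding e cR[OF ik] using assms(2) D(2) conj_cancel(2)[of k] by fastforce
    have sL: "(a, c) \<in> L \<Longrightarrow> (a, c') \<in> L \<Longrightarrow> c = c'" for a c c' using assms(1) unfolding bifree_iff by blast
    show "A\<inverse> O L = conj_graph k (Range A)"
    proof (rule Set.set_eqI)
      fix p show "p \<in> A\<inverse> O L \<longleftrightarrow> p \<in> conj_graph k (Range A)"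
      proof
        assume "p \<in> A\<inverse> O L"
        then obtain a b c where p: "p = (b, c)" "(a, b) \<in> A" "(a, c) \<in> L" by blast
        then have "c = k \<otimes> b \<otimes> inv k" using AL[OF p(2)] sL by blast
        then show "p \<in> conj_graph k (Range A)" unfolding conj_graph_def using p by auto
      next
        assume "p \<in> conj_graph k (Range A)"
        then obtain a b where p: "(a, b) \<in> A" "p = (b, k \<otimes> b \<otimes> inv k)" unfolding conj_graph_def by auto
        then obtain c where "(a, c) \<in> L" "c = k \<otimes> b \<otimes> inv k" using AL[OF p(1)] by blast
        then show "p \<in> A\<inverse> O L" using p by auto
      qed
    qed
  qed
qed

text \<open>(a, b) normalises \<open>diag V\<close> iff a normalises V and b acts on V as a does.
  For fixed a the possible b form a coset of the centralizer.\<close>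

lemma card_normalizer_of_diag:
  assumes "subgroup V G"
  shows "card (group.normalizer_of GG (diag V)) = card (centralizer V) * card (normalizer_of V)"
proof -
  interpret D: fin_group GG by (rule GG_fin_group)
  have sV: "V \<subseteq> carrier G" using assms by (rule subgroup.subset)
  have cd: "conj_img GG (a, b) (diag V) = (\<lambda>v. (a \<otimes> v \<otimes> inv a, b \<otimes> v \<otimes> inv b)) ` V"
    if "a \<in> carrier G" "b \<in> carrier G" for a b
    unfolding conj_img_GG[OF that] diag_def by auto
  have iff: "(a, b) \<in> D.normalizer_of (diag V) \<longleftrightarrow> a \<in> normalizer_of V \<and> b \<in> carrier G \<and> (\<forall>v\<in>V. b \<otimes> v \<otimes> inv b = a \<otimes> v \<otimes> inv a)"
    for a b
  proof
    assume l: "(a, b) \<in> D.normalizer_of (diag V)"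
    then have ab: "a \<in> carrier G" "b \<in> carrier G" unfolding D.normalizer_of_def by auto
    have e: "(\<lambda>v. (a \<otimes> v \<otimes> inv a, b \<otimes> v \<otimes> inv b)) ` V = diag V" using l cd[OF ab] unfolding D.normalizer_of_def by simp
    then have "fst ` (\<lambda>v. (a \<otimes> v \<otimes> inv a, b \<otimes> v \<otimes> inv b)) ` V = fst ` diag V" by simp
    then have "conj_img G a V = V" unfolding conj_img_def diag_def image_image by (simp add: image_def) 
    moreover have "b \<otimes> v \<otimes> inv b = a \<otimes> v \<otimes> inv a" if "v \<in> V" for v
    proof -
      have "(a \<otimes> v \<otimes> inv a, b \<otimes> v \<otimes> inv b) \<in> diag V" using e that by blast
      then show ?thesis unfolding diag_def by auto
    qed
    ultimately show "a \<in> normalizer_of V \<and> b \<in> carrier G \<and> (\<forall>v\<in>V. b \<otimes> v \<otimes> inv b = a \<otimes> v \<otimes> inv a)"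
      unfolding normalizer_of_def using ab by simp
  next
    assume r: "a \<in> normalizer_of V \<and> b \<in> carrier G \<and> (\<forall>v\<in>V. b \<otimes> v \<otimes> inv b = a \<otimes> v \<otimes> inv a)"
    then have ab: "a \<in> carrier G" "b \<in> carrier G" unfolding normalizer_of_def by auto
    have "(\<lambda>v. (a \<otimes> v \<otimes> inv a, b \<otimes> v \<otimes> inv b)) ` V = (\<lambda>w. (w, w)) ` conj_img G a V"
      unfolding conj_img_def image_image using r by (intro image_cong) auto
    also have "\<dots> = diag V" using r unfolding normalizer_of_def diag_def by auto
    finally show "(a, b) \<in> D.normalizer_of (diag V)" unfolding D.normalizer_of_def using cd[OF ab] ab by simp
  qed
  show ?thesis
  proof (rule card_fibres[where f = fst])
    show "finite (D.normalizer_of (diag V))" unfolding D.normalizer_of_def by simp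
    show "fst ` D.normalizer_of (diag V) = normalizer_of V"
      using iff unfolding normalizer_of_def by (force simp: image_iff)
    fix a assume a: "a \<in> normalizer_of V"
    have "{p \<in> D.normalizer_of (diag V). fst p = a}
        = Pair a ` {b \<in> carrier G. \<forall>v\<in>V. b \<otimes> v \<otimes> inv b = a \<otimes> v \<otimes> inv a}"
      using iff a by auto
    moreover have "a \<in> carrier G" using a unfolding normalizer_of_def by simp
    ultimately show "card {p \<in> D.normalizer_of (diag V). fst p = a} = card (centralizer V)"
      using card_centralizer_fibre[OF sV, of a] by (simp add: card_image inj_on_def)
  qed
qed

end

section \<open>The identity and the image of \<open>Delta\<close> in ghost coordinates\<close>

context double_burnside
begin

text \<open>The ghost coordinates of the identity: the normalised number of elements of \<open>G\<close> whose conjugation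
  has graph \<open>L\<close>.\<close>

definition ghost_one :: "('a \<times> 'a) set \<Rightarrow> 'k" where
  "ghost_one L = of_nat (card {k \<in> carrier G. L = conj_graph k (Domain L)}) / of_nat (order G)"

definition class_fun :: "(('a \<times> 'a) set \<Rightarrow> 'k) \<Rightarrow> bool" where
  "class_fun f \<longleftrightarrow> (\<forall>L p. bifree G L \<longrightarrow> p \<in> carrier GG \<longrightarrow> f (conj_img GG p L) = f L)"

definition conj_inv :: "('a set \<Rightarrow> 'k) \<Rightarrow> bool" where
  "conj_inv m \<longleftrightarrow> (\<forall>U g. subgroup U G \<longrightarrow> g \<in> carrier G \<longrightarrow> m (conj_img G g U) = m U)"

lemma ghost_one_sum: "ghost_one L = (\<Sum>k\<in>carrier G. if L = conj_graph k (Domain L) then 1 else 0) / of_nat (order G)"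
  unfolding ghost_one_def by (simp add: sum.inter_filter[symmetric])

lemma ghost_class_fun: "a \<in> bd_space G \<Longrightarrow> class_fun (ghost a)"
  unfolding class_fun_def ghost_def bd_space_eq using D.fmark_conj D.F_sub by simp

lemma ghost_inj:
  assumes "a \<in> bd_space G" "b \<in> bd_space G" "\<And>L. bifree G L \<Longrightarrow> ghost a L = ghost b L"
  shows "a = b"
  using D.fmark_inj[of a b] assms ord_inv unfolding bd_space_eq ghost_def by simp

text \<open>Supplies elements over the field, such as the indicator of one class of isomorphisms,
  against which commutation is tested later.\<close>

lemma ghost_surj:
  assumes "class_fun f"
  obtains a where "a \<in> bd_space G" "\<And>L. bifree G L \<Longrightarrow> ghost a L = f L"
proof
  define m where "m = (\<lambda>L. f L * of_nat (order G))"
  show "D.of_marks m \<in> bd_space G" unfolding bd_space_eq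
  proof (rule D.of_marks_fspace)
    fix L p assume "L \<in> {L. bifree G L}" and p: "p \<in> carrier GG"
    then have "f (conj_img GG p L) = f L" using assms unfolding class_fun_def by blast
    then show "m (conj_img GG p L) = m L" unfolding m_def by simp
  qed
  show "ghost (D.of_marks m) L = f L" if "bifree G L" for L
    unfolding ghost_def using D.fmark_of_marks[of L m] that ord_inv by (simp add: m_def)
qed

text \<open>\<open>ghost_one\<close> is an average over the conjugations by elements k of G, so the
  convolution averages f over the (k, 1)-conjugates of L, on which a class function is constant. The
  factor m is read at the source of the first factor, which is the source of L.\<close>

lemma ghost_mult_one_left:
  assumes f: "class_fun f" and L: "bifree G L"
  shows "ghost_mult (\<lambda>A. ghost_one A * m (Domain A)) f L = m (Domain L) * f L"
proof -
  let ?n = "of_nat (order G) :: 'k"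
  have "ghost_mult (\<lambda>A. ghost_one A * m (Domain A)) f L
      = (\<Sum>A\<in>same_dom L. \<Sum>k\<in>carrier G. (if A = conj_graph k (Domain L) then m (Domain L) * f (A\<inverse> O L) / ?n else 0))"
    unfolding ghost_mult_def
  proof (rule sum.cong[OF refl])
    fix A assume "A \<in> same_dom L"
    then have d: "Domain A = Domain L" unfolding same_dom_def by simp
    show "ghost_one A * m (Domain A) * f (A\<inverse> O L)
      = (\<Sum>k\<in>carrier G. if A = conj_graph k (Domain L) then m (Domain L) * f (A\<inverse> O L) / ?n else 0)"
      unfolding ghost_one_sum d sum_divide_distrib sum_distrib_right by (intro sum.cong refl) simp
  qed
  also have "\<dots> = (\<Sum>k\<in>carrier G. \<Sum>A\<in>same_dom L. (if A = conj_graph k (Domain L) then m (Domain L) * f (A\<inverse> O L) / ?n else 0))"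
    by (rule sum.swap)
  also have "\<dots> = (\<Sum>k\<in>carrier G. m (Domain L) * f L / ?n)"
  proof (rule sum.cong[OF refl])
    fix k assume k: "k \<in> carrier G"
    have "conj_graph k (Domain L) \<in> same_dom L"
      unfolding same_dom_def using conj_graph_bifree[OF Domain_subgroup[OF bifree_subgroup[OF L]] k] by simp
    moreover have "f ((conj_graph k (Domain L))\<inverse> O L) = f L"
      unfolding conj_img_cases(1)[OF L k] using f k L unfolding class_fun_def by simp
    ultimately show "(\<Sum>A\<in>same_dom L. (if A = conj_graph k (Domain L) then m (Domain L) * f (A\<inverse> O L) / ?n else 0))
        = m (Domain L) * f L / ?n"
      using fin_same_dom by (simp add: sum.delta')
  qed
  also have "\<dots> = m (Domain L) * f L" using ord_inv unfolding order_def by simp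
  finally show ?thesis .
qed

text \<open>Here m is read at the source of the second factor. For the terms that survive, this is a
  G-conjugate of \<open>Range L\<close>, and conjugation invariance of m removes the
  ambiguity.\<close>

lemma ghost_mult_one_right:
  assumes f: "class_fun f" and m: "conj_inv m" and L: "bifree G L"
  shows "ghost_mult f (\<lambda>A. ghost_one A * m (Domain A)) L = f L * m (Range L)"
proof -
  let ?n = "of_nat (order G) :: 'k" and ?c = "\<lambda>k. conj_img GG (\<one>, inv k) L"
  have "f A * (ghost_one (A\<inverse> O L) * m (Domain (A\<inverse> O L)))
      = (\<Sum>k\<in>carrier G. (if A = ?c k then f A * m (Range A) / ?n else 0))" if A: "A \<in> same_dom L" for A
  proof -
    have A': "A \<subseteq> carrier GG" "Domain A = Domain L" "bifree G A"
      using A D.F_sub unfolding same_dom_def by auto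
    have dom: "Domain (A\<inverse> O L) = Range A" using A'(2) by blast
    have "ghost_one (A\<inverse> O L) = (\<Sum>k\<in>carrier G. if A = ?c k then 1 else 0) / ?n"
      unfolding ghost_one_sum dom using conj_img_cases(2)[OF L _ A'] by simp
    then show ?thesis unfolding dom
      by (simp only: sum_distrib_right sum_distrib_left sum_divide_distrib) (intro sum.cong refl, simp)
  qed
  then have "ghost_mult f (\<lambda>A. ghost_one A * m (Domain A)) L
     = (\<Sum>A\<in>same_dom L. \<Sum>k\<in>carrier G. (if A = ?c k then f A * m (Range A) / ?n else 0))"
    unfolding ghost_mult_def by simp
  also have "\<dots> = (\<Sum>k\<in>carrier G. \<Sum>A\<in>same_dom L. (if A = ?c k then f A * m (Range A) / ?n else 0))"
    by (rule sum.swap)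
  also have "\<dots> = (\<Sum>k\<in>carrier G. f L * m (Range L) / ?n)"
  proof (rule sum.cong[OF refl])
    fix k assume k: "k \<in> carrier G"
    then have ik: "inv k \<in> carrier G" by simp
    have "?c k \<in> same_dom L"
      unfolding same_dom_def using conj_img_cases(3)[OF L ik] bifree_conj[OF L] ik by simp
    moreover have "f (?c k) = f L" using f ik L unfolding class_fun_def by simp
    moreover have "m (Range (?c k)) = m (Range L)"
      unfolding conj_img_cases(4)[OF L ik]
      using m ik Range_subgroup[OF bifree_subgroup[OF L]] unfolding conj_inv_def by simp
    ultimately show "(\<Sum>A\<in>same_dom L. (if A = ?c k then f A * m (Range A) / ?n else 0))
        = f L * m (Range L) / ?n"
      using fin_same_dom by (simp add: sum.delta')
  qed
  also have "\<dots> = f L * m (Range L)" using ord_inv unfolding order_def by simp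
  finally show ?thesis .
qed

lemma ghost_one_twist: assumes "ghost_one L \<noteq> 0" obtains k where "k \<in> carrier G" "L = conj_graph k (Domain L)"
proof -
  have "{k \<in> carrier G. L = conj_graph k (Domain L)} \<noteq> {}" using assms unfolding ghost_one_def by force
  then show ?thesis using that by blast
qed

lemma ghost_one_range: assumes "ghost_one L \<noteq> 0" obtains k where "k \<in> carrier G" "Range L = conj_img G k (Domain L)"
  using ghost_one_twist[OF assms] Range_conj_graph by metis

lemma ghost_one_diag:
  assumes "subgroup U G" shows "ghost_one (diag U) = of_nat (card (centralizer U)) / of_nat (order G)"
proof -
  have sU: "U \<subseteq> carrier G" using assms by (rule subgroup.subset)
  have "Domain (diag U) = U" unfolding diag_def by auto
  then show ?thesis unfolding ghost_one_def using card_conj_graph_fibre[OF sU one_closed] conj_graph_one[OF sU]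
    by (simp add: eq_commute)
qed

text \<open>If k realises L as a conjugation, then h k g^-1 realises the (g, h)-conjugate of L, and
  this correspondence is bijective.\<close>

lemma ghost_one_class_fun: "class_fun ghost_one"
  unfolding class_fun_def
proof (intro allI impI)
  fix L p assume L: "bifree G L" and p: "p \<in> carrier GG"
  obtain g h where gh: "p = (g, h)" "g \<in> carrier G" "h \<in> carrier G" using p by (cases p) auto
  have sL: "L \<subseteq> carrier GG" using D.F_sub L by simp
  have sD: "Domain L \<subseteq> carrier G" using sL by auto
  have dom: "Domain (conj_img GG p L) = conj_img G g (Domain L)"
    unfolding gh(1) conj_img_GG[OF gh(2,3)] unfolding conj_img_def by force
  have "card {k \<in> carrier G. L = conj_graph k (Domain L)}
      = card {k \<in> carrier G. conj_img GG p L = conj_graph k (Domain (conj_img GG p L))}"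
  proof (rule bij_betw_same_card)
    have *: "L = conj_graph k (Domain L) \<longleftrightarrow> conj_img GG p L = conj_graph (h \<otimes> k \<otimes> inv g) (conj_img G g (Domain L))"
      if "k \<in> carrier G" for k
    proof -
      have sg: "conj_graph k (Domain L) \<subseteq> carrier GG" using sD that unfolding conj_graph_def by auto
      show ?thesis unfolding conj_img_conj_graph[OF sD gh(2,3) that, symmetric] gh(1)[symmetric]
        using D.conj_img_cancel(1)[OF sL p] D.conj_img_cancel(1)[OF sg p] by metis
    qed
    show "bij_betw (\<lambda>k. h \<otimes> k \<otimes> inv g) {k \<in> carrier G. L = conj_graph k (Domain L)}
      {k \<in> carrier G. conj_img GG p L = conj_graph k (Domain (conj_img GG p L))}"
      unfolding dom
    proof (rule bij_betwI[where g = "\<lambda>k. inv h \<otimes> k \<otimes> g"])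
      show "(\<lambda>k. h \<otimes> k \<otimes> inv g) \<in> {k \<in> carrier G. L = conj_graph k (Domain L)}
        \<rightarrow> {k \<in> carrier G. conj_img GG p L = conj_graph k (conj_img G g (Domain L))}"
        using * gh by auto
      have inv1: "h \<otimes> (inv h \<otimes> k \<otimes> g) \<otimes> inv g = k" "inv h \<otimes> (h \<otimes> k \<otimes> inv g) \<otimes> g = k"
        if "k \<in> carrier G" for k
        using gh that by (simp_all add: m_assoc) (simp_all add: m_assoc[symmetric])
      show "(\<lambda>k. inv h \<otimes> k \<otimes> g) \<in> {k \<in> carrier G. conj_img GG p L = conj_graph k (conj_img G g (Domain L))}
        \<rightarrow> {k \<in> carrier G. L = conj_graph k (Domain L)}"
      proof
        fix k assume k: "k \<in> {k \<in> carrier G. conj_img GG p L = conj_graph k (conj_img G g (Domain L))}"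
        then show "inv h \<otimes> k \<otimes> g \<in> {k \<in> carrier G. L = conj_graph k (Domain L)}"
          using *[of "inv h \<otimes> k \<otimes> g"] inv1(1)[of k] gh by simp
      qed
    qed (use gh in \<open>simp_all add: m_assoc, simp_all add: m_assoc[symmetric]\<close>)
  qed
  then show "ghost_one (conj_img GG p L) = ghost_one L" unfolding ghost_one_def by simp
qed

lemma burnside_space_eq: "burnside_space G = S.fspace"
  unfolding burnside_space_def S.fspace_def by simp

text \<open>The source of a conjugate of \<open>diag V\<close> recovers V up to G-conjugacy, which
  is why the choice of subgroup in the definition of \<open>Delta\<close> does not affect its
  value.\<close>

lemma conjugate_diag:
  assumes "subgroup V G" "conjugate GG (diag V) M"
  shows "conjugate G V (Domain M)"
proof -
  obtain g h where gh: "g \<in> carrier G" "h \<in> carrier G" "M = conj_img GG (g, h) (diag V)"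
    using assms(2) unfolding conjugate_def by auto
  have "Domain M = conj_img G g V"
    unfolding gh(3) conj_img_GG[OF gh(1,2)] unfolding conj_img_def diag_def by force
  then show ?thesis using conjugateI[OF assms(1) gh(1)] by simp
qed

lemma Delta_val:
  assumes "x \<in> burnside_space G" "subgroup V G" "conjugate GG (diag V) M"
  shows "Delta G x M = x V"
proof -
  let ?P = "\<lambda>U. subgroup U G \<and> conjugate GG (diag U) M"
  have ex: "\<exists>U. ?P U" using assms(2,3) by blast
  then have P: "?P (SOME U. ?P U)" by (rule someI_ex)
  have "conjugate G (SOME U. ?P U) V"
    using P conjugate_diag assms(2,3) conjugate_trans conjugate_sym by blast
  then have "x (SOME U. ?P U) = x V" using assms(1) unfolding burnside_space_def by blast
  then show ?thesis unfolding Delta_def using ex by simp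
qed

lemma conjugate_diag_conj_graph:
  assumes "subgroup V G" "k \<in> carrier G" shows "conjugate GG (diag V) (conj_graph k V)"
  using D.conjugateI[OF bifree_subgroup[OF diag_bifree[OF assms(1)]], of "(\<one>, k)"]
    conj_graph_conj_diag[OF subgroup.subset[OF assms(1)] assms(2)] assms(2) by simp

lemma Delta_conj_graph:
  assumes "x \<in> burnside_space G" "subgroup V G" "k \<in> carrier G"
  shows "Delta G x (conj_graph k V) = x V"
  using Delta_val[OF assms(1,2) conjugate_diag_conj_graph[OF assms(2,3)]] .

lemma conjugate_diag_twist:
  assumes "subgroup V G" "conjugate GG (diag V) M"
  obtains k where "k \<in> carrier G" "M = conj_graph k (Domain M)"
proof -
  have sV: "V \<subseteq> carrier G" using assms(1) by (rule subgroup.subset)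
  obtain g h where gh: "g \<in> carrier G" "h \<in> carrier G" "M = conj_img GG (g, h) (diag V)"
    using assms(2) unfolding conjugate_def by auto
  have "M = conj_graph (h \<otimes> \<one> \<otimes> inv g) (conj_img G g V)"
    unfolding gh(3) conj_graph_one[OF sV, symmetric] using conj_img_conj_graph[OF sV gh(1,2) one_closed] .
  then show ?thesis using that[of "h \<otimes> \<one> \<otimes> inv g"] gh by (metis Domain_conj_graph inv_closed m_closed one_closed)
qed

lemma Delta_zero: "(\<And>k. k \<in> carrier G \<Longrightarrow> M \<noteq> conj_graph k (Domain M)) \<Longrightarrow> Delta G x M = 0"
  unfolding Delta_def using conjugate_diag_twist by (metis (no_types, lifting))

lemma Delta_space:
  assumes x: "x \<in> burnside_space G" shows "Delta G x \<in> bd_space G"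
proof -
  have c: "Delta G x L = Delta G x M" if c: "conjugate GG L M" for L M
  proof (cases "\<exists>V. subgroup V G \<and> conjugate GG (diag V) L")
    case True
    then obtain V where V: "subgroup V G" "conjugate GG (diag V) L" by blast
    then have "conjugate GG (diag V) M" using c D.conjugate_trans by blast
    then show ?thesis using Delta_val[OF x V(1)] V(2) by simp
  next
    case False
    then have "\<not> (\<exists>V. subgroup V G \<and> conjugate GG (diag V) M)"
      using c D.conjugate_trans D.conjugate_sym by blast
    then show ?thesis unfolding Delta_def by (simp only: False if_False)
  qed
  have "bifree G L" if nz: "Delta G x L \<noteq> 0" for L
  proof -
    obtain V where "subgroup V G" "conjugate GG (diag V) L"
      using nz unfolding Delta_def by (metis (no_types, lifting))
    then show ?thesis using D.F_conjugate[of "diag V" L] diag_bifree by simp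
  qed
  then show ?thesis using c unfolding bd_space_def by blast
qed

text \<open>If M is the graph of a conjugation on V, it arises from |C_G(V)| elements k, and its
  weight is |C_G(V)| times the weight of V. The sum over M therefore becomes a sum over pairs (k,
  V). Such a graph contains L iff V contains the source of L and L itself is conjugation by k, which
  separates the two factors.\<close>

lemma ghost_Delta:
  assumes x: "x \<in> burnside_space G" and L: "bifree G L"
  shows "ghost (Delta G x) L = ghost_one L * S.fmark x (Domain L)"
proof -
  define Sb where "Sb = {U. subgroup U G}"
  have fSb: "finite Sb" unfolding Sb_def by (rule fin_subgroups)
  have sL: "L \<subseteq> carrier GG" using D.F_sub L by simp
  have term_eq: "Delta G x M * D.weight M = (\<Sum>k\<in>carrier G. \<Sum>V\<in>Sb. if M = conj_graph k V then x V * S.weight V else 0)"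
    if M: "bifree G M" for M
  proof -
    have dom: "Domain M \<in> Sb" unfolding Sb_def using Domain_subgroup[OF bifree_subgroup[OF M]] by simp
    have dsub: "Domain M \<subseteq> carrier G" using dom subgroup.subset unfolding Sb_def by auto
    have "(\<Sum>V\<in>Sb. if M = conj_graph k V then x V * S.weight V else 0)
        = (if M = conj_graph k (Domain M) then x (Domain M) * S.weight (Domain M) else 0)" for k
    proof -
      have "(\<Sum>V\<in>Sb. if M = conj_graph k V then x V * S.weight V else 0)
        = (\<Sum>V\<in>Sb. if V = Domain M then (if M = conj_graph k V then x V * S.weight V else 0) else 0)"
        by (intro sum.cong refl) auto
      then show ?thesis using dom fSb by (simp add: sum.delta')
    qed
    then have r: "(\<Sum>k\<in>carrier G. \<Sum>V\<in>Sb. if M = conj_graph k V then x V * S.weight V else 0)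
        = of_nat (card {k \<in> carrier G. M = conj_graph k (Domain M)}) * (x (Domain M) * S.weight (Domain M))"
      by (simp add: sum.inter_filter[symmetric])
    show ?thesis
    proof (cases "\<exists>k\<in>carrier G. M = conj_graph k (Domain M)")
      case False
      then have "{k \<in> carrier G. M = conj_graph k (Domain M)} = {}" by blast
      then have c0: "card {k \<in> carrier G. M = conj_graph k (Domain M)} = 0" by (metis card.empty)
      have "Delta G x M = 0" using Delta_zero[of M x] False by blast
      then show ?thesis unfolding r c0 by simp
    next
      case True
      then obtain k where k0: "k \<in> carrier G" "M = conj_graph k (Domain M)" by blast
      define V where "V = Domain M"
      have k: "k \<in> carrier G" "V = Domain M" "M = conj_graph k V"
        unfolding V_def by (fact k0(1), rule refl, fact k0(2))
      have V: "subgroup V G" using dom unfolding Sb_def V_def by simp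
      have "conjugate GG (diag V) M" using conjugate_diag_conj_graph[OF V k(1)] k(3) by simp
      then have "D.weight M = (D.weight (diag V) :: 'k)" by (rule D.weight_conj)
      moreover have "card (diag V) = card V"
      proof -
        have "diag V = (\<lambda>v. (v, v)) ` V" unfolding diag_def by auto
        then show ?thesis by (simp add: card_image inj_on_def)
      qed
      ultimately have weight: "D.weight M = of_nat (card (centralizer V)) * (S.weight V :: 'k)"
        unfolding D.weight_def S.weight_def using card_normalizer_of_diag[OF V] by simp
      have "card {k \<in> carrier G. M = conj_graph k (Domain M)} = card (centralizer V)"
        unfolding k(2)[symmetric] using card_conj_graph_fibre[OF subgroup.subset[OF V] k(1)]
        unfolding k(3)[symmetric] by (simp add: eq_commute)
      then show ?thesis unfolding r weight unfolding k(2)[symmetric]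
        using Delta_conj_graph[OF x V k(1), folded k(3)] by simp
    qed
  qed
  have fB: "finite {M. bifree G M \<and> L \<subseteq> M}" by (rule finite_subset[OF _ fin_bifree]) auto
  have "D.fmark (Delta G x) L = (\<Sum>M\<in>{M. bifree G M \<and> L \<subseteq> M}. \<Sum>k\<in>carrier G. \<Sum>V\<in>Sb. if M = conj_graph k V then x V * S.weight V else 0)"
    unfolding D.fmark_def by (rule sum.cong) (simp_all add: term_eq)
  also have "\<dots> = (\<Sum>k\<in>carrier G. \<Sum>V\<in>Sb. \<Sum>M\<in>{M. bifree G M \<and> L \<subseteq> M}. if M = conj_graph k V then x V * S.weight V else 0)"
    by (subst sum.swap, subst (2) sum.swap) simp
  also have "\<dots> = (\<Sum>k\<in>carrier G. if L = conj_graph k (Domain L) then S.fmark x (Domain L) else 0)"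
  proof (rule sum.cong[OF refl])
    fix k assume k: "k \<in> carrier G"
    have "(\<Sum>M\<in>{M. bifree G M \<and> L \<subseteq> M}. if M = conj_graph k V then x V * S.weight V else 0)
        = (if Domain L \<subseteq> V \<and> L = conj_graph k (Domain L) then x V * S.weight V else 0)" if "V \<in> Sb" for V
      using fB conj_graph_bifree[of V k] k that conj_graph_sub_iff[OF sL, of k V] unfolding Sb_def
      by (simp add: sum.delta')
    then have "(\<Sum>V\<in>Sb. \<Sum>M\<in>{M. bifree G M \<and> L \<subseteq> M}. if M = conj_graph k V then x V * S.weight V else 0)
        = (\<Sum>V\<in>Sb. if Domain L \<subseteq> V \<and> L = conj_graph k (Domain L) then x V * S.weight V else 0)"
      by simp
    also have "\<dots> = (if L = conj_graph k (Domain L) then S.fmark x (Domain L) else 0)"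
    proof (cases "L = conj_graph k (Domain L)")
      case True
      have "(\<Sum>V\<in>Sb. if Domain L \<subseteq> V \<and> L = conj_graph k (Domain L) then x V * S.weight V else 0)
          = (\<Sum>V\<in>{V \<in> Sb. Domain L \<subseteq> V}. x V * S.weight V)"
        using True fSb by (simp add: sum.inter_filter)
      then show ?thesis using True unfolding S.fmark_def Sb_def by simp
    qed simp
    finally show "(\<Sum>V\<in>Sb. \<Sum>M\<in>{M. bifree G M \<and> L \<subseteq> M}. if M = conj_graph k V then x V * S.weight V else 0)
        = (if L = conj_graph k (Domain L) then S.fmark x (Domain L) else 0)" .
  qed
  also have "\<dots> = of_nat (card {k \<in> carrier G. L = conj_graph k (Domain L)}) * S.fmark x (Domain L)"
    by (simp add: sum.inter_filter[symmetric])
  finally show ?thesis unfolding ghost_def ghost_one_def by simp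
qed

lemma mark_eq:
  assumes "x \<in> burnside_space G" "subgroup H G"
  shows "mark G H x = (S.fmark x H :: 'k)"
proof -
  have "sub_classes G = S.fclasses" unfolding sub_classes_def S.fclasses_def by simp
  then show ?thesis
    unfolding mark_def using S.fmark_classes[of x H] assms subgroup.subset[of H G]
    unfolding burnside_space_eq by simp
qed

text \<open>The unit is the image of the one-point G-set, whose marks are all 1.\<close>

lemma bd_one_Delta:
  "bd_one G = Delta G (\<lambda>U. if U = carrier G then 1 else 0 :: 'k)"
  "(\<lambda>U. if U = carrier G then 1 else 0 :: 'k) \<in> burnside_space G"
  "subgroup H G \<Longrightarrow> S.fmark (\<lambda>U. if U = carrier G then 1 else 0 :: 'k) H = 1"
proof -
  let ?x = "\<lambda>U. if U = carrier G then 1 else 0 :: 'k"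
  have cc: "U = carrier G \<longleftrightarrow> V = carrier G" if "conjugate G U V" for U V
  proof -
    have "card V = card U" using conjugate_card[OF that] .
    moreover have "U \<subseteq> carrier G" "V \<subseteq> carrier G" using conjugate_subgroup[OF that] subgroup.subset by auto
    ultimately show ?thesis using card_subset_eq[OF fin] by metis
  qed
  show bs: "?x \<in> burnside_space G"
    unfolding burnside_space_def using cc subgroup_self by auto
  show "bd_one G = Delta G ?x"
  proof
    fix L show "bd_one G L = Delta G ?x L"
    proof (cases "\<exists>V. subgroup V G \<and> conjugate GG (diag V) L")
      case True
      then obtain V where V: "subgroup V G" "conjugate GG (diag V) L" by blast
      have "conjugate GG (diag (carrier G)) L \<longleftrightarrow> V = carrier G"
        using V conjugate_diag[OF subgroup_self, of L] conjugate_diag[OF V] cc subgroup_self by metis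
      then show ?thesis using Delta_val[OF bs V] unfolding bd_one_def by simp
    next
      case False
      then show ?thesis unfolding Delta_def bd_one_def using subgroup_self by auto
    qed
  qed
  assume H: "subgroup H G"
  have f: "finite {M \<in> {U. subgroup U G}. H \<subseteq> M}" using S.finF by simp
  have "S.fmark ?x H = (\<Sum>M\<in>{M \<in> {U. subgroup U G}. H \<subseteq> M}. if M = carrier G then S.weight M else 0)"
    unfolding S.fmark_def by (intro sum.cong) auto
  also have "\<dots> = S.weight (carrier G)"
    using f H subgroup_self subgroup.subset[OF H] by (simp add: sum.delta')
  also have "\<dots> = 1"
  proof -
    have "normalizer_of (carrier G) = carrier G"
      using subset_normalizer_of[OF subgroup_self] unfolding normalizer_of_def by auto
    then show ?thesis unfolding S.weight_def using ord_inv unfolding order_def by simp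
  qed
  finally show "S.fmark ?x H = 1" .
qed

end

section \<open>Integral idempotents of automorphism algebras\<close>

text \<open>The rank of an idempotent matrix is its trace and is at most the number of distinct nonzero rows. One rank
  is split off at a time (Wedderburn reduction), which kills a row and separates no equal rows.\<close>

lemma idempotent_trace:
  fixes P :: "'s \<Rightarrow> 's \<Rightarrow> 'k::field"
  assumes S: "finite S"
    and idem: "\<And>a c. a \<in> S \<Longrightarrow> c \<in> S \<Longrightarrow> (\<Sum>b\<in>S. P a b * P b c) = P a c"
  shows "\<exists>r. r \<le> card ((\<lambda>a. restrict (P a) S) ` S - {\<lambda>_\<in>S. 0}) \<and> (\<Sum>a\<in>S. P a a) = of_nat r
     \<and> (r = 0 \<longrightarrow> (\<forall>a\<in>S. \<forall>b\<in>S. P a b = 0))"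
  using idem
proof (induction "card ((\<lambda>a. restrict (P a) S) ` S - {\<lambda>_\<in>S. 0})" arbitrary: P rule: less_induct)
  case less
  let ?rows = "\<lambda>P. (\<lambda>a. restrict (P a) S) ` S - {\<lambda>_\<in>S. 0 :: 'k}"
  show ?case
  proof (cases "\<forall>a\<in>S. \<forall>b\<in>S. P a b = 0")
    case True
    then show ?thesis by (intro exI[of _ 0]) simp
  next
    case False
    then obtain i j where ij: "i \<in> S" "j \<in> S" "P i j \<noteq> 0" by blast
    \<comment> \<open>\<open>Q\<close> below is P minus the rank-one idempotent v w, where v is the
      j-th column of P and w its i-th row scaled so that the scalar product of w and v is 1.\<close>
    define w where "w = (\<lambda>b. P i b / P i j)"
    define Q where "Q = (\<lambda>a b. P a b - P a j * w b)"
    have Pv: "(\<Sum>b\<in>S. P a b * P b j) = P a j" if "a \<in> S" for a using less.prems that ij by simp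
    have wP: "(\<Sum>b\<in>S. w b * P b c) = w c" if "c \<in> S" for c
      using less.prems[OF ij(1) that] unfolding w_def by (simp add: sum_divide_distrib[symmetric])
    have wv: "(\<Sum>b\<in>S. w b * P b j) = 1" using wP[OF ij(2)] ij unfolding w_def by simp
    have Qidem: "(\<Sum>b\<in>S. Q a b * Q b c) = Q a c" if a: "a \<in> S" and c: "c \<in> S" for a c
    proof -
      have "(\<Sum>b\<in>S. Q a b * Q b c) = (\<Sum>b\<in>S. P a b * P b c) - P a j * (\<Sum>b\<in>S. w b * P b c)
          - (\<Sum>b\<in>S. P a b * P b j) * w c + P a j * (\<Sum>b\<in>S. w b * P b j) * w c"
        unfolding Q_def by (simp add: algebra_simps sum.distrib sum_subtractf sum_distrib_left sum_distrib_right)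
      then show ?thesis using less.prems[OF a c] wP[OF c] Pv[OF a] wv unfolding Q_def by simp
    qed
    have trQ: "(\<Sum>a\<in>S. Q a a) = (\<Sum>a\<in>S. P a a) - 1"
      using wv unfolding Q_def by (simp add: sum_subtractf mult.commute)
    have iR: "restrict (P i) S \<in> ?rows P"
    proof -
      have "restrict (P i) S \<noteq> (\<lambda>_\<in>S. 0)" using ij by (metis restrict_apply')
      then show ?thesis using ij by simp
    qed
    \<comment> \<open>The row operation that turns rows of P into rows of \<open>Q\<close>. It kills
      row i and fixes 0, so \<open>Q\<close> has fewer distinct nonzero rows.\<close>
    define \<phi> where "\<phi> = (\<lambda>x. \<lambda>b\<in>S. x b - x j * w b)"
    have row: "restrict (Q a) S = \<phi> (restrict (P a) S)" if "a \<in> S" for a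
      unfolding \<phi>_def Q_def using ij by (intro restrict_ext) simp
    have \<phi>0: "\<phi> (\<lambda>_\<in>S. 0) = (\<lambda>_\<in>S. 0)" unfolding \<phi>_def using ij by (intro restrict_ext) simp
    have \<phi>i: "\<phi> (restrict (P i) S) = (\<lambda>_\<in>S. 0)"
      unfolding \<phi>_def w_def using ij by (intro restrict_ext) simp
    have sub: "?rows Q \<subseteq> \<phi> ` (?rows P - {restrict (P i) S})"
    proof
      fix x assume x: "x \<in> ?rows Q"
      then obtain a where a: "a \<in> S" "x = \<phi> (restrict (P a) S)" using row by auto
      then have "restrict (P a) S \<noteq> (\<lambda>_\<in>S. 0)" "restrict (P a) S \<noteq> restrict (P i) S"
        using x \<phi>0 \<phi>i by auto
      then show "x \<in> \<phi> ` (?rows P - {restrict (P i) S})" using a by blast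
    qed
    have fin: "finite (?rows P)" using S by simp
    have "card (?rows Q) \<le> card (?rows P - {restrict (P i) S})"
      using card_mono[OF _ sub] card_image_le[of "?rows P - {restrict (P i) S}" \<phi>] fin
      by (meson finite_Diff finite_imageI order_trans)
    also have "\<dots> < card (?rows P)" using iR fin by (meson card_Diff1_less)
    finally have lt: "card (?rows Q) < card (?rows P)" .
    obtain r where r: "r \<le> card (?rows Q)" "(\<Sum>a\<in>S. Q a a) = of_nat r"
      using less.hyps[OF lt Qidem] by blast
    \<comment> \<open>The split-off part has trace 1. As \<open>Suc r\<close> is nonzero, the
      vanishing clause holds vacuously here.\<close>
    show ?thesis using r lt trQ by (intro exI[of _ "Suc r"]) (simp add: algebra_simps)
  qed
qed

section \<open>Integer fractions that lie in \<open>R\<close>\<close>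

lemma of_nat_prime_nonzero:
  assumes "N \<noteq> 0" "\<And>p. prime p \<Longrightarrow> p dvd N \<Longrightarrow> (of_nat p :: 'k::field) \<noteq> 0"
  shows "(of_nat N :: 'k) \<noteq> 0"
  using assms
proof (induction N rule: less_induct)
  case (less N)
  show ?case
  proof (cases "N = 1")
    case False
    then obtain p where p: "prime p" "p dvd N" using prime_factor_nat by blast
    then obtain q where q: "N = p * q" by blast
    have "q < N" using q p less.prems(1) using prime_gt_1_nat[OF p(1)] by simp
    then have "(of_nat q :: 'k) \<noteq> 0" using less.IH[of q] less.prems q by auto
    then show ?thesis using less.prems(2)[OF p] q by simp
  qed simp
qed

text \<open>If 0 < r < N, write r / N in lowest terms as r' / d with d \<noteq> 1. As s = r' / d
  lies in \<open>R\<close>, Bezout for r' and d puts 1 / d into \<open>R\<close>, hence also 1 / p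
  for a prime p dividing d. Then pR = R, against the hypothesis.\<close>

lemma ring_fraction_trivial:
  fixes R :: "'k::field set"
  assumes R: "0 \<in> R" "1 \<in> R" "\<And>x y. x \<in> R \<Longrightarrow> y \<in> R \<Longrightarrow> x + y \<in> R" "\<And>x. x \<in> R \<Longrightarrow> - x \<in> R"
      "\<And>x y. x \<in> R \<Longrightarrow> y \<in> R \<Longrightarrow> x * y \<in> R"
    and N: "(of_nat N :: 'k) \<noteq> 0" "\<And>p. prime p \<Longrightarrow> p dvd N \<Longrightarrow> (\<lambda>x. of_nat p * x) ` R \<noteq> R"
    and s: "s \<in> R" "of_nat N * s = of_nat r" "r \<le> N"
  shows "r = 0 \<or> r = N"
proof (rule ccontr)
  assume "\<not> (r = 0 \<or> r = N)"
  then have r: "0 < r" "r < N" using s(3) by auto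
  have nR: "of_nat n \<in> R" for n by (induction n) (use R in auto)
  have zR: "of_int z \<in> R" for z
  proof (cases z)
    case (neg n)
    then have "of_int z = - (of_nat (Suc n) :: 'k)" by simp
    then show ?thesis using R(4)[OF nR[of "Suc n"]] by metis
  qed (use nR in simp)
  define g where "g = gcd r N"
  obtain d r' where d: "N = g * d" "r = g * r'" unfolding g_def by (metis gcd_dvd1 gcd_dvd2 dvdE)
  have cop: "coprime r' d" using r d unfolding g_def
    by (metis gcd_coprime gcd_eq_0_iff less_nat_zero_code mult.commute)
  have g0: "(of_nat g :: 'k) \<noteq> 0" using N d by auto
  then have ds: "of_nat d * s = of_nat r'" using s(2) d by simp
  have "d \<noteq> 1" using r d by auto
  then obtain p where p: "prime p" "p dvd d" using prime_factor_nat by blast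
  then obtain e where e: "d = p * e" by blast
  obtain u v where uv: "u * int r' + v * int d = gcd (int r') (int d)" using bezout_int by blast
  then have uv1: "u * int r' + v * int d = 1" using cop by (simp add: coprime_int_iff)
  define t where "t = of_int u * s + of_int v"
  have tR: "t \<in> R" unfolding t_def using R s zR by auto
  have "of_nat d * t = of_int u * (of_nat d * s) + of_int v * of_nat d" unfolding t_def by (simp add: algebra_simps)
  also have "\<dots> = of_int (u * int r' + v * int d)" unfolding ds by simp
  finally have dt: "of_nat d * t = 1" unfolding uv1 by simp
  have inv: "of_nat p * (of_nat e * t) = 1" using dt e by (simp add: mult.assoc)
  have "x \<in> (\<lambda>x. of_nat p * x) ` R" if "x \<in> R" for x
  proof
    show "x = of_nat p * (of_nat e * t * x)" using inv by (simp add: mult.assoc[symmetric])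
    show "of_nat e * t * x \<in> R" using R nR tR that by auto
  qed
  moreover have "(\<lambda>x. of_nat p * x) ` R \<subseteq> R" using R nR by auto
  ultimately have "(\<lambda>x. of_nat p * x) ` R = R" by blast
  moreover have "p dvd N" using p d by simp
  ultimately show False using N(2) p by blast
qed

section \<open>Automorphisms and isomorphisms as graphs, and their numbers\<close>

context fin_group
begin

definition aut_rel :: "'a set \<Rightarrow> ('a \<times> 'a) set set" where
  "aut_rel U = {A. bifree G A \<and> Domain A = U \<and> Range A = U}"

definition iso_rel :: "'a set \<Rightarrow> ('a \<times> 'a) set set" where
  "iso_rel U = {A. bifree G A \<and> Domain A = U \<and> conjugate G U (Range A)}"

text \<open>Matches graphs with the extensional bijections that make up \<open>AutoGroup\<close>,
  from which \<open>order_Out\<close> is built.\<close>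

lemma card_aut_rel:
  assumes U: "subgroup U G"
  shows "card (aut_rel U) = order (AutoGroup (G\<lparr>carrier := U\<rparr>))"
proof -
  let ?U = "G\<lparr>carrier := U\<rparr>"
  have sU: "U \<subseteq> carrier G" using U by (rule subgroup.subset)
  note cl = subgroup.m_closed[OF U] subgroup.one_closed[OF U] subgroup.m_inv_closed[OF U]
  have au: "\<phi> \<in> auto ?U \<longleftrightarrow> \<phi> \<in> extensional U \<and> bij_betw \<phi> U U \<and> (\<forall>x\<in>U. \<forall>y\<in>U. \<phi> (x \<otimes> y) = \<phi> x \<otimes> \<phi> y)" for \<phi>
    unfolding auto_def Bij_def hom_def using bij_betw_imp_funcset by auto
  have "bij_betw (\<lambda>\<phi>. (\<lambda>u. (u, \<phi> u)) ` U) (auto ?U) (aut_rel U)"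
  proof (rule bij_betwI')
    fix \<phi> \<psi> assume a: "\<phi> \<in> auto ?U" "\<psi> \<in> auto ?U"
    have "\<phi> = \<psi>" if e: "(\<lambda>u. (u, \<phi> u)) ` U = (\<lambda>u. (u, \<psi> u)) ` U"
    proof (rule extensionalityI)
      show "\<phi> \<in> extensional U" "\<psi> \<in> extensional U" using a au by auto
      show "\<phi> x = \<psi> x" if "x \<in> U" for x
      proof -
        have "(x, \<phi> x) \<in> (\<lambda>u. (u, \<psi> u)) ` U" using e that by blast
        then show ?thesis by auto
      qed
    qed
    then show "((\<lambda>u. (u, \<phi> u)) ` U = (\<lambda>u. (u, \<psi> u)) ` U) = (\<phi> = \<psi>)" by auto
  next
    fix \<phi> assume a: "\<phi> \<in> auto ?U"
    then have b: "bij_betw \<phi> U U" and h: "\<And>x y. x \<in> U \<Longrightarrow> y \<in> U \<Longrightarrow> \<phi> (x \<otimes> y) = \<phi> x \<otimes> \<phi> y" using au by auto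
    have mem: "\<phi> x \<in> U" if "x \<in> U" for x using b that bij_betwE by metis
    have one: "\<phi> \<one> = \<one>"
    proof -
      have "\<phi> \<one> \<otimes> \<phi> \<one> = \<phi> \<one>" using h[of \<one> \<one>] cl by simp
      moreover have "\<phi> \<one> \<in> carrier G" using mem cl sU by auto
      ultimately show ?thesis by (metis l_cancel_one)
    qed
    have iv: "\<phi> (inv x) = inv (\<phi> x)" if "x \<in> U" for x
    proof -
      have "\<phi> (inv x) \<otimes> \<phi> x = \<one>" using h[of "inv x" x] cl that sU one by (simp add: subset_iff)
      then show ?thesis using inv_equality mem that cl sU by (metis subsetD)
    qed
    have sg: "subgroup ((\<lambda>u. (u, \<phi> u)) ` U) GG"
    proof (rule GG_subgroupI)
      show "(\<lambda>u. (u, \<phi> u)) ` U \<subseteq> carrier G \<times> carrier G" using mem sU by auto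
      show "(\<one>, \<one>) \<in> (\<lambda>u. (u, \<phi> u)) ` U" using one cl by force
      show "(a \<otimes> c, b \<otimes> d) \<in> (\<lambda>u. (u, \<phi> u)) ` U" if "(a, b) \<in> (\<lambda>u. (u, \<phi> u)) ` U" "(c, d) \<in> (\<lambda>u. (u, \<phi> u)) ` U" for a b c d
        using that h cl by auto
      show "(inv a, inv b) \<in> (\<lambda>u. (u, \<phi> u)) ` U" if "(a, b) \<in> (\<lambda>u. (u, \<phi> u)) ` U" for a b
        using that iv cl by auto
    qed
    have inj: "x = y" if "x \<in> U" "y \<in> U" "\<phi> x = \<phi> y" for x y using b that unfolding bij_betw_def inj_on_def by blast
    have "bifree G ((\<lambda>u. (u, \<phi> u)) ` U)" unfolding bifree_iff using sg inj by auto
    moreover have "Domain ((\<lambda>u. (u, \<phi> u)) ` U) = U" "Range ((\<lambda>u. (u, \<phi> u)) ` U) = \<phi> ` U" by force+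
    moreover have "\<phi> ` U = U" using b unfolding bij_betw_def by simp
    ultimately show "(\<lambda>u. (u, \<phi> u)) ` U \<in> aut_rel U" unfolding aut_rel_def by simp
  next
    fix A assume A: "A \<in> aut_rel U"
    then have bf: "bifree G A" "Domain A = U" "Range A = U" unfolding aut_rel_def by auto
    note D = GG_subgroupD[OF bifree_subgroup[OF bf(1)]]
    have sv: "(a, b) \<in> A \<Longrightarrow> (a, b') \<in> A \<Longrightarrow> b = b'" "(a, b) \<in> A \<Longrightarrow> (a', b) \<in> A \<Longrightarrow> a = a'" for a b a' b'
      using bf(1) unfolding bifree_iff by blast+
    define \<phi> where "\<phi> = (\<lambda>a\<in>U. THE b. (a, b) \<in> A)"
    have \<phi>: "(a, b) \<in> A \<longleftrightarrow> a \<in> U \<and> b = \<phi> a" for a b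
    proof
      assume ab: "(a, b) \<in> A"
      then have "(THE b. (a, b) \<in> A) = b" using sv(1) by (intro the_equality) auto
      then show "a \<in> U \<and> b = \<phi> a" using ab bf unfolding \<phi>_def by auto
    next
      assume a: "a \<in> U \<and> b = \<phi> a"
      then obtain c where c: "(a, c) \<in> A" using bf by blast
      then have "(THE b. (a, b) \<in> A) = c" using sv(1) by (intro the_equality) auto
      then show "(a, b) \<in> A" using a c unfolding \<phi>_def by auto
    qed
    have "\<phi> \<in> auto ?U" unfolding au
    proof (intro conjI ballI)
      show "\<phi> \<in> extensional U" unfolding \<phi>_def by simp
      show "bij_betw \<phi> U U" unfolding bij_betw_def
      proof
        show "inj_on \<phi> U" using \<phi> sv(2) unfolding inj_on_def by metis
        show "\<phi> ` U = U" using \<phi> bf(3) by auto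
      qed
      fix x y assume "x \<in> U" "y \<in> U"
      then have "(x \<otimes> y, \<phi> x \<otimes> \<phi> y) \<in> A" using D(4) \<phi> by blast
      then show "\<phi> (x \<otimes> y) = \<phi> x \<otimes> \<phi> y" using \<phi> by metis
    qed
    moreover have "A = (\<lambda>u. (u, \<phi> u)) ` U" using \<phi> by (auto simp: image_iff)
    ultimately show "\<exists>\<phi>\<in>auto ?U. A = (\<lambda>u. (u, \<phi> u)) ` U" by blast
  qed
  then show ?thesis unfolding order_def AutoGroup_def using bij_betw_same_card by fastforce
qed

text \<open>Lagrange for Inn(U) inside Aut(U); Inn(U) is a subgroup as the image of the conjugation
  homomorphism.\<close>

lemma order_Out_Inn:
  assumes U: "subgroup U G"
  shows "order_Out G U * card (Inn G U) = card (aut_rel U)"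
proof -
  let ?U = "G\<lparr>carrier := U\<rparr>"
  interpret U: group ?U using subgroup.subgroup_is_group[OF U is_group] .
  interpret B: group "BijGroup U" by (rule group_BijGroup)
  interpret A: group "AutoGroup ?U" by (rule U.AutoGroup)
  have "(\<lambda>g. \<lambda>h\<in>U. g \<otimes> h \<otimes> inv\<^bsub>?U\<^esub> g) \<in> hom ?U (BijGroup U)"
    using U.conjugation_is_hom by simp
  then interpret h: group_hom ?U "BijGroup U" "\<lambda>g. \<lambda>h\<in>U. g \<otimes> h \<otimes> inv\<^bsub>?U\<^esub> g"
    unfolding group_hom_def group_hom_axioms_def using U.is_group B.is_group by simp
  have inn: "Inn G U = (\<lambda>g. \<lambda>h\<in>U. g \<otimes> h \<otimes> inv\<^bsub>?U\<^esub> g) ` carrier ?U"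
    unfolding Inn_def setcompr_eq_image using m_inv_consistent[OF U] by simp
  have sB: "subgroup (Inn G U) (BijGroup U)" unfolding inn by (rule h.img_is_subgroup)
  have "Inn G U \<subseteq> auto ?U"
  proof
    fix f assume f: "f \<in> Inn G U"
    then obtain u where u: "u \<in> U" "f = (\<lambda>x\<in>U. u \<otimes> x \<otimes> inv u)" unfolding Inn_def by auto
    have "f \<in> Bij U" using subgroup.subset[OF sB] f unfolding BijGroup_def by auto
    moreover have "f (x \<otimes> y) = f x \<otimes> f y" if "x \<in> U" "y \<in> U" for x y
    proof -
      have c: "x \<in> carrier G" "y \<in> carrier G" "u \<in> carrier G" using that u subgroup.subset[OF U] by auto
      have "u \<otimes> (x \<otimes> y) \<otimes> inv u = (u \<otimes> x \<otimes> inv u) \<otimes> (u \<otimes> y \<otimes> inv u)"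
        using c by (simp add: m_assoc inv_mult_cancel)
      then show ?thesis unfolding u(2) using that subgroup.m_closed[OF U that] by simp
    qed
    ultimately show "f \<in> auto ?U" unfolding auto_def hom_def using Bij_imp_funcset[of f U] by (auto simp: Pi_iff)
  qed
  then have "subgroup (Inn G U) (BijGroup U \<lparr>carrier := auto ?U\<rparr>)"
    using B.subgroup_incl[OF sB] U.subgroup_auto by simp
  then have "subgroup (Inn G U) (AutoGroup ?U)" unfolding AutoGroup_def by simp
  then have "card (rcosets\<^bsub>AutoGroup ?U\<^esub> Inn G U) * card (Inn G U) = order (AutoGroup ?U)"
    by (rule A.lagrange)
  then show ?thesis unfolding order_Out_def card_aut_rel[OF U] order_def FactGroup_def by simp
qed

text \<open>The elements of G that act on U as an element of U does form the subgroup J = U C_G(U)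
  of N_G(U). Mapping J onto Inn(U) has cosets of C_G(U) as fibres, so |J| = |C_G(U)| |Inn(U)|, and t
  is the index of J in N_G(U).\<close>

lemma card_normalizer_of_Inn:
  assumes U: "subgroup U G"
  obtains t where "card (normalizer_of U) = t * (card (centralizer U) * card (Inn G U))"
proof -
  have sU: "U \<subseteq> carrier G" using U by (rule subgroup.subset)
  define J where "J = {n \<in> carrier G. \<exists>u\<in>U. \<forall>x\<in>U. n \<otimes> x \<otimes> inv n = u \<otimes> x \<otimes> inv u}"
  have conj_mult: "(a \<otimes> b) \<otimes> x \<otimes> inv (a \<otimes> b) = a \<otimes> (b \<otimes> x \<otimes> inv b) \<otimes> inv a"
    if "a \<in> carrier G" "b \<in> carrier G" "x \<in> carrier G" for a b x
    using that by (simp add: m_assoc inv_mult_group)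
  have conjU: "u \<otimes> x \<otimes> inv u \<in> U" if "u \<in> U" "x \<in> U" for u x
    using that subgroup.m_closed[OF U] subgroup.m_inv_closed[OF U] by simp
  have sgJ: "subgroup J G"
  proof (rule subgroupI)
    show "J \<subseteq> carrier G" unfolding J_def by auto
    show "J \<noteq> {}" unfolding J_def using subgroup.one_closed[OF U] by auto
    fix a assume "a \<in> J"
    then obtain u where a: "a \<in> carrier G" "u \<in> U" "\<forall>x\<in>U. a \<otimes> x \<otimes> inv a = u \<otimes> x \<otimes> inv u" unfolding J_def by auto
    have uc: "u \<in> carrier G" "inv u \<in> U" using a sU subgroup.m_inv_closed[OF U] by auto
    have "inv a \<otimes> x \<otimes> inv (inv a) = inv u \<otimes> x \<otimes> inv (inv u)" if x: "x \<in> U" for x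
    proof -
      define y where "y = inv u \<otimes> x \<otimes> u"
      have y: "y \<in> U" using conjU[OF uc(2) x] uc unfolding y_def by simp
      have "a \<otimes> y \<otimes> inv a = u \<otimes> y \<otimes> inv u" using a(3) y by blast
      also have "\<dots> = x" unfolding y_def using conj_cancel(2)[of u x] uc x sU by auto
      finally have "inv a \<otimes> x \<otimes> a = y" using conj_cancel(1)[of a y] a(1) y sU by auto
      then show ?thesis unfolding y_def using a(1) uc by simp
    qed
    then show "inv a \<in> J" unfolding J_def using a(1) uc(2) by blast
    fix b assume "b \<in> J"
    then obtain v where b: "b \<in> carrier G" "v \<in> U" "\<forall>x\<in>U. b \<otimes> x \<otimes> inv b = v \<otimes> x \<otimes> inv v" unfolding J_def by auto
    have "(a \<otimes> b) \<otimes> x \<otimes> inv (a \<otimes> b) = (u \<otimes> v) \<otimes> x \<otimes> inv (u \<otimes> v)" if x: "x \<in> U" for x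
    proof -
      have c: "x \<in> carrier G" "v \<in> carrier G" using x b sU by auto
      show ?thesis using conj_mult[OF a(1) b(1) c(1)] conj_mult[OF uc(1) c(2,1)] b(3) a(3) conjU[OF b(2) x] x by simp
    qed
    then show "a \<otimes> b \<in> J" unfolding J_def using a(1) b(1) subgroup.m_closed[OF U a(2) b(2)] by blast
  qed
  have JN: "J \<subseteq> normalizer_of U"
  proof
    fix n assume n: "n \<in> J"
    then obtain u where u: "n \<in> carrier G" "u \<in> U" "\<forall>x\<in>U. n \<otimes> x \<otimes> inv n = u \<otimes> x \<otimes> inv u" unfolding J_def by auto
    then have "conj_img G n U = conj_img G u U" unfolding conj_img_def by (intro image_cong) auto
    then show "n \<in> normalizer_of U" using subset_normalizer_of[OF U] u unfolding normalizer_of_def by auto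
  qed
  have sN: "subgroup (normalizer_of U) G" using normalizer_of_subgroup[OF sU] .
  interpret N: fin_group "G\<lparr>carrier := normalizer_of U\<rparr>" using subgroup_fin_group[OF sN] .
  have "subgroup J (G\<lparr>carrier := normalizer_of U\<rparr>)" using subgroup_incl[OF sgJ sN JN] .
  then have dv: "card J dvd card (normalizer_of U)" using N.card_subgroup_dvd unfolding order_def by simp
  have "card J = card (centralizer U) * card (Inn G U)"
  proof (rule card_fibres[where f = "\<lambda>n. \<lambda>x\<in>U. n \<otimes> x \<otimes> inv n"])
    show "finite J" using fin_subgroup[OF sgJ] .
    have ext: "(\<lambda>x\<in>U. n \<otimes> x \<otimes> inv n) = (\<lambda>x\<in>U. u \<otimes> x \<otimes> inv u) \<longleftrightarrow> (\<forall>x\<in>U. n \<otimes> x \<otimes> inv n = u \<otimes> x \<otimes> inv u)" for n u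
      by (metis (mono_tags, lifting) restrict_apply' restrict_ext)
    show "(\<lambda>n. \<lambda>x\<in>U. n \<otimes> x \<otimes> inv n) ` J = Inn G U"
    proof
      show "(\<lambda>n. \<lambda>x\<in>U. n \<otimes> x \<otimes> inv n) ` J \<subseteq> Inn G U"
        unfolding J_def Inn_def using ext by blast
      show "Inn G U \<subseteq> (\<lambda>n. \<lambda>x\<in>U. n \<otimes> x \<otimes> inv n) ` J"
        unfolding J_def Inn_def using sU by blast
    qed
    fix b assume "b \<in> Inn G U"
    then obtain u where u: "u \<in> U" "b = (\<lambda>x\<in>U. u \<otimes> x \<otimes> inv u)" unfolding Inn_def by auto
    have "{n \<in> J. (\<lambda>x\<in>U. n \<otimes> x \<otimes> inv n) = b} = {n \<in> carrier G. \<forall>x\<in>U. n \<otimes> x \<otimes> inv n = u \<otimes> x \<otimes> inv u}"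
      unfolding u(2) ext J_def using u(1) by blast
    then show "card {n \<in> J. (\<lambda>x\<in>U. n \<otimes> x \<otimes> inv n) = b} = card (centralizer U)"
      using card_centralizer_fibre[OF sU, of u] u(1) sU by auto
  qed
  then show ?thesis using dv that by (metis dvdE mult.commute)
qed

text \<open>Sorted by their range, the isomorphisms fall into one fibre for each conjugate of U, and
  every fibre is a translate of Aut(U) by some (1, g).\<close>

lemma card_iso_rel:
  assumes U: "subgroup U G"
  shows "card (iso_rel U) * card (normalizer_of U) = card (aut_rel U) * order G"
proof -
  have sU: "U \<subseteq> carrier G" using U by (rule subgroup.subset)
  interpret D: fin_group GG by (rule GG_fin_group)
  have "card (iso_rel U) = card (aut_rel U) * card (conj_class G U)"
  proof (rule card_fibres[where f = Range])
    show "finite (iso_rel U)" unfolding iso_rel_def by (rule finite_subset[OF _ fin_bifree]) auto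
    have fib: "bij_betw (\<lambda>A. conj_img GG (\<one>, g) A) (aut_rel U) {A \<in> iso_rel U. Range A = conj_img G g U}"
      if g: "g \<in> carrier G" for g
    proof (rule bij_betwI[where g = "\<lambda>A. conj_img GG (\<one>, inv g) A"])
      have ig: "inv g \<in> carrier G" using g by simp
      show "(\<lambda>A. conj_img GG (\<one>, g) A) \<in> aut_rel U \<rightarrow> {A \<in> iso_rel U. Range A = conj_img G g U}"
        unfolding aut_rel_def iso_rel_def
        using conj_img_cases(3,4)[OF _ g] bifree_conj[of _ "(\<one>, g)"] conjugateI[OF U g] g by auto
      show "(\<lambda>A. conj_img GG (\<one>, inv g) A) \<in> {A \<in> iso_rel U. Range A = conj_img G g U} \<rightarrow> aut_rel U"
        unfolding aut_rel_def iso_rel_def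
        using conj_img_cases(3,4)[OF _ ig] bifree_conj[of _ "(\<one>, inv g)"] ig conj_img_cancel(1)[OF sU g] by auto
      have sub: "A \<subseteq> carrier GG" if "bifree G A" for A using subgroup.subset[OF bifree_subgroup[OF that]] .
      have m: "(\<one>, g) \<in> carrier GG" "inv\<^bsub>GG\<^esub> (\<one>, g) = (\<one>, inv g)"
        using g inv_DirProd[OF is_group is_group one_closed g] by auto
      show "conj_img GG (\<one>, inv g) (conj_img GG (\<one>, g) A) = A" if "A \<in> aut_rel U" for A
        using D.conj_img_cancel(1)[OF sub m(1), of A] that unfolding m(2) aut_rel_def by auto
      show "conj_img GG (\<one>, g) (conj_img GG (\<one>, inv g) A) = A" if "A \<in> {A \<in> iso_rel U. Range A = conj_img G g U}" for A
        using D.conj_img_cancel(2)[OF sub m(1), of A] that unfolding m(2) iso_rel_def by auto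
    qed
    have idn: "diag U \<in> aut_rel U" unfolding aut_rel_def using diag_bifree[OF U] by (auto simp: diag_def)
    show "Range ` iso_rel U = conj_class G U"
    proof
      show "Range ` iso_rel U \<subseteq> conj_class G U" unfolding iso_rel_def conj_class_alt[OF U] by auto
      show "conj_class G U \<subseteq> Range ` iso_rel U"
      proof
        fix V assume "V \<in> conj_class G U"
        then obtain g where g: "g \<in> carrier G" "V = conj_img G g U" unfolding conj_class_def by auto
        have "conj_img GG (\<one>, g) (diag U) \<in> {A \<in> iso_rel U. Range A = V}"
          using bij_betwE[OF fib[OF g(1)]] idn g(2) by blast
        then show "V \<in> Range ` iso_rel U" by blast
      qed
    qed
    fix V assume "V \<in> conj_class G U"
    then obtain g where g: "g \<in> carrier G" "V = conj_img G g U" unfolding conj_class_def by auto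
    show "card {A \<in> iso_rel U. Range A = V} = card (aut_rel U)"
      using bij_betw_same_card[OF fib[OF g(1)]] g(2) by simp
  qed
  then show ?thesis using card_conj_class[OF sU] by (simp add: mult.assoc mult.commute mult.left_commute)
qed

lemma fin_iso_rel: "finite (iso_rel U)"
  unfolding iso_rel_def by (rule finite_subset[OF _ fin_bifree]) auto

lemma iso_rel_action:
  assumes U: "subgroup U G"
  shows "fin_action G (iso_rel U) (\<lambda>g A. conj_img GG (\<one>, g) A)"
proof (intro fin_action.intro fin_action_axioms.intro fin_group_axioms fin_iso_rel)
  interpret D: fin_group GG by (rule GG_fin_group)
  fix A assume A: "A \<in> iso_rel U"
  then have bf: "bifree G A" "Domain A = U" "conjugate G U (Range A)" unfolding iso_rel_def by auto
  have sA: "A \<subseteq> carrier GG" using subgroup.subset[OF bifree_subgroup[OF bf(1)]] .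
  show "conj_img GG (\<one>, \<one>) A = A" using D.conj_img_one[OF sA] by simp
  fix g assume g: "g \<in> carrier G"
  show "conj_img GG (\<one>, g) A \<in> iso_rel U"
    unfolding iso_rel_def using conj_img_cases(3,4)[OF bf(1) g] bifree_conj[OF bf(1), of "(\<one>, g)"] g bf
      conjugate_trans[OF bf(3) conjugateI[OF conjugate_subgroup(2)[OF bf(3)] g]] by simp
  fix h assume h: "h \<in> carrier G"
  show "conj_img GG (\<one>, g \<otimes> h) A = conj_img GG (\<one>, g) (conj_img GG (\<one>, h) A)"
    using D.conj_img_mult[OF sA, of "(\<one>, g)" "(\<one>, h)"] g h by simp
qed

text \<open>The orbits of \<open>G\<close> on \<open>iso_rel U\<close> correspond to the cosets of \<open>Aut\<^sub>G(U)\<close> in \<open>Aut(U)\<close>; since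
  \<open>Inn(U) \<le> Aut\<^sub>G(U)\<close>, their number divides \<open>|Out(U)|\<close>.\<close>

lemma iso_rel_orbits:
  assumes U: "subgroup U G"
  obtains n t where "n * order G = card (iso_rel U) * card (centralizer U)" "n * t = order_Out G U" "order_Out G U > 0"
    "\<And>f. (\<And>g A. g \<in> carrier G \<Longrightarrow> A \<in> iso_rel U \<Longrightarrow> f (conj_img GG (\<one>, g) A) = f A) \<Longrightarrow> card (f ` iso_rel U) \<le> n"
proof -
  interpret I: fin_action G "iso_rel U" "\<lambda>g A. conj_img GG (\<one>, g) A" using iso_rel_action[OF U] .
  have sU: "U \<subseteq> carrier G" using U by (rule subgroup.subset)
  have "card (I.stab A) = card (centralizer U)" if A: "A \<in> iso_rel U" for A
  proof -
    have bf: "bifree G A" "Domain A = U" "conjugate G U (Range A)" using A unfolding iso_rel_def by auto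
    note D = GG_subgroupD[OF bifree_subgroup[OF bf(1)]]
    have sv: "(a, b) \<in> A \<Longrightarrow> (a, b') \<in> A \<Longrightarrow> b = b'" for a b b' using bf(1) unfolding bifree_iff by blast
    have "I.stab A = centralizer (Range A)"
    proof (rule Set.set_eqI)
      fix g
      have "conj_img GG (\<one>, g) A = A \<longleftrightarrow> (\<forall>b\<in>Range A. g \<otimes> b = b \<otimes> g)" if g: "g \<in> carrier G"
      proof -
        have c: "conj_img GG (\<one>, g) A = (\<lambda>(a, b). (a, g \<otimes> b \<otimes> inv g)) ` A"
          unfolding conj_img_GG[OF one_closed g]
          by (rule image_cong[OF refl]) (clarsimp simp: D(1))
        have e: "g \<otimes> b \<otimes> inv g = b \<longleftrightarrow> g \<otimes> b = b \<otimes> g" if "b \<in> carrier G" for b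
          using g that by (metis inv_closed inv_solve_right m_closed)
        show ?thesis
        proof
          assume a: "conj_img GG (\<one>, g) A = A"
          show "\<forall>b\<in>Range A. g \<otimes> b = b \<otimes> g"
          proof
            fix b assume "b \<in> Range A"
            then obtain a' where ab: "(a', b) \<in> A" by blast
            then have "(a', g \<otimes> b \<otimes> inv g) \<in> A" using a unfolding c by force
            then show "g \<otimes> b = b \<otimes> g" using sv[OF ab] e D(2)[OF ab] by metis
          qed
        next
          assume r: "\<forall>b\<in>Range A. g \<otimes> b = b \<otimes> g"
          then have "(\<lambda>(a, b). (a, g \<otimes> b \<otimes> inv g)) x = x" if "x \<in> A" for x
            using that e D(2) by (cases x) auto
          then show "conj_img GG (\<one>, g) A = A" unfolding c by (simp add: image_cong)
        qed
      qed
      then show "g \<in> I.stab A \<longleftrightarrow> g \<in> centralizer (Range A)" unfolding I.stab_def centralizer_def by auto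
    qed
    moreover have "card (centralizer (Range A)) = card (centralizer U)"
    proof -
      obtain g where g: "g \<in> carrier G" "Range A = conj_img G g U" using bf(3) unfolding conjugate_def by auto
      have "centralizer (Range A) = conj_img G g (centralizer U)"
      proof (rule Set.set_eqI)
        fix c
        have cs: "centralizer U \<subseteq> carrier G" unfolding centralizer_def by auto
        have "c \<in> centralizer (Range A) \<longleftrightarrow> inv g \<otimes> c \<otimes> g \<in> centralizer U" if c: "c \<in> carrier G"
        proof -
          have "c \<otimes> (g \<otimes> u \<otimes> inv g) = (g \<otimes> u \<otimes> inv g) \<otimes> c \<longleftrightarrow> (inv g \<otimes> c \<otimes> g) \<otimes> u = u \<otimes> (inv g \<otimes> c \<otimes> g)"
            if "u \<in> U" for u
          proof -
            have u: "u \<in> carrier G" using that sU by auto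
            have "c \<otimes> (g \<otimes> u \<otimes> inv g) = g \<otimes> ((inv g \<otimes> c \<otimes> g) \<otimes> u) \<otimes> inv g"
              "(g \<otimes> u \<otimes> inv g) \<otimes> c = g \<otimes> (u \<otimes> (inv g \<otimes> c \<otimes> g)) \<otimes> inv g"
              using u c g by (simp_all add: m_assoc inv_mult_cancel)
            then show ?thesis using u c g by simp
          qed
          then show ?thesis unfolding centralizer_def g(2) conj_img_def using c g by auto
        qed
        then show "c \<in> centralizer (Range A) \<longleftrightarrow> c \<in> conj_img G g (centralizer U)"
          using mem_conj_img[OF cs g(1), of c] conj_img_carrier[OF cs g(1)] unfolding centralizer_def by blast
      qed
      moreover have "centralizer U \<subseteq> carrier G" unfolding centralizer_def by auto
      ultimately show ?thesis using card_conj_img g(1) by simp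
    qed
    ultimately show ?thesis by simp
  qed
  then have no: "card I.orbs * order G = card (iso_rel U) * card (centralizer U)" using I.card_orbs by simp
  obtain t where t: "card (normalizer_of U) = t * (card (centralizer U) * card (Inn G U))" using card_normalizer_of_Inn[OF U] .
  have p1: "card (centralizer U) > 0" using card_subgroup_pos[OF centralizer_subgroup[OF sU]] .
  have p2: "card (normalizer_of U) > 0" using card_subgroup_pos[OF normalizer_of_subgroup[OF sU]] .
  have p3: "card (Inn G U) > 0" using p2 t by (metis gr0I mult_is_0 less_numeral_extra(3))
  \<comment> \<open>Combines four counts: n |G| = |\<open>iso_rel U\<close>| |C_G(U)|,
    |\<open>iso_rel U\<close>| |N_G(U)| = |Aut(U)| |G|, |N_G(U)| = t |C_G(U)| |Inn(U)| and |Aut(U)|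
    = |Out(U)| |Inn(U)|. Cancelling leaves n t = |Out(U)|.\<close>
  have "(card I.orbs * t) * (order G * (card (centralizer U) * card (Inn G U))) = card I.orbs * order G * card (normalizer_of U)"
    unfolding t by simp
  also have "\<dots> = card (iso_rel U) * card (normalizer_of U) * card (centralizer U)" unfolding no by simp
  also have "\<dots> = order_Out G U * (order G * (card (centralizer U) * card (Inn G U)))"
    unfolding card_iso_rel[OF U] order_Out_Inn[OF U, symmetric] by simp
  finally have nt: "card I.orbs * t = order_Out G U" using p1 p3 order_pos by simp
  have "diag U \<in> aut_rel U" unfolding aut_rel_def using diag_bifree[OF U] by (auto simp: diag_def)
  moreover have "finite (aut_rel U)" unfolding aut_rel_def by (rule finite_subset[OF _ fin_bifree]) auto
  ultimately have "card (aut_rel U) > 0" using card_gt_0_iff by blast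
  then have po: "order_Out G U > 0" using order_Out_Inn[OF U] by (metis gr0I mult_is_0 less_numeral_extra(3))
  \<comment> \<open>An invariant function factors through the set of orbits. It will be applied to
    the map that sends an index to its row in an idempotent matrix.\<close>
  have "card (f ` iso_rel U) \<le> card I.orbs"
    if f: "\<And>g A. g \<in> carrier G \<Longrightarrow> A \<in> iso_rel U \<Longrightarrow> f (conj_img GG (\<one>, g) A) = f A" for f :: "('a \<times> 'a) set \<Rightarrow> 'c"
  proof -
    have "f ` iso_rel U \<subseteq> (\<lambda>\<Omega>. f (SOME A. A \<in> \<Omega>)) ` I.orbs"
    proof
      fix y assume "y \<in> f ` iso_rel U"
      then obtain A where A: "A \<in> iso_rel U" "y = f A" by auto
      have "(SOME B. B \<in> I.orb A) \<in> I.orb A" using I.orb_self[OF A(1)] by (rule someI)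
      then have "f (SOME B. B \<in> I.orb A) = y" using f A unfolding I.orb_def by auto
      then show "y \<in> (\<lambda>\<Omega>. f (SOME A. A \<in> \<Omega>)) ` I.orbs" using A(1) unfolding I.orbs_def by blast
    qed
    then show ?thesis using surj_card_le[OF I.fin_orbs] by blast
  qed
  then show ?thesis using that no nt po by blast
qed

end

section \<open>Rank and integrality over a single subgroup\<close>

context double_burnside
begin

lemma comp_cancel:
  assumes "bifree G A"
  shows "Domain M = Range A \<Longrightarrow> A\<inverse> O (A O M) = M" "Domain B = Domain A \<Longrightarrow> A O (A\<inverse> O B) = B"
    "A\<inverse> O A = diag (Range A)"
proof -
  have sv: "(a, b) \<in> A \<Longrightarrow> (a, b') \<in> A \<Longrightarrow> b = b'" "(a, b) \<in> A \<Longrightarrow> (a', b) \<in> A \<Longrightarrow> a = a'" for a b a' b'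
    using assms unfolding bifree_iff by blast+
  show "A\<inverse> O (A O M) = M" if d: "Domain M = Range A"
  proof (rule subset_antisym)
    show "A\<inverse> O (A O M) \<subseteq> M" using sv(1) by blast
    show "M \<subseteq> A\<inverse> O (A O M)"
    proof clarify
      fix b c assume bc: "(b, c) \<in> M"
      then have "b \<in> Range A" using d by blast
      then show "(b, c) \<in> A\<inverse> O (A O M)" using bc by blast
    qed
  qed
  show "A O (A\<inverse> O B) = B" if d: "Domain B = Domain A"
  proof (rule subset_antisym)
    show "A O (A\<inverse> O B) \<subseteq> B" using sv(2) by blast
    show "B \<subseteq> A O (A\<inverse> O B)"
    proof clarify
      fix b c assume bc: "(b, c) \<in> B"
      then have "b \<in> Domain A" using d by blast
      then show "(b, c) \<in> A O (A\<inverse> O B)" using bc by blast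
    qed
  qed
  show "A\<inverse> O A = diag (Range A)" using sv(1) unfolding diag_def by blast
qed

lemma class_fun_diag:
  assumes f: "class_fun f" and U: "subgroup U G" and V: "conjugate G U V"
  shows "f (diag V) = f (diag U)"
proof -
  obtain g where g: "g \<in> carrier G" "V = conj_img G g U" using V unfolding conjugate_def by auto
  have "conj_img GG (g, g) (diag U) = diag V"
    unfolding conj_img_GG[OF g(1) g(1)] unfolding g(2) conj_img_def diag_def by force
  moreover have "f (conj_img GG (g, g) (diag U)) = f (diag U)"
    using f diag_bifree[OF U] g(1) unfolding class_fun_def by simp
  ultimately show ?thesis by simp
qed

text \<open>The matrix with entries P A B = f (A^-1 O B), indexed by the isomorphisms from U onto
  its conjugates, is idempotent; \<open>supp\<close> removes the intermediate indices outside
  \<open>iso_rel U\<close>. Its diagonal is constantly f (\<open>diag U\<close>), and its rows are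
  constant on G-orbits of indices. So its rank r is at most the number n of orbits, and the trace
  formula together with the normalisation of s becomes r = n s.\<close>

lemma idempotent_component:
  fixes R :: "'k set"
  assumes R: "0 \<in> R" "1 \<in> R" "\<And>x y. x \<in> R \<Longrightarrow> y \<in> R \<Longrightarrow> x + y \<in> R" "\<And>x. x \<in> R \<Longrightarrow> - x \<in> R"
      "\<And>x y. x \<in> R \<Longrightarrow> y \<in> R \<Longrightarrow> x * y \<in> R"
    and U: "subgroup U G"
    and Out: "\<And>p. prime p \<Longrightarrow> p dvd order_Out G U \<Longrightarrow>
          (\<lambda>r. of_nat p * r) ` R \<noteq> {0} \<and> (\<lambda>r. of_nat p * r) ` R \<noteq> R"
    and f: "class_fun f" and idem: "\<And>L. bifree G L \<Longrightarrow> ghost_mult f f L = f L"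
    and supp: "\<And>L. bifree G L \<Longrightarrow> f L \<noteq> 0 \<Longrightarrow> conjugate G (Domain L) (Range L)"
    and s: "s \<in> R" "f (diag U) * of_nat (order G) = of_nat (card (centralizer U)) * s"
  shows "s = 1 \<or> (s = 0 \<and> (\<forall>L. bifree G L \<longrightarrow> Domain L = U \<longrightarrow> f L = 0))"
proof -
  let ?S = "iso_rel U"
  define P :: "('a \<times> 'a) set \<Rightarrow> ('a \<times> 'a) set \<Rightarrow> 'k" where "P = (\<lambda>A B. f (A\<inverse> O B))"
  have S: "bifree G A" "Domain A = U" "conjugate G U (Range A)" if "A \<in> ?S" for A
    using that unfolding iso_rel_def by auto
  have idemP: "(\<Sum>B\<in>?S. P A B * P B C) = P A C" if A: "A \<in> ?S" and C: "C \<in> ?S" for A C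
  proof -
    have AC: "bifree G (A\<inverse> O C)" using bifree_comp bifree_converse S(1) A C by blast
    have dAC: "Domain (A\<inverse> O C) = Range A" using S(2)[OF A] S(2)[OF C] by blast
    have "f (A\<inverse> O C) = (\<Sum>M\<in>same_dom (A\<inverse> O C). f M * f (M\<inverse> O (A\<inverse> O C)))"
      using idem[OF AC] unfolding ghost_mult_def by simp
    also have "\<dots> = (\<Sum>B\<in>{B. bifree G B \<and> Domain B = U}. P A B * P B C)"
    proof (rule sum.reindex_bij_witness[where i = "\<lambda>B. A\<inverse> O B" and j = "\<lambda>M. A O M"])
      fix M assume "M \<in> same_dom (A\<inverse> O C)"
      then have M: "bifree G M" "Domain M = Range A" unfolding same_dom_def dAC by auto
      show "A\<inverse> O (A O M) = M" using comp_cancel(1)[OF S(1)[OF A] M(2)] .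
      have "Domain (A O M) = U" using M(2) S(2)[OF A] by blast
      then show "A O M \<in> {B. bifree G B \<and> Domain B = U}" using bifree_comp[OF S(1)[OF A] M(1)] by simp
      show "P A (A O M) * P (A O M) C = f M * f (M\<inverse> O (A\<inverse> O C))"
        unfolding P_def comp_cancel(1)[OF S(1)[OF A] M(2)] converse_relcomp O_assoc ..
    next
      fix B assume "B \<in> {B. bifree G B \<and> Domain B = U}"
      then have B: "bifree G B" "Domain B = U" by auto
      show "A O (A\<inverse> O B) = B" using comp_cancel(2)[OF S(1)[OF A]] B(2) S(2)[OF A] by simp
      have "Domain (A\<inverse> O B) = Range A" using B(2) S(2)[OF A] by blast
      then show "A\<inverse> O B \<in> same_dom (A\<inverse> O C)"
        unfolding same_dom_def dAC using bifree_comp[OF bifree_converse[OF S(1)[OF A]] B(1)] by simp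
    qed
    also have "\<dots> = (\<Sum>B\<in>?S. P A B * P B C)"
    proof (rule sum.mono_neutral_right)
      show "finite {B. bifree G B \<and> Domain B = U}" by (rule finite_subset[OF _ fin_bifree]) auto
      show "?S \<subseteq> {B. bifree G B \<and> Domain B = U}" unfolding iso_rel_def by auto
      show "\<forall>B\<in>{B. bifree G B \<and> Domain B = U} - ?S. P A B * P B C = 0"
      proof
        fix B assume B: "B \<in> {B. bifree G B \<and> Domain B = U} - ?S"
        then have AB: "bifree G (A\<inverse> O B)" using bifree_comp bifree_converse S(1)[OF A] by blast
        have r: "Range (A\<inverse> O B) = Range B" "Domain (A\<inverse> O B) = Range A" using B S(2)[OF A] by blast+
        have "P A B = 0"
        proof (rule ccontr)
          assume "P A B \<noteq> 0"
          then have "conjugate G (Range A) (Range B)" using supp[OF AB] unfolding P_def r by simp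
          then have "conjugate G U (Range B)" using S(3)[OF A] conjugate_trans by blast
          then show False using B unfolding iso_rel_def by blast
        qed
        then show "P A B * P B C = 0" by simp
      qed
    qed
    finally show ?thesis unfolding P_def by simp
  qed
  obtain r where r: "r \<le> card ((\<lambda>A. restrict (P A) ?S) ` ?S - {\<lambda>_\<in>?S. 0})" "(\<Sum>A\<in>?S. P A A) = of_nat r"
    "r = 0 \<longrightarrow> (\<forall>A\<in>?S. \<forall>B\<in>?S. P A B = 0)"
    using idempotent_trace[OF fin_iso_rel idemP] by blast
  obtain n t where nt: "n * order G = card ?S * card (centralizer U)" "n * t = order_Out G U" "order_Out G U > 0"
    and rows: "\<And>h :: ('a \<times> 'a) set \<Rightarrow> ('a \<times> 'a) set \<Rightarrow> 'k.
      (\<And>g A. g \<in> carrier G \<Longrightarrow> A \<in> ?S \<Longrightarrow> h (conj_img GG (\<one>, g) A) = h A) \<Longrightarrow> card (h ` ?S) \<le> n"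
    using iso_rel_orbits[OF U] by blast
  have "card ((\<lambda>A. restrict (P A) ?S) ` ?S) \<le> n"
  proof (rule rows)
    fix g A assume g: "g \<in> carrier G" and A: "A \<in> ?S"
    have "P (conj_img GG (\<one>, g) A) B = P A B" if B: "B \<in> ?S" for B
    proof -
      note D = GG_subgroupD[OF bifree_subgroup[OF S(1)[OF A]]]
      note D' = GG_subgroupD[OF bifree_subgroup[OF S(1)[OF B]]]
      have bf: "bifree G (A\<inverse> O B)" using bifree_comp bifree_converse S(1) A B by blast
      have "conj_img GG (\<one>, g) A = (\<lambda>(a, b). (a, g \<otimes> b \<otimes> inv g)) ` A"
        unfolding conj_img_GG[OF one_closed g] by (rule image_cong[OF refl]) (clarsimp simp: D(1))
      moreover have "conj_img GG (g, \<one>) (A\<inverse> O B) = (\<lambda>(b, c). (g \<otimes> b \<otimes> inv g, c)) ` (A\<inverse> O B)"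
        unfolding conj_img_GG[OF g one_closed] by (rule image_cong[OF refl]) (clarsimp simp: D'(2))
      ultimately have "(conj_img GG (\<one>, g) A)\<inverse> O B = conj_img GG (g, \<one>) (A\<inverse> O B)"
        by (auto simp: image_iff)
      then show ?thesis unfolding P_def using f bf g unfolding class_fun_def by simp
    qed
    then show "restrict (P (conj_img GG (\<one>, g) A)) ?S = restrict (P A) ?S"
      by (intro restrict_ext) simp
  qed
  moreover have "card ((\<lambda>A. restrict (P A) ?S) ` ?S - {\<lambda>_\<in>?S. 0}) \<le> card ((\<lambda>A. restrict (P A) ?S) ` ?S)"
    by (rule card_Diff1_le)
  ultimately have rn: "r \<le> n" using r(1) by linarith
  have "(\<Sum>A\<in>?S. P A A) = (\<Sum>A\<in>?S. f (diag U))"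
    unfolding P_def using comp_cancel(3)[OF S(1)] class_fun_diag[OF f U S(3)] by (intro sum.cong refl) simp
  then have rS: "of_nat r = of_nat (card ?S) * f (diag U)" using r(2) by simp
  have "(of_nat r :: 'k) * of_nat (order G) = of_nat (card ?S * card (centralizer U)) * s"
    unfolding rS using s(2) by (simp add: mult.assoc)
  also have "\<dots> = of_nat n * of_nat (order G) * s" unfolding nt(1)[symmetric] by simp
  finally have rns: "of_nat r = of_nat n * s" using ord_inv by simp
  have p0: "(of_nat p :: 'k) \<noteq> 0" if "prime p" "p dvd order_Out G U" for p
  proof
    assume "(of_nat p :: 'k) = 0"
    then have "(\<lambda>r. of_nat p * r) ` R = {0}" using R(1) by auto
    then show False using Out[OF that] by blast
  qed
  have N0: "(of_nat (order_Out G U) :: 'k) \<noteq> 0"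
    by (rule of_nat_prime_nonzero[OF _ p0]) (use nt(3) in simp)
  \<comment> \<open>The fraction is expanded by t from r / n to r t / |Out(U)|, so that the
    conditions on the primes dividing |Out(U)| apply directly.\<close>
  have eq: "of_nat (order_Out G U) * s = (of_nat (r * t) :: 'k)" unfolding nt(2)[symmetric] using rns by simp
  have le: "r * t \<le> order_Out G U" unfolding nt(2)[symmetric] using rn by simp
  have "r * t = 0 \<or> r * t = order_Out G U"
    by (rule ring_fraction_trivial[OF R N0 conjunct2[OF Out] s(1) eq le])
  then consider "r * t = 0" | "r * t = order_Out G U" by (elim disjE)
  then show ?thesis
  proof cases
    case 2
    then have "of_nat (order_Out G U) * s = (of_nat (order_Out G U) :: 'k)" using eq by simp
    then show ?thesis using N0 by simp
  next
    case 1
    have s0: "s = 0" using eq[unfolded 1] N0 by simp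
    have "t > 0" using nt(2,3) by (metis gr0I mult_is_0 less_numeral_extra(3))
    then have "r = 0" using 1 by simp
    then have P0: "\<And>A B. A \<in> ?S \<Longrightarrow> B \<in> ?S \<Longrightarrow> P A B = 0" using r(3) by blast
    have "Domain (diag U) = U" "Range (diag U) = U" unfolding diag_def by auto
    then have idS: "diag U \<in> ?S"
      unfolding iso_rel_def using diag_bifree[OF U] conjugate_refl[OF U] by simp
    \<comment> \<open>If f L were nonzero, L would be an index, and f L is the entry of the
      vanishing matrix in row \<open>diag U\<close> and column L.\<close>
    have "f L = 0" if L: "bifree G L" "Domain L = U" for L
    proof (rule ccontr)
      assume nz: "f L \<noteq> 0"
      then have "L \<in> ?S" unfolding iso_rel_def using supp[OF L(1) nz] L by simp
      then have "f ((diag U)\<inverse> O L) = 0" using P0[OF idS] unfolding P_def by simp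
      moreover have "(diag U)\<inverse> O L = L" using L(2) unfolding diag_def by auto
      ultimately show False using nz by simp
    qed
    then show ?thesis using s0 by blast
  qed
qed

text \<open>\<open>C\<^sub>G(U) \<times> 1\<close> acts freely on the \<open>\<Delta>(U)\<close>-fixed points of a bifree biset.\<close>

lemma fmark_diag_integral:
  fixes R :: "'k set"
  assumes R: "0 \<in> R" "1 \<in> R" "\<And>x y. x \<in> R \<Longrightarrow> y \<in> R \<Longrightarrow> x + y \<in> R" "\<And>x y. x \<in> R \<Longrightarrow> y \<in> R \<Longrightarrow> x * y \<in> R"
    and a: "a \<in> bd_R G R" and U: "subgroup U G"
  obtains s where "s \<in> R" "D.fmark a (diag U) = of_nat (card (centralizer U)) * s"
proof -
  have sU: "U \<subseteq> carrier G" using U by (rule subgroup.subset)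
  have cs: "subgroup (centralizer U) G" using centralizer_subgroup[OF sU] .
  \<comment> \<open>\<open>Q\<close> is the product of C_G(U) x 1 with \<open>diag U\<close>. It
    normalises \<open>diag U\<close>, which has index |C_G(U)| in it.\<close>
  define Q where "Q = (\<lambda>(c, u). (u \<otimes> c, u)) ` (centralizer U \<times> U)"
  have cu: "c \<in> carrier G" "c \<otimes> u = u \<otimes> c" if "c \<in> centralizer U" "u \<in> U" for c u using that unfolding centralizer_def by auto
  have sgQ: "subgroup Q GG"
  proof (rule GG_subgroupI)
    show "Q \<subseteq> carrier G \<times> carrier G" unfolding Q_def using sU cu by auto
    show "(\<one>, \<one>) \<in> Q" unfolding Q_def using subgroup.one_closed[OF U] subgroup.one_closed[OF cs] by force
    show "(a \<otimes> a', b \<otimes> b') \<in> Q" if ab: "(a, b) \<in> Q" "(a', b') \<in> Q" for a b a' b'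
    proof -
      obtain c c' where c: "c \<in> centralizer U" "b \<in> U" "a = b \<otimes> c" "c' \<in> centralizer U" "b' \<in> U" "a' = b' \<otimes> c'"
        using ab unfolding Q_def by auto
      have m: "b \<in> carrier G" "b' \<in> carrier G" "c \<in> carrier G" "c' \<in> carrier G" using c sU cu by auto
      have "a \<otimes> a' = b \<otimes> (c \<otimes> b') \<otimes> c'" unfolding c(3,6) using m by (simp add: m_assoc)
      also have "\<dots> = (b \<otimes> b') \<otimes> (c \<otimes> c')" unfolding cu(2)[OF c(1,5)] using m by (simp add: m_assoc)
      finally show ?thesis unfolding Q_def
        using subgroup.m_closed[OF U c(2,5)] subgroup.m_closed[OF cs c(1,4)] by (auto simp: image_iff)
    qed
    show "(inv a, inv b) \<in> Q" if ab: "(a, b) \<in> Q" for a b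
    proof -
      obtain c where c: "c \<in> centralizer U" "b \<in> U" "a = b \<otimes> c" using ab unfolding Q_def by auto
      have m: "b \<in> carrier G" "c \<in> carrier G" using c sU cu by auto
      have "inv a = inv (c \<otimes> b)" unfolding c(3) cu(2)[OF c(1,2)] ..
      also have "\<dots> = inv b \<otimes> inv c" using m by (simp add: inv_mult_group)
      finally show ?thesis unfolding Q_def
        using subgroup.m_inv_closed[OF U c(2)] subgroup.m_inv_closed[OF cs c(1)] by (auto simp: image_iff)
    qed
  qed
  have inj: "inj_on (\<lambda>(c, u). (u \<otimes> c, u)) (centralizer U \<times> U)"
    using sU cu unfolding inj_on_def by (auto simp: subset_iff)
  have cardQ: "card Q = card (centralizer U) * card U"
    unfolding Q_def card_image[OF inj] by (simp add: card_cartesian_product)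
  have dQ: "diag U \<subseteq> Q"
  proof
    fix p assume "p \<in> diag U"
    then obtain u where u: "u \<in> U" "p = (u, u)" unfolding diag_def by auto
    then have "p = (u \<otimes> \<one>, u)" using sU by auto
    then show "p \<in> Q" unfolding Q_def using subgroup.one_closed[OF cs] u(1) by force
  qed
  have norm: "inv\<^bsub>GG\<^esub> q \<otimes>\<^bsub>GG\<^esub> n \<otimes>\<^bsub>GG\<^esub> q \<in> diag U" if q: "q \<in> Q" and n: "n \<in> diag U" for q n
  proof -
    obtain c u where c: "c \<in> centralizer U" "u \<in> U" "q = (u \<otimes> c, u)" using q unfolding Q_def by auto
    obtain v where v: "v \<in> U" "n = (v, v)" using n unfolding diag_def by auto
    have m: "u \<in> carrier G" "v \<in> carrier G" "c \<in> carrier G" using c v sU cu by auto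
    define w where "w = inv u \<otimes> v \<otimes> u"
    have w: "w \<in> U" unfolding w_def using subgroup.m_closed[OF U] subgroup.m_inv_closed[OF U] c v by simp
    have wc: "w \<in> carrier G" using w sU by auto
    have "inv (u \<otimes> c) \<otimes> v \<otimes> (u \<otimes> c) = inv c \<otimes> (w \<otimes> c)"
      unfolding w_def using m by (simp add: inv_mult_group m_assoc)
    also have "\<dots> = w" unfolding cu(2)[OF c(1) w, symmetric] using m wc by (simp add: inv_mult_cancel)
    finally have "inv\<^bsub>GG\<^esub> q \<otimes>\<^bsub>GG\<^esub> n \<otimes>\<^bsub>GG\<^esub> q = (w, w)"
      unfolding c(3) v(2) using inv_DirProd[OF is_group is_group, of "u \<otimes> c" u] m by (simp add: w_def)
    then show ?thesis using w unfolding diag_def by auto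
  qed
  have aF: "a \<in> D.fspace" "\<And>L. a L \<in> R" using a unfolding bd_R_def bd_space_eq by auto
  obtain s where s: "s \<in> R" "(\<Sum>q\<in>Q. D.fmark a (insert q (diag U))) = of_nat (card Q) * s"
    using D.sum_fmark_integral[OF aF R sgQ dQ norm] by blast
  \<comment> \<open>Freeness: no bifree subgroup contains both (u c, u) and (u, u) for c \<noteq> 1,
    so the terms outside \<open>diag U\<close> vanish. The sum is |U| times the mark at
    \<open>diag U\<close>, while |Q| = |C_G(U)| |U|.\<close>
  have "D.fmark a (insert q (diag U)) = (if q \<in> diag U then D.fmark a (diag U) else 0)" if q: "q \<in> Q" for q
  proof (cases "q \<in> diag U")
    case True
    then show ?thesis by (simp add: insert_absorb)
  next
    case False
    obtain c u where c: "c \<in> centralizer U" "u \<in> U" "q = (u \<otimes> c, u)" using q unfolding Q_def by auto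
    have "\<not> insert q (diag U) \<subseteq> M" if M: "bifree G M" for M
    proof
      assume i: "insert q (diag U) \<subseteq> M"
      then have "(u \<otimes> c, u) \<in> M" "(u, u) \<in> M" using c unfolding diag_def by auto
      then have "u \<otimes> c = u" using M unfolding bifree_iff by blast
      then show False using False c unfolding diag_def by auto
    qed
    then have "{M \<in> {L. bifree G L}. insert q (diag U) \<subseteq> M} = {}" by blast
    then show ?thesis unfolding D.fmark_def using False by (metis sum.empty)
  qed
  then have "(\<Sum>q\<in>Q. D.fmark a (insert q (diag U))) = (\<Sum>q\<in>Q. if q \<in> diag U then D.fmark a (diag U) else 0)"
    by simp
  also have "\<dots> = (\<Sum>q\<in>{q \<in> Q. q \<in> diag U}. D.fmark a (diag U))"
    using D.fin_subgroup[OF sgQ] by (rule sum.inter_filter[symmetric])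
  also have "{q \<in> Q. q \<in> diag U} = diag U" using dQ by auto
  also have "(\<Sum>q\<in>diag U. D.fmark a (diag U)) = of_nat (card U) * D.fmark a (diag U)"
  proof -
    have "diag U = (\<lambda>u. (u, u)) ` U" unfolding diag_def by auto
    then have "card (diag U) = card U" by (simp add: card_image inj_on_def)
    then show ?thesis by simp
  qed
  finally have "of_nat (card U) * D.fmark a (diag U) = of_nat (card U) * (of_nat (card (centralizer U)) * s)"
    unfolding s(2) cardQ by (metis mult.assoc mult.commute of_nat_mult)
  then have "D.fmark a (diag U) = of_nat (card (centralizer U)) * s"
    using mult_left_cancel[OF S.card_subgroup_nz[OF U]] by metis
  then show ?thesis using that[OF s(1)] by blast
qed

end

section \<open>The residual by chains of prime index\<close>

context fin_group
begin

text \<open>Normality written with elements of G, so that chains of subgroups can be intersected and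
  conjugated without changing the ambient group.\<close>

definition normal_in :: "'a set \<Rightarrow> 'a set \<Rightarrow> bool" where
  "normal_in N U \<longleftrightarrow> subgroup U G \<and> subgroup N G \<and> N \<subseteq> U \<and> (\<forall>u\<in>U. \<forall>n\<in>N. u \<otimes> n \<otimes> inv u \<in> N)"

lemma (in group) mult_inv_eq_one:
  assumes "a \<in> carrier G" "b \<in> carrier G" shows "a \<otimes> inv b = \<one> \<longleftrightarrow> a = b"
  using assms by (metis inv_closed inv_equality inv_inv r_inv)

lemma normal_iff_normal_in:
  assumes U: "subgroup U G" shows "N \<lhd> G\<lparr>carrier := U\<rparr> \<longleftrightarrow> normal_in N U"
proof -
  interpret U: group "G\<lparr>carrier := U\<rparr>" using subgroup.subgroup_is_group[OF U is_group] .
  have sg: "subgroup N (G\<lparr>carrier := U\<rparr>) \<longleftrightarrow> subgroup N G \<and> N \<subseteq> U"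
    using incl_subgroup[OF U] subgroup_incl[OF _ U] subgroup.subset by fastforce
  show ?thesis unfolding U.normal_inv_iff normal_in_def sg using U m_inv_consistent[OF U] by auto
qed

abbreviation quotient :: "'a set \<Rightarrow> 'a set \<Rightarrow> 'a set monoid" where
  "quotient U N \<equiv> (G\<lparr>carrier := U\<rparr>) Mod N"

lemma quotient_group:
  assumes n: "normal_in N U"
  shows "fin_group (quotient U N)" and "group_hom (G\<lparr>carrier := U\<rparr>) (quotient U N) (\<lambda>x. N #> x)"
    and "carrier (quotient U N) = (\<lambda>x. N #> x) ` U" and "\<one>\<^bsub>quotient U N\<^esub> = N"
    and "x \<in> U \<Longrightarrow> N #> x = N \<longleftrightarrow> x \<in> N"
    and "order (quotient U N) * card N = card U"
proof -
  have U: "subgroup U G" and N: "subgroup N G" "N \<subseteq> U" using n unfolding normal_in_def by auto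
  interpret U: group "G\<lparr>carrier := U\<rparr>" using subgroup.subgroup_is_group[OF U is_group] .
  interpret N: normal N "G\<lparr>carrier := U\<rparr>" using n normal_iff_normal_in[OF U] by simp
  have rc: "N #>\<^bsub>G\<lparr>carrier := U\<rparr>\<^esub> x = N #> x" for x unfolding r_coset_def by simp
  show c: "carrier (quotient U N) = (\<lambda>x. N #> x) ` U" unfolding carrier_FactGroup rc by simp
  show "fin_group (quotient U N)"
    unfolding fin_group_def fin_group_axioms_def c using N.factorgroup_is_group fin_subgroup[OF U] by simp
  show "group_hom (G\<lparr>carrier := U\<rparr>) (quotient U N) (\<lambda>x. N #> x)"
    unfolding group_hom_def group_hom_axioms_def
    using N.r_coset_hom_Mod N.factorgroup_is_group U.is_group unfolding rc by simp
  show "\<one>\<^bsub>quotient U N\<^esub> = N" by simp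
  show "N #> x = N \<longleftrightarrow> x \<in> N" if "x \<in> U"
  proof
    have xc: "x \<in> carrier G" using that subgroup.subset[OF U] by auto
    assume "N #> x = N" then show "x \<in> N" using rcos_self[OF xc N(1)] by simp
  next
    assume "x \<in> N" then show "N #> x = N" using coset_join2[OF _ N(1)] subgroup.subset[OF N(1)] by auto
  qed
  show "order (quotient U N) * card N = card U"
    using U.lagrange[OF N.subgroup_axioms] unfolding order_def FactGroup_def by simp
qed

lemma quotient_eq_iff:
  assumes n: "normal_in N U" and "x \<in> U" "y \<in> U"
  shows "N #> x = N #> y \<longleftrightarrow> x \<otimes> inv y \<in> N"
proof -
  have U: "subgroup U G" and N: "subgroup N G" using n unfolding normal_in_def by auto
  interpret h: group_hom "G\<lparr>carrier := U\<rparr>" "quotient U N" "\<lambda>x. N #> x" by (rule quotient_group(2)[OF n])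
  have c: "x \<in> carrier G" "y \<in> carrier G" using assms subgroup.subset[OF U] by auto
  have iy: "inv y \<in> U" using subgroup.m_inv_closed[OF U assms(3)] .
  have e: "N #> (x \<otimes> inv y) = (N #> x) \<otimes>\<^bsub>quotient U N\<^esub> inv\<^bsub>quotient U N\<^esub> (N #> y)"
    using h.hom_mult[of x "inv y"] h.hom_inv[of y] assms iy m_inv_consistent[OF U assms(3)] by simp
  have "x \<otimes> inv y \<in> U" using subgroup.m_closed[OF U assms(2) iy] .
  then have "x \<otimes> inv y \<in> N \<longleftrightarrow> (N #> x) \<otimes>\<^bsub>quotient U N\<^esub> inv\<^bsub>quotient U N\<^esub> (N #> y) = \<one>\<^bsub>quotient U N\<^esub>"
    unfolding e[symmetric] quotient_group(4)[OF n] using quotient_group(5)[OF n] by blast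
  also have "\<dots> \<longleftrightarrow> N #> x = N #> y"
    by (rule h.H.mult_inv_eq_one) (use quotient_group(3)[OF n] assms in auto)
  finally show ?thesis ..
qed

lemma quotient_preimage:
  assumes n: "normal_in N U" and K: "subgroup K (quotient U N)"
  shows "subgroup {u \<in> U. N #> u \<in> K} G" "N \<subseteq> {u \<in> U. N #> u \<in> K}"
proof -
  have U: "subgroup U G" and N: "subgroup N G" "N \<subseteq> U" using n unfolding normal_in_def by auto
  have sU: "U \<subseteq> carrier G" using subgroup.subset[OF U] .
  interpret h: group_hom "G\<lparr>carrier := U\<rparr>" "quotient U N" "\<lambda>x. N #> x" by (rule quotient_group(2)[OF n])
  have K1: "N \<in> K" using subgroup.one_closed[OF K] quotient_group(4)[OF n] by simp
  have "N #> x \<in> K" if "x \<in> N" for x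
  proof -
    have "N #> x = N" using quotient_group(5)[OF n, of x] N(2) that by auto
    then show ?thesis using K1 by simp
  qed
  then show NK: "N \<subseteq> {u \<in> U. N #> u \<in> K}" using N(2) by blast
  show "subgroup {u \<in> U. N #> u \<in> K} G"
  proof (rule subgroupI)
    show "{u \<in> U. N #> u \<in> K} \<subseteq> carrier G" using sU by auto
    show "{u \<in> U. N #> u \<in> K} \<noteq> {}" using NK subgroup.one_closed[OF N(1)] by blast
    show "inv a \<in> {u \<in> U. N #> u \<in> K}" if "a \<in> {u \<in> U. N #> u \<in> K}" for a
      using that h.hom_inv[of a] m_inv_consistent[OF U, of a] subgroup.m_inv_closed[OF U, of a]
        subgroup.m_inv_closed[OF K, of "N #> a"] by simp
    show "a \<otimes> b \<in> {u \<in> U. N #> u \<in> K}" if "a \<in> {u \<in> U. N #> u \<in> K}" "b \<in> {u \<in> U. N #> u \<in> K}" for a b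
      using that h.hom_mult[of a b] subgroup.m_closed[OF U, of a b]
        subgroup.m_closed[OF K, of "N #> a" "N #> b"] by simp
  qed
qed

text \<open>It is the preimage in U of the centralizer of the image of x in U/N.\<close>

lemma commuting_subgroup:
  assumes n: "normal_in N U" and x: "x \<in> U"
  shows "subgroup {u \<in> U. u \<otimes> x \<otimes> inv u \<otimes> inv x \<in> N} G"
proof -
  have U: "subgroup U G" using n unfolding normal_in_def by auto
  have sU: "U \<subseteq> carrier G" using subgroup.subset[OF U] .
  interpret Q: fin_group "quotient U N" by (rule quotient_group(1)[OF n])
  interpret h: group_hom "G\<lparr>carrier := U\<rparr>" "quotient U N" "\<lambda>x. N #> x" by (rule quotient_group(2)[OF n])
  have xQ: "{N #> x} \<subseteq> carrier (quotient U N)" using quotient_group(3)[OF n] x by auto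
  have "u \<otimes> x \<otimes> inv u \<otimes> inv x \<in> N \<longleftrightarrow> N #> u \<in> Q.centralizer {N #> x}" if u: "u \<in> U" for u
  proof -
    have c: "u \<in> carrier G" "x \<in> carrier G" using u x sU by auto
    have m: "u \<otimes> x \<in> U" "x \<otimes> u \<in> U" using subgroup.m_closed[OF U] u x by auto
    have "u \<otimes> x \<otimes> inv u \<otimes> inv x = (u \<otimes> x) \<otimes> inv (x \<otimes> u)" using c by (simp add: inv_mult_group m_assoc)
    then have "u \<otimes> x \<otimes> inv u \<otimes> inv x \<in> N \<longleftrightarrow> N #> (u \<otimes> x) = N #> (x \<otimes> u)"
      using quotient_eq_iff[OF n m] by simp
    also have "\<dots> \<longleftrightarrow> N #> u \<in> Q.centralizer {N #> x}"
      using h.hom_mult[of u x] h.hom_mult[of x u] u x h.hom_closed[of u] unfolding Q.centralizer_def by simp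
    finally show ?thesis .
  qed
  then have "{u \<in> U. u \<otimes> x \<otimes> inv u \<otimes> inv x \<in> N} = {u \<in> U. N #> u \<in> Q.centralizer {N #> x}}" by auto
  then show ?thesis using quotient_preimage(1)[OF n Q.centralizer_subgroup[OF xQ]] by simp
qed

lemma subgroup_card_dvd:
  assumes "subgroup H G" "subgroup K G" "H \<subseteq> K" shows "card H dvd card K"
proof -
  interpret K: fin_group "G\<lparr>carrier := K\<rparr>" using subgroup_fin_group[OF assms(2)] .
  show ?thesis using K.card_subgroup_dvd[OF subgroup_incl[OF assms]] unfolding order_def by simp
qed

lemma prime_index_maximal:
  assumes "subgroup N G" "subgroup H G" "subgroup U G" "N \<subseteq> H" "H \<subseteq> U" "prime p" "card U = p * card N"
  shows "H = N \<or> H = U"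
proof -
  obtain k where k: "card H = card N * k" using subgroup_card_dvd[OF assms(1,2,4)] by blast
  obtain l where l: "card U = card H * l" using subgroup_card_dvd[OF assms(2,3,5)] by blast
  have "card U = k * l * card N" unfolding l k by simp
  then have "p * card N = k * l * card N" using assms(7) by metis
  then have "p = k * l" using card_subgroup_pos[OF assms(1)] by (metis mult_cancel2 less_numeral_extra(3))
  then have "k = 1 \<or> l = 1" using assms(6) prime_product by blast
  then show ?thesis
  proof
    assume "k = 1" then show ?thesis using k card_subset_eq[OF fin_subgroup[OF assms(2)] assms(4)] by simp
  next
    assume "l = 1" then show ?thesis using l card_subset_eq[OF fin_subgroup[OF assms(3)] assms(5)] by simp
  qed
qed

text \<open>A quotient of prime order is abelian. For y outside N, the elements of U that commute
  with y modulo N form a subgroup that contains N and y, and N is maximal in U.\<close>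

lemma prime_index_commutators:
  assumes n: "normal_in N U" and p: "prime p" "card U = p * card N" and "x \<in> U" "y \<in> U"
  shows "x \<otimes> y \<otimes> inv x \<otimes> inv y \<in> N"
proof -
  have U: "subgroup U G" and N: "subgroup N G" "N \<subseteq> U" and nn: "\<And>u m. u \<in> U \<Longrightarrow> m \<in> N \<Longrightarrow> u \<otimes> m \<otimes> inv u \<in> N"
    using n unfolding normal_in_def by auto
  have sU: "U \<subseteq> carrier G" using subgroup.subset[OF U] .
  have yc: "y \<in> carrier G" using assms sU by auto
  show ?thesis
  proof (cases "y \<in> N")
    case True
    then show ?thesis using nn[OF assms(4) True] subgroup.m_inv_closed[OF N(1) True] subgroup.m_closed[OF N(1)] by blast
  next
    case False
    define Z where "Z = {u \<in> U. u \<otimes> y \<otimes> inv u \<otimes> inv y \<in> N}"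
    have Z: "subgroup Z G" unfolding Z_def using commuting_subgroup[OF n assms(5)] .
    have NZ: "N \<subseteq> Z"
    proof
      fix m assume m: "m \<in> N"
      have mc: "m \<in> carrier G" using m N sU by auto
      have im: "inv m \<in> N" using subgroup.m_inv_closed[OF N(1) m] .
      have "m \<otimes> y \<otimes> inv m \<otimes> inv y = m \<otimes> (y \<otimes> inv m \<otimes> inv y)" using mc yc by (simp add: m_assoc)
      also have "\<dots> \<in> N" using subgroup.m_closed[OF N(1) m nn[OF assms(5) im]] .
      finally show "m \<in> Z" unfolding Z_def using m N by auto
    qed
    have "y \<in> Z" unfolding Z_def using assms(5) yc subgroup.one_closed[OF N(1)] by (simp add: m_assoc)
    then have "Z \<noteq> N" using False by auto
    moreover have "Z \<subseteq> U" unfolding Z_def by auto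
    ultimately have "Z = U" using prime_index_maximal[OF N(1) Z U NZ _ p] by auto
    then show ?thesis using assms(4) unfolding Z_def by auto
  qed
qed

section \<open>Chains of normal subgroups of prime index\<close>

definition prime_step :: "nat set \<Rightarrow> 'a set \<Rightarrow> 'a set \<Rightarrow> bool" where
  "prime_step \<pi> U N \<longleftrightarrow> normal_in N U \<and> (\<exists>p\<in>\<pi>. prime p \<and> card U = p * card N)"

text \<open>These chains replace the solvable \<pi>-quotients in the definition of the residual.
  They can be concatenated and intersected with subgroups, and a property of marks can be followed
  along them one prime at a time.\<close>

abbreviation reach :: "nat set \<Rightarrow> 'a set \<Rightarrow> 'a set \<Rightarrow> bool" where
  "reach \<pi> \<equiv> (prime_step \<pi>)\<^sup>*\<^sup>*"

lemma pi_perfect_step: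
  assumes "subgroup U G" shows "pi_perfect G \<pi> U \<longleftrightarrow> \<not> (\<exists>N. prime_step \<pi> U N)"
proof -
  have "order (quotient U N) = p \<longleftrightarrow> card U = p * card N" if n: "normal_in N U" for N p
    using quotient_group(6)[OF n] card_subgroup_pos[of N] n unfolding normal_in_def by auto
  then show ?thesis unfolding pi_perfect_def normal_iff_normal_in[OF assms] prime_step_def by blast
qed

lemma reach_subgroup:
  assumes "reach \<pi> U N" "subgroup U G" shows "subgroup N G \<and> N \<subseteq> U"
  using assms by (induction rule: rtranclp_induct) (auto simp: prime_step_def normal_in_def)

text \<open>K / (K \<inter> N) embeds in U/N, which has prime order p, so it has order 1 or
  p.\<close>

lemma step_int:
  assumes s: "prime_step \<pi> U N" and K: "subgroup K G" "K \<subseteq> U"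
  shows "K \<inter> N = K \<or> prime_step \<pi> K (K \<inter> N)"
proof -
  obtain p where n: "normal_in N U" and p: "p \<in> \<pi>" "prime p" "card U = p * card N" using s unfolding prime_step_def by auto
  have U: "subgroup U G" and N: "subgroup N G" "N \<subseteq> U" and nn: "\<And>u m. u \<in> U \<Longrightarrow> m \<in> N \<Longrightarrow> u \<otimes> m \<otimes> inv u \<in> N"
    using n unfolding normal_in_def by auto
  have KN: "subgroup (K \<inter> N) G" using subgroups_Inter_pair[OF K(1) N(1)] .
  have nK: "normal_in (K \<inter> N) K" unfolding normal_in_def
    using K KN nn subgroup.m_closed[OF K(1)] subgroup.m_inv_closed[OF K(1)] by auto
  interpret Q: fin_group "quotient U N" by (rule quotient_group(1)[OF n])
  interpret h: group_hom "G\<lparr>carrier := U\<rparr>" "quotient U N" "\<lambda>x. N #> x" by (rule quotient_group(2)[OF n])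
  have KU: "subgroup K (G\<lparr>carrier := U\<rparr>)" using subgroup_incl[OF K(1) U K(2)] .
  define I where "I = (\<lambda>x. N #> x) ` K"
  have I: "subgroup I (quotient U N)" unfolding I_def using h.subgroup_img_is_subgroup[OF KU] .
  have ord: "order (quotient U N) = p" using quotient_group(6)[OF n] p(3) card_subgroup_pos[OF N(1)] by simp
  have "card I dvd p" using Q.card_subgroup_dvd[OF I] ord by simp
  then have cI: "card I = 1 \<or> card I = p" using p(2) prime_nat_iff by blast
  have cK: "card K = card (K \<inter> N) * card I"
  proof (rule card_fibres[where f = "\<lambda>x. N #> x"])
    show "finite K" using fin_subgroup[OF K(1)] .
    show "(\<lambda>x. N #> x) ` K = I" unfolding I_def ..
    fix b assume "b \<in> I"
    then obtain k where k: "k \<in> K" "b = N #> k" unfolding I_def by auto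
    have kc: "k \<in> carrier G" using k subgroup.subset[OF K(1)] by auto
    show "card {a \<in> K. N #> a = b} = card (K \<inter> N)"
    proof (rule bij_betw_same_card[symmetric])
      show "bij_betw (\<lambda>x. x \<otimes> k) (K \<inter> N) {a \<in> K. N #> a = b}"
      proof (rule bij_betwI[where g = "\<lambda>x. x \<otimes> inv k"])
        show "(\<lambda>x. x \<otimes> k) \<in> K \<inter> N \<rightarrow> {a \<in> K. N #> a = b}"
        proof
          fix x assume x: "x \<in> K \<inter> N"
          have xk: "x \<otimes> k \<in> K" using subgroup.m_closed[OF K(1)] x k by auto
          have "x \<otimes> k \<otimes> inv k = x" using x kc subgroup.subset[OF K(1)] by (auto simp: m_assoc)
          then show "x \<otimes> k \<in> {a \<in> K. N #> a = b}"
            unfolding k(2) using quotient_eq_iff[OF n, of "x \<otimes> k" k] xk k K x by auto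
        qed
        show "(\<lambda>x. x \<otimes> inv k) \<in> {a \<in> K. N #> a = b} \<rightarrow> K \<inter> N"
          unfolding k(2) using quotient_eq_iff[OF n, of _ k] k K subgroup.m_closed[OF K(1)] subgroup.m_inv_closed[OF K(1)] by auto
      qed (use kc subgroup.subset[OF K(1)] in \<open>auto simp: m_assoc\<close>)
    qed
  qed
  show ?thesis
  proof (cases "card I = 1")
    case True
    then have "card (K \<inter> N) = card K" using cK by simp
    then show ?thesis using card_subset_eq[OF fin_subgroup[OF K(1)], of "K \<inter> N"] by auto
  next
    case False
    then have "card K = p * card (K \<inter> N)" using cI cK by simp
    then show ?thesis unfolding prime_step_def using nK p by blast
  qed
qed

lemma reach_int:
  assumes "reach \<pi> U N" "subgroup U G" "subgroup K G" "K \<subseteq> U"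
  shows "reach \<pi> K (K \<inter> N)"
  using assms
proof (induction rule: rtranclp_induct)
  case base
  then have "K \<inter> U = K" by auto
  then show ?case by simp
next
  case (step M N)
  have M: "subgroup M G" using reach_subgroup[OF step(1,4)] by simp
  have KM: "subgroup (K \<inter> M) G" using subgroups_Inter_pair[OF step(5) M] .
  have NM: "N \<subseteq> M" using step(2) unfolding prime_step_def normal_in_def by auto
  have "K \<inter> M \<inter> N = K \<inter> M \<or> prime_step \<pi> (K \<inter> M) (K \<inter> M \<inter> N)" using step_int[OF step(2) KM] by auto
  moreover have "K \<inter> M \<inter> N = K \<inter> N" using NM by auto
  ultimately show ?case using step.IH[OF step(4-6)] by (auto intro: rtranclp.rtrancl_into_rtrancl)
qed

lemma step_conj:
  assumes s: "prime_step \<pi> U N" and g: "g \<in> carrier G"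
  shows "prime_step \<pi> (conj_img G g U) (conj_img G g N)"
proof -
  have U: "subgroup U G" and N: "subgroup N G" "N \<subseteq> U" and nn: "\<And>u m. u \<in> U \<Longrightarrow> m \<in> N \<Longrightarrow> u \<otimes> m \<otimes> inv u \<in> N"
    using s unfolding prime_step_def normal_in_def by auto
  have sU: "U \<subseteq> carrier G" and sN: "N \<subseteq> carrier G" using subgroup.subset U N by auto
  have "(g \<otimes> u \<otimes> inv g) \<otimes> (g \<otimes> m \<otimes> inv g) \<otimes> inv (g \<otimes> u \<otimes> inv g) = g \<otimes> (u \<otimes> m \<otimes> inv u) \<otimes> inv g"
    if "u \<in> U" "m \<in> N" for u m
  proof -
    have "u \<in> carrier G" "m \<in> carrier G" using that sU sN by auto
    then show ?thesis using g by (simp add: inv_mult_group m_assoc inv_mult_cancel)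
  qed
  then have "normal_in (conj_img G g N) (conj_img G g U)"
    unfolding normal_in_def using conj_img_subgroup U N g conj_img_mono[OF N(2)] nn
    by (auto simp: conj_img_def image_iff)
  then show ?thesis using s unfolding prime_step_def card_conj_img[OF sU g] card_conj_img[OF sN g] by blast
qed

lemma reach_conj:
  assumes "reach \<pi> U N" "g \<in> carrier G" shows "reach \<pi> (conj_img G g U) (conj_img G g N)"
  using assms by (induction rule: rtranclp_induct) (auto intro: step_conj rtranclp.rtrancl_into_rtrancl)

text \<open>A reachable N of smallest order is contained in every reachable M: intersecting the
  chain from U to M with N shows that N \<inter> M is reachable too.\<close>

lemma least_reach:
  assumes U: "subgroup U G"
  obtains N where "reach \<pi> U N" "\<And>M. reach \<pi> U M \<Longrightarrow> N \<subseteq> M"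
proof -
  obtain N where N: "reach \<pi> U N" "\<And>M. reach \<pi> U M \<Longrightarrow> card N \<le> card M"
    using ex_has_least_nat[of "reach \<pi> U" U card] by blast
  have sN: "subgroup N G" "N \<subseteq> U" using reach_subgroup[OF N(1) U] by auto
  have "N \<subseteq> M" if M: "reach \<pi> U M" for M
  proof -
    have "reach \<pi> N (N \<inter> M)" using reach_int[OF M U sN] .
    then have "reach \<pi> U (N \<inter> M)" using N(1) by simp
    then have "card N \<le> card (N \<inter> M)" using N(2) by simp
    then have "N \<inter> M = N" using card_seteq[OF fin_subgroup[OF sN(1)], of "N \<inter> M"] by auto
    then show ?thesis by auto
  qed
  then show ?thesis using N(1) that by blast
qed

lemma derived_sub_iff:
  assumes "subgroup U G" "subgroup N G"
  shows "derived G U \<subseteq> N \<longleftrightarrow> (\<forall>x\<in>U. \<forall>y\<in>U. x \<otimes> y \<otimes> inv x \<otimes> inv y \<in> N)"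
proof
  assume d: "derived G U \<subseteq> N"
  have "derived_set G U \<subseteq> derived G U" unfolding derived_def by (rule subsetI, rule generate.incl)
  then show "\<forall>x\<in>U. \<forall>y\<in>U. x \<otimes> y \<otimes> inv x \<otimes> inv y \<in> N" using d by blast
next
  assume "\<forall>x\<in>U. \<forall>y\<in>U. x \<otimes> y \<otimes> inv x \<otimes> inv y \<in> N"
  then have "derived_set G U \<subseteq> N" by blast
  then show "derived G U \<subseteq> N" unfolding derived_def using generate_subgroup_incl assms(2) by blast
qed

text \<open>The derived series of U/N is the image of the derived series of U.\<close>

lemma solvable_quo_iff:
  assumes n: "normal_in N U"
  shows "solvable (quotient U N) \<longleftrightarrow> (\<exists>k. (derived G ^^ k) U \<subseteq> N)"
proof -
  have U: "subgroup U G" and N: "subgroup N G" "N \<subseteq> U" using n unfolding normal_in_def by auto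
  interpret Q: fin_group "quotient U N" by (rule quotient_group(1)[OF n])
  interpret h: group_hom "G\<lparr>carrier := U\<rparr>" "quotient U N" "\<lambda>x. N #> x" by (rule quotient_group(2)[OF n])
  have dk: "(derived (G\<lparr>carrier := U\<rparr>) ^^ k) U = (derived G ^^ k) U \<and> (derived G ^^ k) U \<subseteq> U" for k
  proof (induction k)
    case (Suc k)
    then show ?case using derived_consistent[OF _ U] derived_incl[OF _ U] by simp
  qed simp
  have im: "(derived (quotient U N) ^^ k) (carrier (quotient U N)) = (\<lambda>x. N #> x) ` ((derived G ^^ k) U)" for k
    using h.exp_of_derived_img[of U k] dk[of k] quotient_group(3)[OF n] by simp
  have gen: "f ` B = {c} \<longleftrightarrow> (\<forall>x\<in>B. f x = c)" if "B \<noteq> {}" for f :: "'a \<Rightarrow> 'a set" and B c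
    using that by auto
  have "(\<lambda>x. N #> x) ` ((derived G ^^ k) U) = {\<one>\<^bsub>quotient U N\<^esub>} \<longleftrightarrow> (derived G ^^ k) U \<subseteq> N" for k
  proof -
    have ne: "(derived G ^^ k) U \<noteq> {}" using exp_of_derived_is_subgroup[OF U, of k] subgroup.one_closed by blast
    have "(\<lambda>x. N #> x) ` ((derived G ^^ k) U) = {\<one>\<^bsub>quotient U N\<^esub>} \<longleftrightarrow> (\<forall>x\<in>(derived G ^^ k) U. N #> x = N)"
      unfolding quotient_group(4)[OF n] by (rule gen[OF ne])
    also have "\<dots> \<longleftrightarrow> (\<forall>x\<in>(derived G ^^ k) U. x \<in> N)"
    proof (rule ball_cong[OF refl])
      fix x assume "x \<in> (derived G ^^ k) U"
      then have "x \<in> U" using dk[of k] by (meson subsetD)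
      then show "N #> x = N \<longleftrightarrow> x \<in> N" by (rule quotient_group(5)[OF n])
    qed
    also have "\<dots> \<longleftrightarrow> (derived G ^^ k) U \<subseteq> N" by (simp only: subset_eq)
    finally show "(\<lambda>x. N #> x) ` ((derived G ^^ k) U) = {\<one>\<^bsub>quotient U N\<^esub>} \<longleftrightarrow> (derived G ^^ k) U \<subseteq> N" .
  qed
  then show ?thesis unfolding Q.solvable_iff_trivial_derived_seq im by (rule ex_cong1)
qed

text \<open>Quotients of prime order are abelian, so each step of the chain absorbs one further
  commutator subgroup.\<close>

lemma reach_derived:
  assumes "reach \<pi> U N" "subgroup U G" shows "\<exists>k. (derived G ^^ k) U \<subseteq> N"
  using assms
proof (induction rule: rtranclp_induct)
  case base
  show ?case by (rule exI[of _ 0]) simp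
next
  case (step M N)
  then obtain k where k: "(derived G ^^ k) U \<subseteq> M" by blast
  obtain p where n: "normal_in N M" "prime p" "card M = p * card N" using step(2) unfolding prime_step_def by auto
  have sg: "subgroup M G" "subgroup N G" using n unfolding normal_in_def by auto
  have "derived G M \<subseteq> N" using derived_sub_iff[OF sg] prime_index_commutators[OF n] by blast
  then have "(derived G ^^ Suc k) U \<subseteq> N" using mono_derived[OF k] by simp
  then show ?case by blast
qed

lemma reach_card:
  assumes "reach \<pi> U N"
  shows "\<exists>k. card U = k * card N \<and> (\<forall>q. prime q \<longrightarrow> q dvd k \<longrightarrow> q \<in> \<pi>)"
  using assms
proof (induction rule: rtranclp_induct)
  case base
  show ?case by (rule exI[of _ 1]) auto
next
  case (step M N)
  then obtain k where k: "card U = k * card M" "\<forall>q. prime q \<longrightarrow> q dvd k \<longrightarrow> q \<in> \<pi>" by blast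
  obtain p where p: "p \<in> \<pi>" "prime p" "card M = p * card N" using step(2) unfolding prime_step_def by auto
  have "q \<in> \<pi>" if "prime q" "q dvd k * p" for q
    using that k(2) p by (metis prime_dvd_mult_iff primes_dvd_imp_eq)
  then show ?case using k(1) p(3) by (intro exI[of _ "k * p"]) auto
qed

text \<open>Take M maximal among the proper subgroups of U that contain D. It is normal because D
  contains all commutators. The preimage of a subgroup of prime order of U/M is strictly larger than
  M, hence all of U, so U/M has prime order.\<close>

lemma proper_prime_index:
  assumes D: "subgroup D G" and U: "subgroup U G" and DU: "D \<subseteq> U" "D \<noteq> U"
    and comm: "\<And>x y. x \<in> U \<Longrightarrow> y \<in> U \<Longrightarrow> x \<otimes> y \<otimes> inv x \<otimes> inv y \<in> D"
  obtains M p where "normal_in M U" "D \<subseteq> M" "prime p" "card U = p * card M"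
proof -
  let ?P = "\<lambda>M. subgroup M G \<and> D \<subseteq> M \<and> M \<subseteq> U \<and> M \<noteq> U"
  have "finite {M. ?P M}" by (rule finite_subset[OF _ fin_subgroups]) auto
  moreover have "{M. ?P M} \<noteq> {}" using D DU by blast
  ultimately obtain M where M: "M \<in> {M. ?P M}" "\<And>H. H \<in> {M. ?P M} \<Longrightarrow> M \<subseteq> H \<Longrightarrow> M = H"
    using finite_has_maximal by (metis (no_types, lifting))
  have M1: "subgroup M G" "D \<subseteq> M" "M \<subseteq> U" "M \<noteq> U" using M(1) by auto
  have sU: "U \<subseteq> carrier G" using subgroup.subset[OF U] .
  have nM: "normal_in M U" unfolding normal_in_def
  proof (intro conjI ballI)
    fix u m assume um: "u \<in> U" "m \<in> M"
    have c: "u \<in> carrier G" "m \<in> carrier G" using um M1 sU by auto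
    have "u \<otimes> m \<otimes> inv u \<otimes> inv m \<in> M" using comm[of u m] um M1 by auto
    then have "u \<otimes> m \<otimes> inv u \<otimes> inv m \<otimes> m \<in> M" using subgroup.m_closed[OF M1(1) _ um(2)] by blast
    then show "u \<otimes> m \<otimes> inv u \<in> M" using c by (simp add: m_assoc)
  qed (use M1 U in auto)
  interpret Q: fin_group "quotient U M" by (rule quotient_group(1)[OF nM])
  have card_eq: "order (quotient U M) * card M = card U" by (rule quotient_group(6)[OF nM])
  have "order (quotient U M) \<noteq> 1"
  proof
    assume "order (quotient U M) = 1"
    then show False using card_eq card_subset_eq[OF fin_subgroup[OF U] M1(3)] M1(4) by simp
  qed
  then obtain p where p: "prime p" "p dvd order (quotient U M)" using prime_factor_nat by blast
  \<comment> \<open>Exponent 1 makes the Sylow theorem serve as Cauchy's theorem.\<close>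
  then obtain m where "order (quotient U M) = p ^ 1 * m" by auto
  then obtain H where H: "subgroup H (quotient U M)" "card H = p ^ 1"
    using sylow_thm[OF p(1) Q.is_group _ Q.fin] by blast
  define M' where "M' = {u \<in> U. M #> u \<in> H}"
  have M': "subgroup M' G" "M \<subseteq> M'" unfolding M'_def using quotient_preimage[OF nM H(1)] by auto
  have "M' = U"
  proof (rule ccontr)
    assume "M' \<noteq> U"
    then have "M = M'" using M(2)[of M'] M' M1(2) unfolding M'_def by blast
    then have iff: "\<And>u. u \<in> U \<Longrightarrow> M #> u \<in> H \<Longrightarrow> u \<in> M" unfolding M'_def by blast
    have "H \<subseteq> {M}"
    proof
      fix h assume h: "h \<in> H"
      then obtain u where u: "u \<in> U" "h = M #> u" using subgroup.subset[OF H(1)] quotient_group(3)[OF nM] by auto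
      then show "h \<in> {M}" using iff h quotient_group(5)[OF nM u(1)] by simp
    qed
    then have "card H \<le> card {M}" by (intro card_mono) auto
    then show False using H(2) prime_gt_1_nat[OF p(1)] by simp
  qed
  then have "carrier (quotient U M) \<subseteq> H" using quotient_group(3)[OF nM] unfolding M'_def by auto
  then have "carrier (quotient U M) = H" using subgroup.subset[OF H(1)] by auto
  then have "order (quotient U M) = p" using H(2) unfolding order_def by simp
  then show ?thesis using that[OF nM M1(2) p(1)] card_eq by simp
qed

text \<open>Induction on |U|. As U/N is solvable and nontrivial, its commutator subgroup is proper.
  A normal subgroup M of prime index above the preimage of this commutator subgroup gives the first
  step of the chain, and its index divides |U : N|.\<close>

lemma solvable_reach:
  assumes "normal_in N U" "(derived G ^^ k) U \<subseteq> N" "\<And>q. prime q \<Longrightarrow> q dvd card U div card N \<Longrightarrow> q \<in> \<pi>"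
  shows "reach \<pi> U N"
  using assms
proof (induction "card U" arbitrary: U rule: less_induct)
  case less
  note n = less.prems(1)
  have U: "subgroup U G" and N: "subgroup N G" "N \<subseteq> U" and nn: "\<And>u m. u \<in> U \<Longrightarrow> m \<in> N \<Longrightarrow> u \<otimes> m \<otimes> inv u \<in> N"
    using n unfolding normal_in_def by auto
  show ?case
  proof (cases "N = U")
    case False
    interpret Q: fin_group "quotient U N" by (rule quotient_group(1)[OF n])
    interpret h: group_hom "G\<lparr>carrier := U\<rparr>" "quotient U N" "\<lambda>x. N #> x" by (rule quotient_group(2)[OF n])
    have solv: "solvable (quotient U N)" using solvable_quo_iff[OF n] less.prems(2) by blast
    define D' where "D' = derived (quotient U N) (carrier (quotient U N))"
    have D': "subgroup D' (quotient U N)" unfolding D'_def using Q.derived_is_subgroup by simp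
    have "D' \<noteq> carrier (quotient U N)"
    proof
      assume e: "D' = carrier (quotient U N)"
      have "(derived (quotient U N) ^^ j) (carrier (quotient U N)) = carrier (quotient U N)" for j
        using e unfolding D'_def by (induction j) simp_all
      then have "carrier (quotient U N) = {\<one>\<^bsub>quotient U N\<^esub>}" using solv unfolding Q.solvable_iff_trivial_derived_seq by simp
      then have "\<And>u. u \<in> U \<Longrightarrow> N #> u = N" unfolding quotient_group(3)[OF n] quotient_group(4)[OF n] by auto
      then show False using quotient_group(5)[OF n] False N by blast
    qed
    define D where "D = {u \<in> U. N #> u \<in> D'}"
    have D: "subgroup D G" "N \<subseteq> D" unfolding D_def using quotient_preimage[OF n D'] by auto
    have "D \<noteq> U"
    proof
      assume "D = U"
      then have "carrier (quotient U N) \<subseteq> D'" unfolding D_def quotient_group(3)[OF n] by auto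
      then show False using \<open>D' \<noteq> carrier (quotient U N)\<close> subgroup.subset[OF D'] by auto
    qed
    have comm: "x \<otimes> y \<otimes> inv x \<otimes> inv y \<in> D" if xy: "x \<in> U" "y \<in> U" for x y
    proof -
      have iv: "inv x \<in> U" "inv y \<in> U" using subgroup.m_inv_closed[OF U] xy by auto
      have cl: "x \<otimes> y \<in> U" "x \<otimes> y \<otimes> inv x \<in> U" "x \<otimes> y \<otimes> inv x \<otimes> inv y \<in> U"
        using subgroup.m_closed[OF U] xy iv by auto
      let ?f = "\<lambda>x. N #> x"
      have "?f (x \<otimes> y \<otimes> inv x \<otimes> inv y) = ?f x \<otimes>\<^bsub>quotient U N\<^esub> ?f y \<otimes>\<^bsub>quotient U N\<^esub> inv\<^bsub>quotient U N\<^esub> ?f x \<otimes>\<^bsub>quotient U N\<^esub> inv\<^bsub>quotient U N\<^esub> ?f y"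
        using h.hom_mult[of "x \<otimes> y \<otimes> inv x" "inv y"] h.hom_mult[of "x \<otimes> y" "inv x"] h.hom_mult[of x y]
          h.hom_inv[of x] h.hom_inv[of y] m_inv_consistent[OF U] xy iv cl by simp
      also have "\<dots> \<in> derived_set (quotient U N) (carrier (quotient U N))" using quotient_group(3)[OF n] xy by blast
      also have "\<dots> \<subseteq> D'" unfolding D'_def derived_def by (rule subsetI, rule generate.incl)
      finally show ?thesis unfolding D_def using cl by simp
    qed
    obtain M p where M: "normal_in M U" "D \<subseteq> M" "prime p" "card U = p * card M"
      using proper_prime_index[OF D(1) U _ \<open>D \<noteq> U\<close> comm] unfolding D_def by blast
    have sM: "subgroup M G" "M \<subseteq> U" "N \<subseteq> M" using M(1,2) D(2) unfolding normal_in_def by auto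
    obtain k' where k': "card M = card N * k'" using subgroup_card_dvd[OF N(1) sM(1,3)] by blast
    have cN: "card N > 0" using card_subgroup_pos[OF N(1)] .
    have q: "card U div card N = p * k'" "card M div card N = k'" using M(4) k' cN by auto
    have "p \<in> \<pi>" using less.prems(3)[of p] M(3) q(1) by simp
    then have "prime_step \<pi> U M" unfolding prime_step_def using M by blast
    moreover have "reach \<pi> M N"
    proof (rule less.hyps)
      show "card M < card U" using M(4) prime_gt_1_nat[OF M(3)] card_subgroup_pos[OF sM(1)] by simp
      show "normal_in N M" unfolding normal_in_def using sM N nn by auto
      show "(derived G ^^ k) M \<subseteq> N" using mono_exp_of_derived[OF sM(2), of k] less.prems(2) by auto
      show "q \<in> \<pi>" if "prime q" "q dvd card M div card N" for q
        using that less.prems(3)[of q] unfolding q \<open>card U div card N = p * k'\<close> by simp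
    qed
    ultimately show ?thesis by (rule converse_rtranclp_into_rtranclp)
  qed simp
qed

text \<open>The least reachable N is normal in U, because conjugation by elements of U permutes the
  reachable subgroups. For a normal subgroup of U, reachability means precisely that the quotient is
  a solvable \<pi>-group. Hence N belongs to the family whose intersection defines the residual, and
  lies in all its members.\<close>

lemma pi_residual_least:
  assumes U: "subgroup U G"
  shows "reach \<pi> U (pi_residual G \<pi> U)" and "reach \<pi> U M \<Longrightarrow> pi_residual G \<pi> U \<subseteq> M"
proof -
  obtain N where N: "reach \<pi> U N" "\<And>M. reach \<pi> U M \<Longrightarrow> N \<subseteq> M" using least_reach[OF U, of \<pi>] by blast
  have sN: "subgroup N G" "N \<subseteq> U" using reach_subgroup[OF N(1) U] by auto
  have sN': "N \<subseteq> carrier G" using subgroup.subset[OF sN(1)] .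
  have nN: "normal_in N U" unfolding normal_in_def
  proof (intro conjI ballI U sN)
    fix u m assume um: "u \<in> U" "m \<in> N"
    have u: "u \<in> carrier G" "conj_img G u U = U" using subset_normalizer_of[OF U] um unfolding normalizer_of_def by auto
    have "reach \<pi> U (conj_img G u N)" using reach_conj[OF N(1) u(1)] u(2) by simp
    then have "N \<subseteq> conj_img G u N" using N(2) by simp
    then have "N = conj_img G u N"
      using card_conj_img[OF sN' u(1)] by (intro card_subset_eq) (auto simp: conj_img_def fin_subgroup[OF sN(1)])
    then show "u \<otimes> m \<otimes> inv u \<in> N" using um unfolding conj_img_def by auto
  qed
  have fam: "normal_in M U \<and> solvable (quotient U M) \<and> (\<forall>p. prime p \<and> p dvd order (quotient U M) \<longrightarrow> p \<in> \<pi>) \<longleftrightarrow> normal_in M U \<and> reach \<pi> U M" for M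
  proof (cases "normal_in M U")
    case True
    have cM: "card M > 0" using card_subgroup_pos True unfolding normal_in_def by simp
    have o: "order (quotient U M) = card U div card M" using quotient_group(6)[OF True] cM by (metis div_mult_self_is_m)
    show ?thesis
    proof
      assume "normal_in M U \<and> solvable (quotient U M) \<and> (\<forall>p. prime p \<and> p dvd order (quotient U M) \<longrightarrow> p \<in> \<pi>)"
      then show "normal_in M U \<and> reach \<pi> U M" using solvable_quo_iff[OF True] solvable_reach[OF True] unfolding o by blast
    next
      assume r: "normal_in M U \<and> reach \<pi> U M"
      obtain k where k: "card U = k * card M" "\<forall>q. prime q \<longrightarrow> q dvd k \<longrightarrow> q \<in> \<pi>" using reach_card r by blast
      have "order (quotient U M) = k" unfolding o k(1) using cM by simp
      then show "normal_in M U \<and> solvable (quotient U M) \<and> (\<forall>p. prime p \<and> p dvd order (quotient U M) \<longrightarrow> p \<in> \<pi>)"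
        using solvable_quo_iff[OF True] reach_derived[OF _ U] r k(2) by blast
    qed
  qed simp
  have "pi_residual G \<pi> U = \<Inter>{M. normal_in M U \<and> reach \<pi> U M}"
    unfolding pi_residual_def normal_iff_normal_in[OF U] fam ..
  then have eq: "pi_residual G \<pi> U = N" using N nN by blast
  show "reach \<pi> U (pi_residual G \<pi> U)" using N eq by simp
  show "reach \<pi> U M \<Longrightarrow> pi_residual G \<pi> U \<subseteq> M" using N eq by simp
qed

lemma pi_residual_subgroup: "subgroup U G \<Longrightarrow> subgroup (pi_residual G \<pi> U) G"
  using pi_residual_least(1) reach_subgroup by blast

text \<open>Constancy along chains follows from leastness at both ends: chains concatenate, and a
  chain from U intersected with N is a chain from N.\<close>

lemma pi_residual_reach:
  assumes "reach \<pi> U N" "subgroup U G" shows "pi_residual G \<pi> N = pi_residual G \<pi> U"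
proof
  have N: "subgroup N G" using reach_subgroup[OF assms] by simp
  have "reach \<pi> U (pi_residual G \<pi> N)" using assms(1) pi_residual_least(1)[OF N] by (rule rtranclp_trans)
  then show "pi_residual G \<pi> U \<subseteq> pi_residual G \<pi> N" using pi_residual_least(2)[OF assms(2)] by blast
  have "pi_residual G \<pi> U \<subseteq> N" using pi_residual_least(2)[OF assms(2,1)] .
  then have "N \<inter> pi_residual G \<pi> U = pi_residual G \<pi> U" by auto
  then have "reach \<pi> N (pi_residual G \<pi> U)"
    using reach_int[OF pi_residual_least(1)[OF assms(2)] assms(2) N] reach_subgroup[OF assms] by metis
  then show "pi_residual G \<pi> N \<subseteq> pi_residual G \<pi> U" using pi_residual_least(2)[OF N] by blast
qed

lemma pi_residual_perfect:
  assumes U: "subgroup U G" shows "pi_perfect G \<pi> (pi_residual G \<pi> U)"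
proof -
  let ?V = "pi_residual G \<pi> U"
  have "\<not> prime_step \<pi> ?V N" for N
  proof
    assume s: "prime_step \<pi> ?V N"
    then have "reach \<pi> U N" using pi_residual_least(1)[OF U] by (metis rtranclp.rtrancl_into_rtrancl)
    then have "?V \<subseteq> N" using pi_residual_least(2)[OF U] by blast
    then have "card ?V = card N" using s unfolding prime_step_def normal_in_def by auto
    moreover obtain p where p: "prime p" "card ?V = p * card N" using s unfolding prime_step_def by blast
    moreover have "card N > 0" using s card_subgroup_pos unfolding prime_step_def normal_in_def by blast
    ultimately show False using prime_gt_1_nat[OF p(1)] by simp
  qed
  then show ?thesis using pi_perfect_step[OF pi_residual_subgroup[OF U]] by blast
qed

lemma pi_perfect_residual:
  assumes U: "subgroup U G" and p: "pi_perfect G \<pi> U" shows "pi_residual G \<pi> U = U"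
  using pi_residual_least(1)[OF U] p pi_perfect_step[OF U] by (metis converse_rtranclpE)

lemma pi_residual_conj:
  assumes U: "subgroup U G" and g: "g \<in> carrier G"
  shows "pi_residual G \<pi> (conj_img G g U) = conj_img G g (pi_residual G \<pi> U)"
proof -
  have "reach \<pi> (conj_img G g U) (conj_img G g (pi_residual G \<pi> U))"
    using reach_conj[OF pi_residual_least(1)[OF U] g] .
  then have "pi_residual G \<pi> (conj_img G g U) = pi_residual G \<pi> (conj_img G g (pi_residual G \<pi> U))"
    using pi_residual_reach conj_img_subgroup[OF U g] by metis
  also have "\<dots> = conj_img G g (pi_residual G \<pi> U)"
  proof (rule pi_perfect_residual)
    show sg: "subgroup (conj_img G g (pi_residual G \<pi> U)) G"
      using conj_img_subgroup[OF pi_residual_subgroup[OF U] g] .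
    have "\<not> prime_step \<pi> (conj_img G g (pi_residual G \<pi> U)) N" for N
    proof
      assume s: "prime_step \<pi> (conj_img G g (pi_residual G \<pi> U)) N"
      have "inv g \<in> carrier G" using g by simp
      from step_conj[OF s this] have "prime_step \<pi> (pi_residual G \<pi> U) (conj_img G (inv g) N)"
        using conj_img_cancel(1)[OF subgroup.subset[OF pi_residual_subgroup[OF U]] g] by simp
      then show False using pi_residual_perfect[OF U] pi_perfect_step[OF pi_residual_subgroup[OF U]] by blast
    qed
    then show "pi_perfect G \<pi> (conj_img G g (pi_residual G \<pi> U))" using pi_perfect_step[OF sg] by blast
  qed
  finally show ?thesis .
qed

end

section \<open>Integrality in the Burnside ring\<close>

locale integral_burnside = double_burnside G K
  for G (structure) and K :: "'k::field itself" +
  fixes R :: "'k set" and \<pi> :: "nat set"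
  assumes R: "0 \<in> R" "1 \<in> R" "\<And>x y. x \<in> R \<Longrightarrow> y \<in> R \<Longrightarrow> x + y \<in> R" "\<And>x. x \<in> R \<Longrightarrow> - x \<in> R"
      "\<And>x y. x \<in> R \<Longrightarrow> y \<in> R \<Longrightarrow> x * y \<in> R"
    and frac: "\<And>x. \<exists>a\<in>R. \<exists>b\<in>R. b \<noteq> 0 \<and> x = a / b"
    and Out: "\<And>U p. subgroup U G \<Longrightarrow> prime p \<Longrightarrow> p dvd order_Out G U \<Longrightarrow>
          (\<lambda>r. of_nat p * r) ` R \<noteq> {0} \<and> (\<lambda>r. of_nat p * r) ` R \<noteq> R"
    and pi_def: "\<pi> = {p. prime p \<and> p dvd order G \<and> \<not> (\<exists>r\<in>R. of_nat p * r = 1)}"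
begin

lemma R_nat: "of_nat n \<in> R"
  by (induction n) (use R in auto)

lemma R_sum: "(\<And>a. a \<in> A \<Longrightarrow> f a \<in> R) \<Longrightarrow> sum f A \<in> R"
  by (induction A rule: infinite_finite_induct) (use R in auto)

lemma R_diff: "a \<in> R \<Longrightarrow> b \<in> R \<Longrightarrow> a - b \<in> R"
  using R(3)[OF _ R(4)] by simp

lemma R_power: "a \<in> R \<Longrightarrow> a ^ n \<in> R"
  by (induction n) (use R in auto)

lemma weight_int:
  assumes U: "subgroup U G"
  obtains w where "card (normalizer_of U) = w * card U" "S.weight U = (of_nat w :: 'k)"
proof -
  obtain w where w: "card (normalizer_of U) = w * card U"
    using subgroup_card_dvd[OF U normalizer_of_subgroup[OF subgroup.subset[OF U]] subset_normalizer_of[OF U]] by (metis dvdE mult.commute)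
  have "S.weight U = (of_nat w :: 'k)" unfolding S.weight_def w using S.card_subgroup_nz[OF U] by simp
  then show ?thesis using that[OF w] by blast
qed

text \<open>The orbit congruence in the case where adjoining any q outside N yields the same mark c,
  so that only two different values occur in the sum.\<close>

lemma sum_fmark_normal:
  assumes x: "x \<in> burnside_space G" "\<And>U. x U \<in> R" and n: "normal_in N Q"
    and q: "\<And>q. q \<in> Q \<Longrightarrow> q \<notin> N \<Longrightarrow> S.fmark x (insert q N) = c"
  obtains r where "r \<in> R" "of_nat (card N) * S.fmark x N + (of_nat (card Q) - of_nat (card N)) * c = of_nat (card Q) * (r :: 'k)"
proof -
  have Q: "subgroup Q G" and N: "subgroup N G" "N \<subseteq> Q" and nn: "\<And>u m. u \<in> Q \<Longrightarrow> m \<in> N \<Longrightarrow> u \<otimes> m \<otimes> inv u \<in> N"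
    using n unfolding normal_in_def by auto
  have norm: "inv q \<otimes> m \<otimes> q \<in> N" if "q \<in> Q" "m \<in> N" for q m
    using nn[OF subgroup.m_inv_closed[OF Q that(1)] that(2)] that subgroup.subset[OF Q] by (auto simp: subset_iff)
  obtain r where r: "r \<in> R" "(\<Sum>q\<in>Q. S.fmark x (insert q N)) = of_nat (card Q) * r"
    using S.sum_fmark_integral[of x R, OF _ x(2) R(1-3,5) Q N(2) norm] x(1) unfolding burnside_space_eq by blast
  have fQ: "finite Q" using fin_subgroup[OF Q] .
  have "(\<Sum>q\<in>Q. S.fmark x (insert q N)) = (\<Sum>q\<in>N. S.fmark x (insert q N)) + (\<Sum>q\<in>Q - N. S.fmark x (insert q N))"
    using sum.subset_diff[OF N(2) fQ] by (simp add: add.commute)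
  also have "(\<Sum>q\<in>N. S.fmark x (insert q N)) = of_nat (card N) * S.fmark x N"
    by (simp add: insert_absorb)
  also have "(\<Sum>q\<in>Q - N. S.fmark x (insert q N)) = (\<Sum>q\<in>Q - N. c)" using q by (intro sum.cong) auto
  also have "\<dots> = (of_nat (card Q) - of_nat (card N)) * c"
    using card_Diff_subset[OF fin_subgroup[OF N(1)] N(2)] card_mono[OF fQ N(2)] by (simp add: of_nat_diff)
  finally show ?thesis using that r by simp
qed

text \<open>By maximality of N, any q in U outside N generates U together with N. The congruence
  then says that the mark at N plus (p - 1) times the mark at U lies in pR. If one mark were 0 and
  the other 1, this would make p invertible in \<open>R\<close>.\<close>

lemma fmark_step:
  assumes x: "x \<in> burnside_space G" "\<And>U. x U \<in> R" and s: "prime_step \<pi> U N"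
    and v: "S.fmark x U \<in> {0, 1}" "S.fmark x N \<in> {0, 1 :: 'k}"
  shows "S.fmark x U = S.fmark x N"
proof -
  obtain p where n: "normal_in N U" and p: "p \<in> \<pi>" "prime p" "card U = p * card N" using s unfolding prime_step_def by auto
  have U: "subgroup U G" and N: "subgroup N G" "N \<subseteq> U" using n unfolding normal_in_def by auto
  have ins: "S.fmark x (insert q N) = S.fmark x U" if q: "q \<in> U" "q \<notin> N" for q
  proof -
    have "insert q N \<subseteq> M \<longleftrightarrow> U \<subseteq> M" if M: "subgroup M G" for M
    proof
      assume a: "insert q N \<subseteq> M"
      have "M \<inter> U = N \<or> M \<inter> U = U"
        using prime_index_maximal[OF N(1) subgroups_Inter_pair[OF M U] U _ _ p(2,3)] a N(2) by blast
      then show "U \<subseteq> M" using a q by blast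
    qed (use q N in auto)
    then have "{M \<in> {U. subgroup U G}. insert q N \<subseteq> M} = {M \<in> {U. subgroup U G}. U \<subseteq> M}" by blast
    then show ?thesis unfolding S.fmark_def by simp
  qed
  obtain r where r: "r \<in> R" "of_nat (card N) * S.fmark x N + (of_nat (card U) - of_nat (card N)) * S.fmark x U = of_nat (card U) * r"
    using sum_fmark_normal[OF x n ins] by blast
  have "of_nat (card N) * (S.fmark x N + (of_nat p - 1) * S.fmark x U) = of_nat (card N) * (of_nat p * r)"
    using r(2) unfolding p(3) by (simp add: algebra_simps)
  then have e: "S.fmark x N + (of_nat p - 1) * S.fmark x U = of_nat p * r"
    using mult_left_cancel[OF S.card_subgroup_nz[OF N(1)]] by blast
  have no: "of_nat p * t \<noteq> 1" if "t \<in> R" for t using p(1) that unfolding pi_def by blast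
  show ?thesis
  proof (rule ccontr)
    assume "S.fmark x U \<noteq> S.fmark x N"
    then consider "S.fmark x U = 0" "S.fmark x N = 1" | "S.fmark x U = 1" "S.fmark x N = 0" using v by auto
    then show False
    proof cases
      case 1 then show False using e no[OF r(1)] by simp
    next
      case 2
      then have "of_nat p * (1 - r) = 1" using e by (simp add: algebra_simps)
      then show False using no[OF R_diff[OF R(2) r(1)]] by blast
    qed
  qed
qed

section \<open>Integral elements from prescribed marks\<close>

lemma coprime_divide:
  assumes "coprime a b" "\<exists>r\<in>R. t = of_nat a * r" "\<exists>r\<in>R. t = of_nat b * r"
  shows "\<exists>r\<in>R. t = of_nat (a * b) * r"
proof -
  obtain r s where r: "r \<in> R" "t = of_nat a * r" and s: "s \<in> R" "t = of_nat b * s" using assms by blast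
  obtain u v where "u * int a + v * int b = gcd (int a) (int b)" using bezout_int by blast
  then have uv: "u * int a + v * int b = 1" using assms(1) by (simp add: coprime_int_iff)
  have zR: "of_int z \<in> R" for z
  proof (cases z)
    case (neg n)
    then have "of_int z = - (of_nat (Suc n) :: 'k)" by simp
    then show ?thesis using R(4)[OF R_nat[of "Suc n"]] by metis
  qed (use R_nat in simp)
  have "t = of_int (u * int a + v * int b) * t" unfolding uv by simp
  also have "\<dots> = of_int u * of_nat a * t + of_int v * of_nat b * t" by (simp add: algebra_simps)
  also have "\<dots> = of_int u * of_nat a * (of_nat b * s) + of_int v * of_nat b * (of_nat a * r)"
    using r(2) s(2) by simp
  also have "\<dots> = of_nat (a * b) * (of_int u * s + of_int v * r)" by (simp add: algebra_simps)
  finally have e: "t = of_nat (a * b) * (of_int u * s + of_int v * r)" .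
  have "of_int u * s + of_int v * r \<in> R" by (intro R(3) R(5) zR r(1) s(1))
  with e show ?thesis by (rule bexI[where x = "of_int u * s + of_int v * r"])
qed

text \<open>Localises divisibility in \<open>R\<close>, so that integrality can be tested with one
  Sylow subgroup at a time.\<close>

lemma prime_powers_divide:
  assumes w: "w \<noteq> 0" and t: "\<And>p. prime p \<Longrightarrow> p dvd w \<Longrightarrow> \<exists>r\<in>R. t = of_nat (p ^ multiplicity p w) * r" and tR: "t \<in> R"
  shows "\<exists>r\<in>R. t = of_nat w * r"
proof -
  have "\<exists>r\<in>R. t = of_nat (\<Prod>p\<in>P. p ^ multiplicity p w) * r" if "finite P" "P \<subseteq> prime_factors w" for P
    using that
  proof (induction P)
    case empty then show ?case using tR by simp
  next
    case (insert p P)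
    have p: "prime p" "p dvd w" using insert by auto
    have "coprime (p ^ multiplicity p w) (\<Prod>p\<in>P. p ^ multiplicity p w)"
    proof (rule prod_coprime_right)
      fix q assume q: "q \<in> P"
      then have "prime q" "p \<noteq> q" using insert by auto
      then have "coprime p q" using p primes_coprime by blast
      then show "coprime (p ^ multiplicity p w) (q ^ multiplicity q w)" by simp
    qed
    then show ?case using coprime_divide[OF _ t[OF p] insert.IH] insert by simp
  qed
  from this[of "prime_factors w"] show ?thesis
    using prime_factorization_nat[of w] w by simp
qed

text \<open>H/L is cyclic of p-power order. That it is abelian is seen in two rounds: the elements
  commuting with q modulo L contain q and L, hence H; so for every y in H the elements commuting
  with y modulo L contain q and L, hence again H.\<close>

lemma reach_cyclic:
  assumes n: "normal_in L Q" and c: "card Q = p ^ a * card L" and p: "prime p" "p \<in> \<pi>" and q: "q \<in> Q"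
  defines "H \<equiv> generate G (insert q L)"
  shows "subgroup H G" "reach \<pi> H L"
proof -
  have Q: "subgroup Q G" and L: "subgroup L G" "L \<subseteq> Q" and nn: "\<And>u m. u \<in> Q \<Longrightarrow> m \<in> L \<Longrightarrow> u \<otimes> m \<otimes> inv u \<in> L"
    using n unfolding normal_in_def by auto
  have sQ: "Q \<subseteq> carrier G" using subgroup.subset[OF Q] .
  have ins: "insert q L \<subseteq> Q" "insert q L \<subseteq> carrier G" using q L sQ by auto
  show H: "subgroup H G" unfolding H_def using generate_is_subgroup[OF ins(2)] .
  have HQ: "H \<subseteq> Q" unfolding H_def using generate_subgroup_incl[OF ins(1) Q] .
  have LH: "L \<subseteq> H" "q \<in> H" unfolding H_def using generate.incl[of _ "insert q L"] by auto
  have nL: "normal_in L H" unfolding normal_in_def using H L LH nn HQ by auto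
  define Z where "Z = (\<lambda>y. {u \<in> Q. u \<otimes> y \<otimes> inv u \<otimes> inv y \<in> L})"
  have Z: "H \<subseteq> Z y" if y: "y \<in> Q" "q \<otimes> y \<otimes> inv q \<otimes> inv y \<in> L" for y
  proof -
    have "m \<otimes> y \<otimes> inv m \<otimes> inv y \<in> L" if m: "m \<in> L" for m
    proof -
      have mc: "m \<in> carrier G" "y \<in> carrier G" using m y L sQ by auto
      have "m \<otimes> y \<otimes> inv m \<otimes> inv y = m \<otimes> (y \<otimes> inv m \<otimes> inv y)" using mc by (simp add: m_assoc)
      then show ?thesis using subgroup.m_closed[OF L(1) m nn[OF y(1) subgroup.m_inv_closed[OF L(1) m]]] by simp
    qed
    then have "insert q L \<subseteq> Z y" unfolding Z_def using y q L by auto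
    then show ?thesis unfolding H_def using generate_subgroup_incl commuting_subgroup[OF n y(1)] unfolding Z_def by blast
  qed
  have qc: "q \<in> carrier G" using q sQ by auto
  have "q \<otimes> q \<otimes> inv q \<otimes> inv q \<in> L" using qc subgroup.one_closed[OF L(1)] by (simp add: m_assoc)
  then have Zq: "H \<subseteq> Z q" using Z[OF q] by blast
  have "x \<otimes> y \<otimes> inv x \<otimes> inv y \<in> L" if "x \<in> H" "y \<in> H" for x y
  proof -
    have yc: "y \<in> carrier G" "y \<in> Q" using that HQ sQ by auto
    have "y \<otimes> q \<otimes> inv y \<otimes> inv q \<in> L" using Zq that unfolding Z_def by auto
    then have "inv (y \<otimes> q \<otimes> inv y \<otimes> inv q) \<in> L" using subgroup.m_inv_closed[OF L(1)] by blast
    also have "inv (y \<otimes> q \<otimes> inv y \<otimes> inv q) = q \<otimes> y \<otimes> inv q \<otimes> inv y"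
      using yc qc by (simp add: inv_mult_group m_assoc)
    finally show ?thesis using Z[OF yc(2)] that unfolding Z_def by blast
  qed
  then have d: "derived G H \<subseteq> L" using derived_sub_iff[OF H L(1)] by blast
  show "reach \<pi> H L"
  proof (rule solvable_reach[OF nL, of 1])
    show "(derived G ^^ 1) H \<subseteq> L" using d by simp
    obtain k where k: "card H = card L * k" using subgroup_card_dvd[OF L(1) H LH(1)] by blast
    obtain l where l: "card Q = card H * l" using subgroup_card_dvd[OF H Q HQ] by blast
    have cL: "card L > 0" using card_subgroup_pos[OF L(1)] .
    have "card Q = card L * (k * l)" unfolding l k by simp
    then have "card L * (k * l) = card L * p ^ a" using c by (metis mult.commute)
    then have kl: "k * l = p ^ a" using cL by (metis mult_cancel1 less_numeral_extra(3))
    fix r assume r: "prime r" "r dvd card H div card L"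
    have "card H div card L = k" using k cL by simp
    then have "r dvd p ^ a" using r(2) kl by (metis dvd_mult2)
    then have "r dvd p" using r(1) prime_dvd_power by blast
    then show "r \<in> \<pi>" using p r(1) primes_dvd_imp_eq by blast
  qed
qed

text \<open>The preimage in N_G(L) of a subgroup of order p^a of N_G(L)/L, which the Sylow theorem
  provides.\<close>

lemma exists_p_extension:
  assumes L: "subgroup L G" and w: "card (normalizer_of L) = p ^ a * m * card L" and p: "prime p"
  obtains Q where "normal_in L Q" "Q \<subseteq> normalizer_of L" "card Q = p ^ a * card L"
proof -
  have sN: "subgroup (normalizer_of L) G" using normalizer_of_subgroup[OF subgroup.subset[OF L]] .
  have n: "normal_in L (normalizer_of L)" unfolding normal_in_def
  proof (intro conjI ballI sN L subset_normalizer_of)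
    fix u l assume "u \<in> normalizer_of L" "l \<in> L"
    then show "u \<otimes> l \<otimes> inv u \<in> L" unfolding normalizer_of_def conj_img_def by auto
  qed
  interpret Q: fin_group "quotient (normalizer_of L) L" by (rule quotient_group(1)[OF n])
  have "order (quotient (normalizer_of L) L) = p ^ a * m"
    using quotient_group(6)[OF n] w card_subgroup_pos[OF L] by simp
  then obtain H where H: "subgroup H (quotient (normalizer_of L) L)" "card H = p ^ a"
    using sylow_thm[OF p Q.is_group _ Q.fin] by blast
  define Q where "Q = {u \<in> normalizer_of L. L #> u \<in> H}"
  have Q: "subgroup Q G" "L \<subseteq> Q" "Q \<subseteq> normalizer_of L" unfolding Q_def using quotient_preimage[OF n H(1)] by auto
  have nQ: "normal_in L Q" unfolding normal_in_def using Q L n unfolding normal_in_def by blast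
  have "carrier (quotient Q L) = H"
  proof
    show "carrier (quotient Q L) \<subseteq> H" unfolding quotient_group(3)[OF nQ] unfolding Q_def by auto
    show "H \<subseteq> carrier (quotient Q L)"
      using subgroup.subset[OF H(1)] unfolding quotient_group(3)[OF nQ] quotient_group(3)[OF n] unfolding Q_def by blast
  qed
  then have "order (quotient Q L) = p ^ a" using H(2) unfolding order_def by simp
  then show ?thesis using that[OF nQ Q(3)] quotient_group(6)[OF nQ] by simp
qed

text \<open>Descent from large subgroups to small ones. At L the recursion puts t = x L times w into
  \<open>R\<close>, where w = |N_G(L) : L|, and t must be shown divisible by w. A prime of w outside
  \<pi> is a unit of \<open>R\<close>. For p in \<pi>, choose Q over L such that Q/L is a Sylow
  p-subgroup of N_G(L)/L. For q in Q outside L, the subgroup generated by q and L reaches L and so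
  has mark m L. The orbit congruence for Q then yields the factor p^a.\<close>

lemma of_marks_integral:
  assumes m: "conj_inv m" "\<And>U. m U \<in> R" and mr: "\<And>U N. subgroup U G \<Longrightarrow> reach \<pi> U N \<Longrightarrow> m U = m N"
  shows "S.of_marks m U \<in> R"
proof -
  let ?x = "S.of_marks m"
  have xs: "?x \<in> burnside_space G"
    unfolding burnside_space_eq using m(1) unfolding conj_inv_def by (intro S.of_marks_fspace) simp
  have xm: "S.fmark ?x L = m L" if "subgroup L G" for L using S.fmark_of_marks[of L m] that by simp
  show ?thesis
  proof (cases "U \<in> {U. subgroup U G}")
    case False
    then have "?x U = 0" using xs unfolding burnside_space_def by blast
    then show ?thesis using R(1) by simp
  next
    case True
    then show ?thesis
    proof (induction rule: S.F_top_induct)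
      case (step L)
      have L: "subgroup L G" using step(1) by simp
      have sL: "L \<subseteq> carrier G" using subgroup.subset[OF L] .
      have IH: "?x M \<in> R" if "subgroup M G" "L \<subset> M" for M using step(2)[of M] that by simp
      obtain w where w: "card (normalizer_of L) = w * card L" "S.weight L = (of_nat w :: 'k)" using weight_int[OF L] .
      define t where "t = ?x L * of_nat w"
      have rec: "m L = t + (\<Sum>M\<in>{M \<in> {U. subgroup U G}. L \<subset> M}. ?x M * S.weight M)"
        using S.fmark_rec[OF step(1), of ?x] xm[OF L] unfolding t_def w(2) by simp
      have "(\<Sum>M\<in>{M \<in> {U. subgroup U G}. L \<subset> M}. ?x M * S.weight M) \<in> R"
      proof (rule R_sum)
        fix M assume M: "M \<in> {M \<in> {U. subgroup U G}. L \<subset> M}"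
        then have sgM: "subgroup M G" by simp
        obtain v where "S.weight M = (of_nat v :: 'k)" using weight_int[OF sgM] by metis
        then show "?x M * S.weight M \<in> R" using R(5)[OF IH R_nat] M by simp
      qed
      then have "m L - (\<Sum>M\<in>{M \<in> {U. subgroup U G}. L \<subset> M}. ?x M * S.weight M) \<in> R" by (rule R_diff[OF m(2)])
      then have tR: "t \<in> R" using rec by simp
      \<comment> \<open>The part of x on subgroups strictly above some conjugate of L. Its
        coefficients lie in \<open>R\<close> by induction, whereas that of x at L is still in
        question; admitting all conjugates of L keeps it a class function.\<close>
      define y where "y = (\<lambda>M. if subgroup M G \<and> (\<exists>g\<in>carrier G. conj_img G g L \<subset> M) then ?x M else 0)"
      have yR: "y M \<in> R" for M
      proof (cases "subgroup M G \<and> (\<exists>g\<in>carrier G. conj_img G g L \<subset> M)")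
        case True
        then obtain g where g: "g \<in> carrier G" "conj_img G g L \<subset> M" and M: "subgroup M G" by blast
        have sM: "M \<subseteq> carrier G" using subgroup.subset[OF M] .
        have ig: "inv g \<in> carrier G" using g by simp
        have "L \<subseteq> conj_img G (inv g) M"
          using conj_img_mono[of "conj_img G g L" M "inv g"] conj_img_cancel(1)[OF sL g(1)] g(2) by auto
        moreover have "L \<noteq> conj_img G (inv g) M" using conj_img_cancel(2)[OF sM g(1)] g(2) by auto
        ultimately have "?x (conj_img G (inv g) M) \<in> R" using IH[OF conj_img_subgroup[OF M ig]] by blast
        moreover have "?x M = ?x (conj_img G (inv g) M)"
          using xs conjugateI[OF M ig] unfolding burnside_space_def by blast
        ultimately show ?thesis unfolding y_def using R(1) by simp
      next
        case False
        then have "y M = 0" unfolding y_def by (rule if_not_P)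
        then show ?thesis using R(1) by simp
      qed
      have ys: "y \<in> burnside_space G"
      proof -
        have "y M = y M'" if c: "conjugate G M M'" for M M'
        proof -
          have up: "\<exists>g\<in>carrier G. conj_img G g L \<subset> N'" if c: "conjugate G N N'" and e: "\<exists>g\<in>carrier G. conj_img G g L \<subset> N" for N N'
          proof -
            obtain g h where g: "g \<in> carrier G" "conj_img G g L \<subset> N" and h: "h \<in> carrier G" "N' = conj_img G h N"
              using c e unfolding conjugate_def by auto
            have sN: "N \<subseteq> carrier G" using conjugate_subgroup(1)[OF c] subgroup.subset by blast
            have cg: "conj_img G g L \<subseteq> carrier G" using g sN by auto
            have "conj_img G h (conj_img G g L) \<subseteq> N'" unfolding h(2) using conj_img_mono g(2) by (simp add: psubset_eq)
            moreover have "conj_img G h (conj_img G g L) \<noteq> N'"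
              unfolding h(2) using conj_img_cancel(1)[OF cg h(1)] conj_img_cancel(1)[OF sN h(1)] g(2) by (metis psubset_eq)
            ultimately show ?thesis using conj_img_mult[OF sL h(1) g(1)] g(1) h(1) by (metis m_closed psubset_eq)
          qed
          have "?x M = ?x M'" using xs c unfolding burnside_space_def by blast
          then show ?thesis unfolding y_def using up[OF c] up[OF conjugate_sym[OF c]] conjugate_subgroup[OF c] by auto
        qed
        then show ?thesis unfolding burnside_space_def y_def by auto
      qed
      have yx: "y M = ?x M" if "subgroup M G" "L \<subset> M" for M
        unfolding y_def using that conj_img_one[OF sL] by (metis one_closed)
      have yL: "y L = 0"
      proof -
        have "\<not> conj_img G g L \<subset> L" if "g \<in> carrier G" for g
          using psubset_card_mono[OF fin_subgroup[OF L], of "conj_img G g L"] card_conj_img[OF sL that] by auto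
        then show ?thesis unfolding y_def by auto
      qed
      have fyL: "S.fmark y L = m L - t"
      proof -
        have "S.fmark y L = (\<Sum>M\<in>{M \<in> {U. subgroup U G}. L \<subset> M}. y M * S.weight M)"
          using S.fmark_rec[OF step(1), of y] yL by simp
        also have "\<dots> = (\<Sum>M\<in>{M \<in> {U. subgroup U G}. L \<subset> M}. ?x M * S.weight M)"
          using yx by (intro sum.cong) auto
        finally show ?thesis using rec by simp
      qed
      have w0: "w \<noteq> 0" using w(1) card_subgroup_pos[OF normalizer_of_subgroup[OF sL]] by auto
      have "\<exists>r\<in>R. t = of_nat w * r"
      proof (rule prime_powers_divide[OF w0 _ tR])
        fix p assume p: "prime p" "p dvd w"
        define a where "a = multiplicity p w"
        obtain k where k: "w = p ^ a * k" using multiplicity_dvd[of p w] unfolding a_def by blast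
        show "\<exists>r\<in>R. t = of_nat (p ^ multiplicity p w) * r"
        proof (cases "p \<in> \<pi>")
          case False
          have "w dvd order G" using w(1) card_subgroup_dvd[OF normalizer_of_subgroup[OF sL]] by (metis dvd_mult_left)
          then have "p dvd order G" using p by auto
          then obtain r where r: "r \<in> R" "of_nat p * r = 1" using False p unfolding pi_def by blast
          have "of_nat (p ^ multiplicity p w) * (r ^ multiplicity p w * t) = (of_nat p * r) ^ multiplicity p w * t"
            by (simp add: power_mult_distrib)
          then show ?thesis using r R(5)[OF R_power tR] by (metis mult_1 power_one)
        next
          case True
          obtain Q where Q: "normal_in L Q" "Q \<subseteq> normalizer_of L" "card Q = p ^ a * card L"
            using exists_p_extension[OF L _ p(1), of a k] w(1) k by auto
          have sgQ: "subgroup Q G" using Q(1) unfolding normal_in_def by auto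
          have ins: "S.fmark y (insert q L) = m L" if q: "q \<in> Q" "q \<notin> L" for q
          proof -
            define H where "H = generate G (insert q L)"
            have H: "subgroup H G" "reach \<pi> H L" using reach_cyclic[OF Q(1,3) p(1) True q(1)] unfolding H_def by auto
            have iH: "insert q L \<subseteq> M \<longleftrightarrow> H \<subseteq> M" if M: "subgroup M G" for M
            proof
              assume "insert q L \<subseteq> M" then show "H \<subseteq> M" unfolding H_def using generate_subgroup_incl M by blast
            next
              have "insert q L \<subseteq> H" unfolding H_def by (rule subsetI, rule generate.incl)
              then show "H \<subseteq> M \<Longrightarrow> insert q L \<subseteq> M" by blast
            qed
            have "S.fmark y (insert q L) = S.fmark ?x H"
              unfolding S.fmark_def
            proof (rule sum.cong)
              show "{M \<in> {U. subgroup U G}. insert q L \<subseteq> M} = {M \<in> {U. subgroup U G}. H \<subseteq> M}" using iH by blast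
              fix M assume "M \<in> {M \<in> {U. subgroup U G}. H \<subseteq> M}"
              then have M: "subgroup M G" "insert q L \<subseteq> M" using iH by auto
              then have "L \<subset> M" using q by auto
              then show "y M * S.weight M = ?x M * S.weight M" using yx M by simp
            qed
            then show ?thesis using xm[OF H(1)] mr[OF H] by simp
          qed
          obtain r where r: "r \<in> R" "of_nat (card L) * S.fmark y L + (of_nat (card Q) - of_nat (card L)) * m L = of_nat (card Q) * r"
            using sum_fmark_normal[OF ys yR Q(1) ins] by blast
          \<comment> \<open>The congruence reads |L| (m L - t) + (|Q| - |L|) m L = |Q| r, and |Q| =
            p^a |L|.\<close>
          have "of_nat (card L) * t = of_nat (card L) * (of_nat (p ^ a) * (m L - r))"
            using r(2) unfolding fyL Q(3) by (simp add: algebra_simps)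
          then have "t = of_nat (p ^ a) * (m L - r)" using mult_left_cancel[OF S.card_subgroup_nz[OF L]] by blast
          then show ?thesis unfolding a_def using R_diff[OF m(2) r(1)] by blast
        qed
      qed
      then obtain r where r: "r \<in> R" "?x L * of_nat w = of_nat w * r" unfolding t_def by blast
      have "(of_nat w :: 'k) \<noteq> 0" using S.weight_nz[OF step(1)] w(2) by simp
      then have "?x L = r" using r(2) by (simp add: mult.commute)
      then show ?case using r(1) by simp
    qed
  qed
qed

end

section \<open>Central idempotents\<close>

context fin_group
begin

lemma bifree_iso:
  assumes L: "bifree G L"
  shows "G\<lparr>carrier := Domain L\<rparr> \<cong> G\<lparr>carrier := Range L\<rparr>"
proof -
  note D = GG_subgroupD[OF bifree_subgroup[OF L]]
  have sv: "(a, b) \<in> L \<Longrightarrow> (a, b') \<in> L \<Longrightarrow> b = b'" "(a, b) \<in> L \<Longrightarrow> (a', b) \<in> L \<Longrightarrow> a = a'" for a b a' b'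
    using L unfolding bifree_iff by blast+
  define \<phi> where "\<phi> = (\<lambda>a. THE b. (a, b) \<in> L)"
  have \<phi>: "\<phi> a = b" if "(a, b) \<in> L" for a b
    unfolding \<phi>_def using that sv(1) by (intro the_equality) auto
  have \<phi>': "(a, \<phi> a) \<in> L" if "a \<in> Domain L" for a using that \<phi> by auto
  have "\<phi> \<in> iso (G\<lparr>carrier := Domain L\<rparr>) (G\<lparr>carrier := Range L\<rparr>)"
    unfolding iso_def hom_def
  proof (intro CollectI conjI)
    show "bij_betw \<phi> (carrier (G\<lparr>carrier := Domain L\<rparr>)) (carrier (G\<lparr>carrier := Range L\<rparr>))"
      unfolding bij_betw_def
    proof
      show "inj_on \<phi> (carrier (G\<lparr>carrier := Domain L\<rparr>))"
      proof (rule inj_onI)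
        fix a a' assume "a \<in> carrier (G\<lparr>carrier := Domain L\<rparr>)" "a' \<in> carrier (G\<lparr>carrier := Domain L\<rparr>)" "\<phi> a = \<phi> a'"
        then have "(a, \<phi> a) \<in> L" "(a', \<phi> a) \<in> L" using \<phi>'[of a] \<phi>'[of a'] by simp_all
        then show "a = a'" by (rule sv(2))
      qed
      show "\<phi> ` carrier (G\<lparr>carrier := Domain L\<rparr>) = carrier (G\<lparr>carrier := Range L\<rparr>)"
        using \<phi> \<phi>' by (force simp: image_iff)
    qed
    show "\<phi> \<in> carrier (G\<lparr>carrier := Domain L\<rparr>) \<rightarrow> carrier (G\<lparr>carrier := Range L\<rparr>)" using \<phi>' by auto
    show "\<forall>x\<in>carrier (G\<lparr>carrier := Domain L\<rparr>). \<forall>y\<in>carrier (G\<lparr>carrier := Domain L\<rparr>).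
      \<phi> (x \<otimes>\<^bsub>G\<lparr>carrier := Domain L\<rparr>\<^esub> y) = \<phi> x \<otimes>\<^bsub>G\<lparr>carrier := Range L\<rparr>\<^esub> \<phi> y"
      using \<phi> D(4)[OF \<phi>' \<phi>'] by simp
  qed
  then show ?thesis unfolding is_iso_def by blast
qed

text \<open>The graph of the isomorphism; this makes invariance along bifree subgroups the same as
  invariance under isomorphism.\<close>

lemma iso_bifree:
  assumes U: "subgroup U G" and V: "subgroup V G" and i: "G\<lparr>carrier := U\<rparr> \<cong> G\<lparr>carrier := V\<rparr>"
  obtains L where "bifree G L" "Domain L = U" "Range L = V"
proof -
  obtain \<phi> where \<phi>: "\<phi> \<in> iso (G\<lparr>carrier := U\<rparr>) (G\<lparr>carrier := V\<rparr>)" using i unfolding is_iso_def by blast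
  interpret GU: group "G\<lparr>carrier := U\<rparr>" using subgroup.subgroup_is_group[OF U is_group] .
  interpret GV: group "G\<lparr>carrier := V\<rparr>" using subgroup.subgroup_is_group[OF V is_group] .
  interpret h: group_hom "G\<lparr>carrier := U\<rparr>" "G\<lparr>carrier := V\<rparr>" \<phi>
    unfolding group_hom_def group_hom_axioms_def using \<phi> GU.is_group GV.is_group unfolding iso_def by simp
  have b: "bij_betw \<phi> U V" using \<phi> unfolding iso_def by simp
  have mem: "\<phi> u \<in> V" if "u \<in> U" for u using h.hom_closed[of u] that by simp
  have mul: "\<phi> (u \<otimes> v) = \<phi> u \<otimes> \<phi> v" if "u \<in> U" "v \<in> U" for u v using h.hom_mult[of u v] that by simp
  have one: "\<phi> \<one> = \<one>" using h.hom_one by simp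
  have iv: "\<phi> (inv u) = inv (\<phi> u)" if "u \<in> U" for u
    using h.hom_inv[of u] that m_inv_consistent[OF U that] m_inv_consistent[OF V mem[OF that]] by simp
  define L where "L = (\<lambda>u. (u, \<phi> u)) ` U"
  have sg: "subgroup L GG"
  proof (rule GG_subgroupI)
    show "L \<subseteq> carrier G \<times> carrier G" unfolding L_def using subgroup.subset[OF U] subgroup.subset[OF V] mem by auto
    show "(\<one>, \<one>) \<in> L" unfolding L_def using one subgroup.one_closed[OF U] by force
    show "(a \<otimes> c, b \<otimes> d) \<in> L" if "(a, b) \<in> L" "(c, d) \<in> L" for a b c d
      using that mul subgroup.m_closed[OF U] unfolding L_def by auto
    show "(inv a, inv b) \<in> L" if "(a, b) \<in> L" for a b
      using that iv subgroup.m_inv_closed[OF U] unfolding L_def by auto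
  qed
  have inj: "u = v" if "u \<in> U" "v \<in> U" "\<phi> u = \<phi> v" for u v using b that unfolding bij_betw_def inj_on_def by blast
  have "bifree G L" unfolding bifree_iff using sg inj unfolding L_def by auto
  moreover have "Domain L = U" unfolding L_def by force
  moreover have "Range L = \<phi> ` U" unfolding L_def by force
  moreover have "\<phi> ` U = V" using b unfolding bij_betw_def by simp
  ultimately show ?thesis using that by simp
qed

lemma Image_subgroup:
  assumes L: "bifree G L" and N: "subgroup N G" "N \<subseteq> Domain L"
  shows "bifree G {(a, b). (a, b) \<in> L \<and> a \<in> N}" "Domain {(a, b). (a, b) \<in> L \<and> a \<in> N} = N"
    "Range {(a, b). (a, b) \<in> L \<and> a \<in> N} = L `` N" "subgroup (L `` N) G" "card (L `` N) = card N"
proof -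
  let ?L = "{(a, b). (a, b) \<in> L \<and> a \<in> N}"
  note D = GG_subgroupD[OF bifree_subgroup[OF L]]
  have sv: "(a, b) \<in> L \<Longrightarrow> (a, b') \<in> L \<Longrightarrow> b = b'" "(a, b) \<in> L \<Longrightarrow> (a', b) \<in> L \<Longrightarrow> a = a'" for a b a' b'
    using L unfolding bifree_iff by blast+
  have "subgroup ?L GG"
    by (rule GG_subgroupI) (use D subgroup.one_closed[OF N(1)] subgroup.m_closed[OF N(1)] subgroup.m_inv_closed[OF N(1)] in auto)
  then show bf: "bifree G ?L" using bifree_mono[OF L, of ?L] by auto
  show dom: "Domain ?L = N" using N(2) by blast
  show rng: "Range ?L = L `` N" by blast
  show "subgroup (L `` N) G" using Range_subgroup[OF bifree_subgroup[OF bf]] unfolding rng .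
  have "inj_on fst ?L" "inj_on snd ?L" unfolding inj_on_def using sv by auto
  then have "card (fst ` ?L) = card (snd ` ?L)" by (simp add: card_image)
  then show "card (L `` N) = card N" unfolding rng[symmetric] using dom by (simp add: Domain_fst Range_snd)
qed

lemma step_iso:
  assumes L: "bifree G L" and s: "prime_step \<pi> U N" and U: "U \<subseteq> Domain L"
  shows "prime_step \<pi> (L `` U) (L `` N)"
proof -
  have sU: "subgroup U G" and sN: "subgroup N G" "N \<subseteq> U" and nn: "\<And>u m. u \<in> U \<Longrightarrow> m \<in> N \<Longrightarrow> u \<otimes> m \<otimes> inv u \<in> N"
    using s unfolding prime_step_def normal_in_def by auto
  have ND: "N \<subseteq> Domain L" using sN U by auto
  note D = GG_subgroupD[OF bifree_subgroup[OF L]]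
  have "normal_in (L `` N) (L `` U)" unfolding normal_in_def
  proof (intro conjI ballI)
    show "subgroup (L `` U) G" using Image_subgroup(4)[OF L sU U] .
    show "subgroup (L `` N) G" using Image_subgroup(4)[OF L sN(1) ND] .
    show "L `` N \<subseteq> L `` U" using sN by auto
    fix v n assume "v \<in> L `` U" "n \<in> L `` N"
    then obtain u m where um: "u \<in> U" "(u, v) \<in> L" "m \<in> N" "(m, n) \<in> L" by auto
    have "(u \<otimes> m \<otimes> inv u, v \<otimes> n \<otimes> inv v) \<in> L" using D(4)[OF D(4)[OF um(2,4)] D(5)[OF um(2)]] .
    then show "v \<otimes> n \<otimes> inv v \<in> L `` N" using nn[OF um(1,3)] by blast
  qed
  then show ?thesis using s unfolding prime_step_def Image_subgroup(5)[OF L sU U] Image_subgroup(5)[OF L sN(1) ND] by blast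
qed

lemma reach_iso:
  assumes "reach \<pi> U N" "bifree G L" "subgroup U G" "U \<subseteq> Domain L"
  shows "reach \<pi> (L `` U) (L `` N)"
  using assms
proof (induction rule: rtranclp_induct)
  case (step M N)
  have "M \<subseteq> Domain L" using reach_subgroup[OF step(1,5)] step(6) by auto
  then have "prime_step \<pi> (L `` M) (L `` N)" using step_iso[OF step(4,2)] by simp
  then show ?case using step.IH[OF step(4-6)] by (metis rtranclp.rtrancl_into_rtrancl)
qed simp

text \<open>An isomorphism carries chains to chains, so the image of the residual of the source
  contains the residual of the target. The inverse isomorphism gives the other inclusion.\<close>

lemma pi_residual_iso:
  assumes L: "bifree G L"
  shows "G\<lparr>carrier := pi_residual G \<pi> (Domain L)\<rparr> \<cong> G\<lparr>carrier := pi_residual G \<pi> (Range L)\<rparr>"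
proof -
  have sub: "pi_residual G \<pi> (Range L) \<subseteq> L `` (pi_residual G \<pi> (Domain L))" if L: "bifree G L" for L
  proof -
    have d: "subgroup (Domain L) G" "subgroup (Range L) G"
      using Domain_subgroup Range_subgroup bifree_subgroup[OF L] by auto
    have "reach \<pi> (L `` Domain L) (L `` pi_residual G \<pi> (Domain L))"
      using reach_iso[OF pi_residual_least(1)[OF d(1)] L d(1)] by simp
    moreover have "L `` Domain L = Range L" by blast
    ultimately show ?thesis using pi_residual_least(2)[OF d(2)] by metis
  qed
  have sv: "(a, b) \<in> L \<Longrightarrow> (a, b') \<in> L \<Longrightarrow> b = b'" for a b b' using L unfolding bifree_iff by blast
  have "pi_residual G \<pi> (Domain L) \<subseteq> L\<inverse> `` (pi_residual G \<pi> (Range L))"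
    using sub[OF bifree_converse[OF L]] by simp
  then have "L `` (pi_residual G \<pi> (Domain L)) \<subseteq> pi_residual G \<pi> (Range L)" using sv by blast
  then have eq: "L `` (pi_residual G \<pi> (Domain L)) = pi_residual G \<pi> (Range L)" using sub[OF L] by blast
  have d: "subgroup (Domain L) G" using Domain_subgroup bifree_subgroup[OF L] by auto
  have r: "subgroup (pi_residual G \<pi> (Domain L)) G" "pi_residual G \<pi> (Domain L) \<subseteq> Domain L"
    using reach_subgroup[OF pi_residual_least(1)[OF d] d] by auto
  show ?thesis using bifree_iso[OF Image_subgroup(1)[OF L r]] unfolding Image_subgroup(2,3)[OF L r] eq .
qed

lemma conjugate_iso:
  assumes "conjugate G U V" shows "G\<lparr>carrier := U\<rparr> \<cong> G\<lparr>carrier := V\<rparr>"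
proof -
  obtain g where g: "subgroup U G" "g \<in> carrier G" "V = conj_img G g U" using assms unfolding conjugate_def by auto
  show ?thesis using bifree_iso[OF conj_graph_bifree[OF g(1,2)]] Range_conj_graph[of g U] g(3) by simp
qed

lemma subgroup_iso_sym:
  assumes "subgroup U G" "G\<lparr>carrier := U\<rparr> \<cong> G\<lparr>carrier := V\<rparr>"
  shows "G\<lparr>carrier := V\<rparr> \<cong> G\<lparr>carrier := U\<rparr>"
  using group.iso_sym[OF subgroup.subgroup_is_group[OF assms(1) is_group] assms(2)] .

end

section \<open>Central idempotents as images of elements with marks 0 and 1\<close>

context integral_burnside
begin

definition iso_inv :: "('a set \<Rightarrow> 'k) \<Rightarrow> bool" where
  "iso_inv m \<longleftrightarrow> (\<forall>L. bifree G L \<longrightarrow> m (Domain L) = m (Range L))"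

definition reach_inv :: "('a set \<Rightarrow> 'k) \<Rightarrow> bool" where
  "reach_inv m \<longleftrightarrow> (\<forall>U N. subgroup U G \<longrightarrow> reach \<pi> U N \<longrightarrow> m U = m N)"

definition central_idempotent :: "(('a \<times> 'a) set \<Rightarrow> 'k) \<Rightarrow> bool" where
  "central_idempotent e \<longleftrightarrow> e \<in> bd_center G R \<and> bd_idem G e"

lemma iso_inv_conj_inv: "iso_inv m \<Longrightarrow> conj_inv m"
  unfolding iso_inv_def conj_inv_def by (metis Domain_conj_graph Range_conj_graph conj_graph_bifree)

lemma of_marks_burnside: "conj_inv m \<Longrightarrow> S.of_marks m \<in> burnside_space G"
  unfolding burnside_space_eq conj_inv_def by (intro S.of_marks_fspace) simp

lemma ghost_Delta_of_marks:
  assumes "conj_inv m" "bifree G L"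
  shows "ghost (Delta G (S.of_marks m)) L = ghost_one L * m (Domain L)"
proof -
  have "Domain L \<in> {U. subgroup U G}" using Domain_subgroup[OF bifree_subgroup[OF assms(2)]] by simp
  then show ?thesis using ghost_Delta[OF of_marks_burnside[OF assms(1)] assms(2)] S.fmark_of_marks by simp
qed

lemma ghost_mult_cong:
  assumes "bifree G L" "\<And>A. bifree G A \<Longrightarrow> f A = f' A" "\<And>A. bifree G A \<Longrightarrow> h A = h' A"
  shows "ghost_mult f h L = ghost_mult f' h' L"
  unfolding ghost_mult_def
proof (rule sum.cong[OF refl])
  fix A assume "A \<in> same_dom L"
  then have A: "bifree G A" unfolding same_dom_def by simp
  show "f A * h (A\<inverse> O L) = f' A * h' (A\<inverse> O L)"
    using assms(2)[OF A] assms(3)[OF bifree_comp[OF bifree_converse[OF A] assms(1)]] by simp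
qed

text \<open>Left multiplication scales the coordinate at L by the mark at its source, right
  multiplication by the mark at its target. Comparing the two is the criterion for
  centrality.\<close>

lemma Delta_mult_left:
  assumes "conj_inv m" "b \<in> bd_space G" "bifree G L"
  shows "ghost (bd_mult G (Delta G (S.of_marks m)) b) L = m (Domain L) * ghost b L"
  using ghost_mult[OF Delta_space[OF of_marks_burnside[OF assms(1)]] assms(2,3)]
    ghost_mult_cong[OF assms(3) ghost_Delta_of_marks[OF assms(1)] refl] ghost_mult_one_left[OF ghost_class_fun[OF assms(2)] assms(3)] by simp

lemma Delta_mult_right:
  assumes "conj_inv m" "b \<in> bd_space G" "bifree G L"
  shows "ghost (bd_mult G b (Delta G (S.of_marks m))) L = ghost b L * m (Range L)"
  using ghost_mult[OF assms(2) Delta_space[OF of_marks_burnside[OF assms(1)]] assms(3)]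
    ghost_mult_cong[OF assms(3) refl ghost_Delta_of_marks[OF assms(1)]] ghost_mult_one_right[OF ghost_class_fun[OF assms(2)] assms(1,3)] by simp

lemma Delta_mult:
  assumes "conj_inv m" "conj_inv m'" "bifree G L"
  shows "ghost (bd_mult G (Delta G (S.of_marks m)) (Delta G (S.of_marks m'))) L = ghost_one L * (m (Domain L) * m' (Domain L))"
  using Delta_mult_left[OF assms(1) Delta_space[OF of_marks_burnside[OF assms(2)]] assms(3)]
    ghost_Delta_of_marks[OF assms(2,3)] by simp

text \<open>Equal marks at source and target give centrality, the values 0 and 1 give idempotency,
  and constancy along chains gives coefficients in \<open>R\<close>.\<close>

lemma central_idempotent_Delta:
  assumes iso: "iso_inv m" and ri: "reach_inv m" and v: "\<And>U. m U \<in> {0, 1}"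
  shows "central_idempotent (Delta G (S.of_marks m))"
proof -
  have ci: "conj_inv m" using iso_inv_conj_inv[OF iso] .
  have mR: "m U \<in> R" for U using v[of U] R(1,2) by auto
  have xR: "S.of_marks m U \<in> R" for U
    using of_marks_integral[OF ci mR] ri unfolding reach_inv_def by blast
  have D: "Delta G (S.of_marks m) \<in> bd_R G R"
    unfolding bd_R_def using Delta_space[OF of_marks_burnside[OF ci]] xR R(1) by (auto simp: Delta_def)
  have "bd_mult G (Delta G (S.of_marks m)) b = bd_mult G b (Delta G (S.of_marks m))" if b: "b \<in> bd_R G R" for b
  proof (rule ghost_inj[OF bd_mult_space bd_mult_space])
    have bs: "b \<in> bd_space G" using b unfolding bd_R_def by simp
    show "ghost (bd_mult G (Delta G (S.of_marks m)) b) L = ghost (bd_mult G b (Delta G (S.of_marks m))) L" if L: "bifree G L" for L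
      using Delta_mult_left[OF ci bs L] Delta_mult_right[OF ci bs L] iso L unfolding iso_inv_def by (simp add: mult.commute)
  qed
  moreover have "bd_mult G (Delta G (S.of_marks m)) (Delta G (S.of_marks m)) = Delta G (S.of_marks m)"
  proof (rule ghost_inj[OF bd_mult_space Delta_space[OF of_marks_burnside[OF ci]]])
    show "ghost (bd_mult G (Delta G (S.of_marks m)) (Delta G (S.of_marks m))) L = ghost (Delta G (S.of_marks m)) L" if L: "bifree G L" for L
      using Delta_mult[OF ci ci L] ghost_Delta_of_marks[OF ci L] v[of "Domain L"] by auto
  qed
  ultimately show ?thesis unfolding central_idempotent_def bd_center_def bd_idem_def using D by blast
qed

lemma common_denominator:
  assumes "finite A" shows "\<exists>d\<in>R. d \<noteq> 0 \<and> (\<forall>a\<in>A. d * a \<in> R)"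
  using assms
proof induction
  case empty
  show ?case using R(2) by (intro bexI[of _ 1]) auto
next
  case (insert x A)
  then obtain d where d: "d \<in> R" "d \<noteq> 0" "\<forall>a\<in>A. d * a \<in> R" by blast
  obtain a b where ab: "a \<in> R" "b \<in> R" "b \<noteq> 0" "x = a / b" using frac by blast
  have "d * b * x \<in> R" using ab d R(5) by simp
  moreover have "d * b * c \<in> R" if "c \<in> A" for c
    using R(5)[OF ab(2), of "d * c"] d(3) that by (simp add: mult.assoc mult.left_commute)
  ultimately show ?case using d ab R(5) by (intro bexI[of _ "d * b"]) auto
qed

lemma ghost_scale: "ghost (\<lambda>L. d * b L) L = d * ghost b L"
  unfolding ghost_def D.fmark_def by (simp add: sum_distrib_left mult.assoc)

lemma ghost_mult_scale: "ghost_mult f (\<lambda>L. d * h L) L = d * ghost_mult f h L" "ghost_mult (\<lambda>L. d * f L) h L = d * ghost_mult f h L"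
  unfolding ghost_mult_def by (simp_all add: sum_distrib_left mult.assoc mult.left_commute)

text \<open>There are only finitely many bifree subgroups, so some nonzero d in \<open>R\<close>
  moves all coefficients of b into \<open>R\<close>; it cancels at the end.\<close>

lemma center_commute:
  assumes e: "e \<in> bd_center G R" and b: "b \<in> bd_space G" and L: "bifree G L"
  shows "ghost_mult (ghost e) (ghost b) L = ghost_mult (ghost b) (ghost e) L"
proof -
  have es: "e \<in> bd_space G" using e unfolding bd_center_def bd_R_def by simp
  obtain d where d: "d \<in> R" "d \<noteq> 0" "\<forall>a\<in>b ` {L. bifree G L}. d * a \<in> R"
    using common_denominator[of "b ` {L. bifree G L}"] fin_bifree by blast
  let ?b = "\<lambda>L. d * b L"
  have bs: "?b \<in> bd_space G" using b unfolding bd_space_def by auto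
  have "?b L \<in> R" for L
  proof (cases "bifree G L")
    case False
    then have "b L = 0" using b unfolding bd_space_def by blast
    then show ?thesis using R(1) by simp
  qed (use d in simp)
  then have "?b \<in> bd_R G R" unfolding bd_R_def using bs by simp
  then have "bd_mult G e ?b = bd_mult G ?b e" using e unfolding bd_center_def by blast
  then have "ghost_mult (ghost e) (ghost ?b) L = ghost_mult (ghost ?b) (ghost e) L"
    using ghost_mult[OF es bs L] ghost_mult[OF bs es L] by simp
  then have "d * ghost_mult (ghost e) (ghost b) L = d * ghost_mult (ghost b) (ghost e) L"
    unfolding ghost_scale ghost_mult_scale .
  then show ?thesis using d(2) by simp
qed

lemma ghost_mult_diff: "ghost_mult (\<lambda>L. f L - f' L) h L = ghost_mult f h L - ghost_mult f' h L"
  "ghost_mult f (\<lambda>L. h L - h' L) L = ghost_mult f h L - ghost_mult f h' L"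
  unfolding ghost_mult_def by (simp_all add: algebra_simps sum_subtractf)

text \<open>The vector f of coordinates is determined over each U separately, by the alternative for
  f and the one for its complement. Centrality enters twice: against class indicators in B(G) for
  the support of f, and against the indicator of a single isomorphism class for the equality of
  marks at its two ends.\<close>

lemma central_idempotent_structure:
  assumes ce: "central_idempotent e"
  obtains m where "iso_inv m" "reach_inv m" "\<And>U. m U \<in> {0, 1}" "e = Delta G (S.of_marks m)"
proof -
  have e: "e \<in> bd_center G R" "bd_mult G e e = e" using ce unfolding central_idempotent_def bd_idem_def by auto
  have eR: "e \<in> bd_R G R" using e(1) unfolding bd_center_def by simp
  have es: "e \<in> bd_space G" using eR unfolding bd_R_def by simp
  define f where "f = ghost e"
  have cf: "class_fun f" unfolding f_def using ghost_class_fun[OF es] .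
  have idem: "ghost_mult f f L = f L" if L: "bifree G L" for L
    using ghost_mult[OF es es L] e(2) unfolding f_def by simp
  have comm: "ghost_mult f (ghost b) L = ghost_mult (ghost b) f L" if "b \<in> bd_space G" "bifree G L" for b L
    using center_commute[OF e(1) that] unfolding f_def .
  have supp: "conjugate G (Domain L) (Range L)" if L: "bifree G L" "f L \<noteq> 0" for L
  proof -
    \<comment> \<open>The marks of e_U for U = \<open>Domain L\<close>. Commutation gives f L times
      m at the target = m at the source times f L, and m is 1 at the source.\<close>
    define m where "m = (\<lambda>V. if conjugate G (Domain L) V then 1 else 0 :: 'k)"
    have "conjugate G (Domain L) (conj_img G g V) \<longleftrightarrow> conjugate G (Domain L) V" if "subgroup V G" "g \<in> carrier G" for V g
      using conjugateI[OF that] conjugate_trans conjugate_sym by blast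
    then have ci: "conj_inv m" unfolding conj_inv_def m_def by simp
    have Ds: "Delta G (S.of_marks m) \<in> bd_space G" using Delta_space[OF of_marks_burnside[OF ci]] .
    have "ghost_mult f (ghost (Delta G (S.of_marks m))) L = ghost_mult f (\<lambda>A. ghost_one A * m (Domain A)) L"
      by (rule ghost_mult_cong[OF L(1) refl ghost_Delta_of_marks[OF ci]])
    moreover have "ghost_mult (ghost (Delta G (S.of_marks m))) f L = ghost_mult (\<lambda>A. ghost_one A * m (Domain A)) f L"
      by (rule ghost_mult_cong[OF L(1) ghost_Delta_of_marks[OF ci] refl])
    ultimately have "f L * m (Range L) = m (Domain L) * f L"
      using comm[OF Ds L(1)] ghost_mult_one_right[OF cf ci L(1)] ghost_mult_one_left[OF cf L(1), of m] by metis
    moreover have "m (Domain L) = 1" unfolding m_def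
      using conjugate_refl Domain_subgroup[OF bifree_subgroup[OF L(1)]] by simp
    ultimately have "m (Range L) \<noteq> 0" using L(2) by auto
    then show ?thesis unfolding m_def by (simp split: if_splits)
  qed
  \<comment> \<open>Over U, f will turn out to be either 0 or \<open>ghost_one\<close>, and the
    latter is nonzero at \<open>diag U\<close>; so testing f there reads off the mark.\<close>
  define m where "m = (\<lambda>U. if f (diag U) = 0 then 0 else 1 :: 'k)"
  have v: "m U \<in> {0, 1}" for U unfolding m_def by simp
  \<comment> \<open>The coordinates of 1 - e. When s = 1, the component lemma says nothing about f
    away from \<open>diag U\<close>; applied to f', whose quotient is then 0, it gives f =
    \<open>ghost_one\<close> over U.\<close>
  define f' where "f' = (\<lambda>L. ghost_one L - f L)"
  have cf': "class_fun f'" using cf ghost_one_class_fun unfolding class_fun_def f'_def by simp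
  have idem': "ghost_mult f' f' L = f' L" if L: "bifree G L" for L
  proof -
    have c1: "conj_inv (\<lambda>_. 1)" unfolding conj_inv_def by simp
    have l: "ghost_mult ghost_one h L = h L" if "class_fun h" for h using ghost_mult_one_left[OF that L, of "\<lambda>_. 1"] by simp
    have r: "ghost_mult h ghost_one L = h L" if "class_fun h" for h using ghost_mult_one_right[OF that c1 L] by simp
    show ?thesis unfolding f'_def ghost_mult_diff using l[OF ghost_one_class_fun] l[OF cf] r[OF cf] idem[OF L] by simp
  qed
  have supp': "conjugate G (Domain L) (Range L)" if L: "bifree G L" "f' L \<noteq> 0" for L
  proof (cases "f L = 0")
    case True
    then have "ghost_one L \<noteq> 0" using L unfolding f'_def by simp
    then obtain k where "k \<in> carrier G" "Range L = conj_img G k (Domain L)" using ghost_one_range by blast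
    then show ?thesis using conjugateI[OF Domain_subgroup[OF bifree_subgroup[OF L(1)]]] by simp
  qed (use supp L in simp)
  have fE: "f L = ghost_one L * m (Domain L)" if L: "bifree G L" for L
  proof -
    define U where "U = Domain L"
    have U: "subgroup U G" unfolding U_def using Domain_subgroup[OF bifree_subgroup[OF L]] .
    have c0: "(of_nat (card (centralizer U)) :: 'k) \<noteq> 0"
      using S.card_subgroup_nz[OF centralizer_subgroup[OF subgroup.subset[OF U]]] .
    obtain s where s: "s \<in> R" "D.fmark e (diag U) = of_nat (card (centralizer U)) * s"
      using fmark_diag_integral[OF R(1-3,5) eR U] .
    have fs: "f (diag U) * of_nat (order G) = of_nat (card (centralizer U)) * s"
      unfolding f_def ghost_def using s(2) ord_inv by simp
    have fs': "f' (diag U) * of_nat (order G) = of_nat (card (centralizer U)) * (1 - s)"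
      unfolding f'_def ghost_one_diag[OF U] left_diff_distrib fs using ord_inv by (simp add: algebra_simps)
    have o: "(\<lambda>r. of_nat p * r) ` R \<noteq> {0} \<and> (\<lambda>r. of_nat p * r) ` R \<noteq> R" if "prime p" "p dvd order_Out G U" for p
      using Out[OF U that] .
    have c: "s = 1 \<or> (s = 0 \<and> (\<forall>L. bifree G L \<longrightarrow> Domain L = U \<longrightarrow> f L = 0))"
      by (rule idempotent_component[OF R U o cf idem supp s(1) fs])
    have c': "1 - s = 1 \<or> (1 - s = 0 \<and> (\<forall>L. bifree G L \<longrightarrow> Domain L = U \<longrightarrow> f' L = 0))"
      by (rule idempotent_component[OF R U o cf' idem' supp' R_diff[OF R(2) s(1)] fs'])
    show ?thesis
    proof (cases "s = 1")
      case True
      then have "f' L = 0" using c' L unfolding U_def by auto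
      moreover have "f (diag U) \<noteq> 0" using fs True c0 by auto
      ultimately show ?thesis unfolding f'_def m_def U_def by simp
    next
      case False
      then have "s = 0" "f L = 0" using c L unfolding U_def by auto
      moreover from this have "f (diag U) = 0" using fs ord_inv by simp
      ultimately show ?thesis unfolding m_def U_def by simp
    qed
  qed
  have ci: "conj_inv m" unfolding conj_inv_def
  proof (intro allI impI)
    fix U g assume U: "subgroup U G" and g: "g \<in> carrier G"
    show "m (conj_img G g U) = m U" unfolding m_def using class_fun_diag[OF cf U conjugateI[OF U g]] by simp
  qed
  have iso: "iso_inv m" unfolding iso_inv_def
  proof (intro allI impI)
    fix \<phi> assume \<phi>: "bifree G \<phi>"
    \<comment> \<open>The indicator of the class of \<phi>. Commuting with it compares the marks at
      the source and target of \<phi>, where it takes the value 1.\<close>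
    define h where "h = (\<lambda>L. if conjugate GG \<phi> L then 1 else 0 :: 'k)"
    have ch: "class_fun h" unfolding class_fun_def
    proof (intro allI impI)
      fix L p assume L: "bifree G L" and p: "p \<in> carrier GG"
      have "conjugate GG \<phi> (conj_img GG p L) \<longleftrightarrow> conjugate GG \<phi> L"
        using D.conjugateI[OF bifree_subgroup[OF L] p] D.conjugate_trans D.conjugate_sym by blast
      then show "h (conj_img GG p L) = h L" unfolding h_def by simp
    qed
    obtain b where b: "b \<in> bd_space G" "\<And>L. bifree G L \<Longrightarrow> ghost b L = h L" using ghost_surj[OF ch] by blast
    have "ghost_mult f (ghost b) \<phi> = ghost_mult (\<lambda>A. ghost_one A * m (Domain A)) h \<phi>" by (rule ghost_mult_cong[OF \<phi> fE b(2)])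
    moreover have "ghost_mult (ghost b) f \<phi> = ghost_mult h (\<lambda>A. ghost_one A * m (Domain A)) \<phi>" by (rule ghost_mult_cong[OF \<phi> b(2) fE])
    ultimately have "m (Domain \<phi>) * h \<phi> = h \<phi> * m (Range \<phi>)"
      using comm[OF b(1) \<phi>] ghost_mult_one_left[OF ch \<phi>, of m] ghost_mult_one_right[OF ch ci \<phi>] by metis
    moreover have "h \<phi> = 1" unfolding h_def using D.conjugate_refl[OF bifree_subgroup[OF \<phi>]] by simp
    ultimately show "m (Domain \<phi>) = m (Range \<phi>)" by simp
  qed
  let ?x = "S.of_marks m"
  have xb: "?x \<in> burnside_space G" using of_marks_burnside[OF ci] .
  have eq: "e = Delta G ?x"
  proof (rule ghost_inj[OF es Delta_space[OF xb]])
    fix L assume L: "bifree G L"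
    show "ghost e L = ghost (Delta G ?x) L" using fE[OF L] ghost_Delta_of_marks[OF ci L] unfolding f_def by simp
  qed
  have xR: "?x U \<in> R" for U
  proof (cases "subgroup U G")
    case True
    have "?x U = Delta G ?x (diag U)"
      using Delta_val[OF xb True D.conjugate_refl[OF bifree_subgroup[OF diag_bifree[OF True]]]] by simp
    also have "\<dots> \<in> R" unfolding eq[symmetric] using eR unfolding bd_R_def by simp
    finally show ?thesis .
  next
    case False
    then have "?x U = 0" using xb unfolding burnside_space_def by blast
    then show ?thesis using R(1) by simp
  qed
  have mk: "S.fmark ?x U = m U" if "subgroup U G" for U using S.fmark_of_marks[of U m] that by simp
  have "m U = m N" if "reach \<pi> U N" "subgroup U G" for U N
    using that
  proof (induction rule: rtranclp_induct)
    case (step M N)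
    have sg: "subgroup M G" "subgroup N G" using step(2) unfolding prime_step_def normal_in_def by auto
    have "S.fmark ?x M = S.fmark ?x N"
      by (rule fmark_step[OF xb xR step(2)]) (use mk sg v in auto)
    then show ?case using step.IH[OF step(4)] mk sg by simp
  qed simp
  then have ri: "reach_inv m" unfolding reach_inv_def by blast
  show ?thesis using that[OF iso ri v eq] .
qed

end

section \<open>The primitive central idempotents\<close>

context integral_burnside
begin

text \<open>The mark function of \<open>eps_hat\<close> for W, as \<open>eps_hat_eq\<close> will
  show.\<close>

definition resid_char :: "'a set \<Rightarrow> 'a set \<Rightarrow> 'k" where
  "resid_char W H = (if G\<lparr>carrier := pi_residual G \<pi> H\<rparr> \<cong> G\<lparr>carrier := W\<rparr> then 1 else 0)"

lemma fspace_sum: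
  assumes "\<And>a. a \<in> A \<Longrightarrow> f a \<in> S.fspace"
  shows "(\<lambda>U. \<Sum>a\<in>A. f a U) \<in> S.fspace"
proof -
  have "subgroup U G" if "(\<Sum>a\<in>A. f a U) \<noteq> 0" for U
  proof (rule ccontr)
    assume "\<not> subgroup U G"
    then have "\<forall>a\<in>A. f a U = 0" using assms S.fspace_supp by blast
    then show False using that by simp
  qed
  moreover have "(\<Sum>a\<in>A. f a U) = (\<Sum>a\<in>A. f a V)" if "conjugate G U V" for U V
    using S.fspace_conj[OF assms that] by (rule sum.cong[OF refl])
  ultimately show ?thesis unfolding S.fspace_def by simp
qed

lemma fmark_sum: "S.fmark (\<lambda>U. \<Sum>a\<in>A. f a U) L = (\<Sum>a\<in>A. S.fmark (f a) L)"
  unfolding S.fmark_def by (simp add: sum_distrib_right) (rule sum.swap)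

lemma conj_ind:
  assumes "subgroup U G" shows "conj_inv (\<lambda>H. if conjugate G H U then 1 else 0)"
proof -
  have "conjugate G (conj_img G g H) U \<longleftrightarrow> conjugate G H U" if "subgroup H G" "g \<in> carrier G" for H g
    using conjugateI[OF that] conjugate_trans conjugate_sym by blast
  then show ?thesis unfolding conj_inv_def by simp
qed

text \<open>Existence and uniqueness behind the definite description come from solving the
  triangular system and from injectivity of marks.\<close>

lemma burnside_idem_eq:
  assumes U: "subgroup U G"
  shows "burnside_idem G U = S.of_marks (\<lambda>H. if conjugate G H U then 1 else 0)"
proof -
  let ?m = "\<lambda>H. if conjugate G H U then 1 else 0 :: 'k"
  have xs: "S.of_marks ?m \<in> burnside_space G" using of_marks_burnside[OF conj_ind[OF U]] .
  have mk: "mark G H (S.of_marks ?m) = ?m H" if "subgroup H G" for H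
    unfolding mark_eq[OF xs that] using S.fmark_of_marks[of H ?m] that by blast
  show ?thesis unfolding burnside_idem_def
  proof (rule the_equality)
    show "S.of_marks ?m \<in> burnside_space G \<and> (\<forall>H. subgroup H G \<longrightarrow> mark G H (S.of_marks ?m) = ?m H)"
      using xs mk by blast
    fix y :: "'a set \<Rightarrow> 'k" assume y: "y \<in> burnside_space G \<and> (\<forall>H. subgroup H G \<longrightarrow> mark G H y = ?m H)"
    then have ys: "y \<in> burnside_space G" by blast
    show "y = S.of_marks ?m"
    proof (rule S.fmark_inj)
      show "y \<in> S.fspace" "S.of_marks ?m \<in> S.fspace" using ys xs unfolding burnside_space_eq by auto
      fix L assume "L \<in> {U. subgroup U G}"
      then have L: "subgroup L G" by simp
      show "S.fmark y L = S.fmark (S.of_marks ?m) L"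
        using y mk[OF L] L mark_eq[OF ys L] mark_eq[OF xs L] by simp
    qed
  qed
qed

lemma resid_char_iso_inv: "iso_inv (resid_char W)"
  unfolding iso_inv_def
proof (intro allI impI)
  fix L assume L: "bifree G L"
  have d: "subgroup (Domain L) G" "subgroup (Range L) G"
    using Domain_subgroup Range_subgroup bifree_subgroup[OF L] by auto
  have i: "G\<lparr>carrier := pi_residual G \<pi> (Domain L)\<rparr> \<cong> G\<lparr>carrier := pi_residual G \<pi> (Range L)\<rparr>"
    using pi_residual_iso[OF L] .
  have i': "G\<lparr>carrier := pi_residual G \<pi> (Range L)\<rparr> \<cong> G\<lparr>carrier := pi_residual G \<pi> (Domain L)\<rparr>"
    using subgroup_iso_sym[OF pi_residual_subgroup[OF d(1)] i] .
  show "resid_char W (Domain L) = resid_char W (Range L)"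
    unfolding resid_char_def using iso_trans[OF i] iso_trans[OF i'] by metis
qed

lemma resid_char_reach_inv: "reach_inv (resid_char W)"
  unfolding reach_inv_def resid_char_def using pi_residual_reach by simp

text \<open>At H both sums collapse. Among the e_V' only the one for the representative V0 of H has
  a nonzero mark at H, and it occurs only in the summand of the representative V1 of the residual of
  H. So the mark is 1 or 0 according to whether V1 is isomorphic to W.\<close>

lemma eps_hat_eq:
  assumes Sig: "\<forall>U\<in>Sig. subgroup U G" "\<And>U. subgroup U G \<Longrightarrow> \<exists>!V. V \<in> Sig \<and> conjugate G U V"
  shows "eps_hat G \<pi> Sig W = S.of_marks (resid_char W)"
proof -
  let ?e = "eps_hat G \<pi> Sig W :: 'a set \<Rightarrow> 'k"
  let ?A = "{V \<in> Sig. pi_perfect G \<pi> V \<and> G\<lparr>carrier := V\<rparr> \<cong> G\<lparr>carrier := W\<rparr>}"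
  let ?B = "\<lambda>V. {V' \<in> Sig. conjugate G (pi_residual G \<pi> V') V}"
  have finS: "finite Sig" using Sig(1) fin_subgroups by (metis (mono_tags, lifting) finite_subset mem_Collect_eq subsetI)
  have bs: "burnside_idem G V' \<in> S.fspace" if "V' \<in> Sig" for V'
    using burnside_idem_eq of_marks_burnside[OF conj_ind] Sig(1) that unfolding burnside_space_eq by simp
  have ep: "eps_pi G \<pi> Sig V = (\<lambda>U. \<Sum>V'\<in>?B V. burnside_idem G V' U :: 'k)" for V
    unfolding eps_pi_def ..
  have eh: "?e = (\<lambda>U. \<Sum>V\<in>?A. eps_pi G \<pi> Sig V U)" unfolding eps_hat_def ..
  have eps: "(eps_pi G \<pi> Sig V :: 'a set \<Rightarrow> 'k) \<in> S.fspace" for V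
    unfolding ep by (rule fspace_sum) (use bs in blast)
  have es: "?e \<in> S.fspace" unfolding eh by (rule fspace_sum) (rule eps)
  have ci: "conj_inv (resid_char W)" using iso_inv_conj_inv[OF resid_char_iso_inv] .
  have "S.fmark ?e H = resid_char W H" if H: "subgroup H G" for H
  proof -
    obtain V0 where V0: "V0 \<in> Sig" "conjugate G H V0" "\<And>V. V \<in> Sig \<Longrightarrow> conjugate G H V \<Longrightarrow> V = V0"
      using Sig(2)[OF H] by blast
    have rs: "subgroup (pi_residual G \<pi> H) G" using pi_residual_subgroup[OF H] .
    obtain V1 where V1: "V1 \<in> Sig" "conjugate G (pi_residual G \<pi> H) V1"
      "\<And>V. V \<in> Sig \<Longrightarrow> conjugate G (pi_residual G \<pi> H) V \<Longrightarrow> V = V1"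
      using Sig(2)[OF rs] by blast
    obtain g where g: "g \<in> carrier G" "V0 = conj_img G g H" using V0(2) unfolding conjugate_def by auto
    have c0: "conjugate G (pi_residual G \<pi> H) (pi_residual G \<pi> V0)"
      unfolding g(2) pi_residual_conj[OF H g(1)] using conjugateI[OF rs g(1)] .
    have bi: "S.fmark (burnside_idem G V' :: 'a set \<Rightarrow> 'k) H = (if V' = V0 then 1 else 0)" if V': "V' \<in> Sig" for V'
    proof -
      have sg: "subgroup V' G" using Sig(1) V' by blast
      have "S.fmark (burnside_idem G V' :: 'a set \<Rightarrow> 'k) H = (if conjugate G H V' then 1 else 0)"
        unfolding burnside_idem_eq[OF sg] by (rule S.fmark_of_marks) (use H in blast)
      moreover have "conjugate G H V' \<longleftrightarrow> V' = V0" using V0(2) V0(3)[OF V'] by (intro iffI) simp_all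
      ultimately show ?thesis by simp
    qed
    have "S.fmark (eps_pi G \<pi> Sig V) H = (if V = V1 then 1 else 0 :: 'k)" if V: "V \<in> Sig" for V
    proof -
      have "S.fmark (eps_pi G \<pi> Sig V) H = (\<Sum>V'\<in>?B V. if V' = V0 then 1 else 0 :: 'k)"
        unfolding ep fmark_sum by (intro sum.cong refl) (use bi in blast)
      also have "\<dots> = (if V0 \<in> ?B V then 1 else 0)" using finS by (simp add: sum.delta')
      also have "V0 \<in> ?B V \<longleftrightarrow> conjugate G (pi_residual G \<pi> H) V"
        using V0(1) conjugate_trans[OF c0] conjugate_trans[OF conjugate_sym[OF c0]] by (intro iffI CollectI conjI) simp_all
      also have "conjugate G (pi_residual G \<pi> H) V \<longleftrightarrow> V = V1" using V1 V by blast
      finally show ?thesis .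
    qed
    then have "S.fmark ?e H = (\<Sum>V\<in>?A. if V = V1 then 1 else 0 :: 'k)"
      unfolding eh fmark_sum by (intro sum.cong refl) blast
    also have "\<dots> = (if V1 \<in> ?A then 1 else 0)" using finS by (simp add: sum.delta')
    also have "V1 \<in> ?A \<longleftrightarrow> G\<lparr>carrier := pi_residual G \<pi> H\<rparr> \<cong> G\<lparr>carrier := W\<rparr>"
    proof -
      obtain h where h: "h \<in> carrier G" "V1 = conj_img G h (pi_residual G \<pi> H)" using V1(2) unfolding conjugate_def by auto
      have "pi_perfect G \<pi> V1"
        using pi_residual_perfect[OF conj_img_subgroup[OF H h(1)], of \<pi>] unfolding h(2) pi_residual_conj[OF H h(1)] .
      moreover have "G\<lparr>carrier := V1\<rparr> \<cong> G\<lparr>carrier := W\<rparr> \<longleftrightarrow> G\<lparr>carrier := pi_residual G \<pi> H\<rparr> \<cong> G\<lparr>carrier := W\<rparr>"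
        using iso_trans[OF conjugate_iso[OF V1(2)]] iso_trans[OF conjugate_iso[OF conjugate_sym[OF V1(2)]]] by blast
      ultimately show ?thesis using V1(1) by blast
    qed
    finally show ?thesis unfolding resid_char_def .
  qed
  note mk = this
  show ?thesis
  proof (rule S.fmark_inj[OF es])
    show "S.of_marks (resid_char W) \<in> S.fspace" using of_marks_burnside[OF ci] unfolding burnside_space_eq .
    fix L assume L: "L \<in> {U. subgroup U G}"
    then show "S.fmark ?e L = S.fmark (S.of_marks (resid_char W)) L"
      unfolding S.fmark_of_marks[OF L] using mk by blast
  qed
qed

definition block_idem :: "'a set \<Rightarrow> ('a \<times> 'a) set \<Rightarrow> 'k" where
  "block_idem W = Delta G (S.of_marks (resid_char W))"

lemma resid_char_conj_inv: "conj_inv (resid_char W)"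
  using iso_inv_conj_inv[OF resid_char_iso_inv] .

lemma block_idem_central: "central_idempotent (block_idem W)"
  unfolding block_idem_def by (rule central_idempotent_Delta[OF resid_char_iso_inv resid_char_reach_inv])
    (simp add: resid_char_def)

lemma block_idem_space: "block_idem W \<in> bd_space G"
  unfolding block_idem_def by (rule Delta_space[OF of_marks_burnside[OF resid_char_conj_inv]])

lemma ghost_idem: "bifree G L \<Longrightarrow> ghost (block_idem W) L = ghost_one L * resid_char W (Domain L)"
  unfolding block_idem_def by (rule ghost_Delta_of_marks[OF resid_char_conj_inv])

lemma ghost_idem_mult: "bifree G L \<Longrightarrow>
    ghost (bd_mult G (block_idem W) (block_idem W')) L = ghost_one L * (resid_char W (Domain L) * resid_char W' (Domain L))"
  unfolding block_idem_def by (rule Delta_mult[OF resid_char_conj_inv resid_char_conj_inv])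

lemma ghost_one_diag_nz: "subgroup U G \<Longrightarrow> ghost_one (diag U) \<noteq> 0"
  using ghost_one_diag[of U] S.card_subgroup_nz[OF centralizer_subgroup[OF subgroup.subset]] ord_inv by simp

lemma zero_space: "(\<lambda>_. 0) \<in> bd_space G"
  unfolding bd_space_def by simp

lemma ghost_zero: "ghost (\<lambda>_. 0) L = 0"
  unfolding ghost_def D.fmark_def by simp

lemma ghost_add: "ghost (\<lambda>L. a L + b L) L = ghost a L + ghost b L"
  unfolding ghost_def D.fmark_def by (simp add: sum.distrib distrib_right add_divide_distrib)

lemma Domain_diag: "Domain (diag U) = U"
  unfolding diag_def by auto

text \<open>The factor \<open>ghost_one\<close> is nonzero at \<open>diag U\<close>, so the marks
  can be read off there.\<close>

lemma Delta_of_marks_eq_iff: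
  assumes "conj_inv m" "conj_inv m'"
  shows "Delta G (S.of_marks m) = Delta G (S.of_marks m') \<longleftrightarrow> (\<forall>U. subgroup U G \<longrightarrow> m U = m' U)"
proof
  assume e: "Delta G (S.of_marks m) = Delta G (S.of_marks m')"
  show "\<forall>U. subgroup U G \<longrightarrow> m U = m' U"
  proof (intro allI impI)
    fix U assume U: "subgroup U G"
    have "ghost_one (diag U) * m U = ghost_one (diag U) * m' U"
      using ghost_Delta_of_marks[OF assms(1) diag_bifree[OF U]] ghost_Delta_of_marks[OF assms(2) diag_bifree[OF U]] e
      unfolding Domain_diag by metis
    then show "m U = m' U" using ghost_one_diag_nz[OF U] by simp
  qed
next
  assume a: "\<forall>U. subgroup U G \<longrightarrow> m U = m' U"
  show "Delta G (S.of_marks m) = Delta G (S.of_marks m')"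
  proof (rule ghost_inj[OF Delta_space[OF of_marks_burnside[OF assms(1)]] Delta_space[OF of_marks_burnside[OF assms(2)]]])
    fix L assume L: "bifree G L"
    show "ghost (Delta G (S.of_marks m)) L = ghost (Delta G (S.of_marks m')) L"
      using ghost_Delta_of_marks[OF assms(1) L] ghost_Delta_of_marks[OF assms(2) L] a Domain_subgroup[OF bifree_subgroup[OF L]] by simp
  qed
qed

lemma of_marks_zero: "Delta G (S.of_marks (\<lambda>_. 0)) = (\<lambda>_. 0)"
proof -
  have ci: "conj_inv (\<lambda>_. 0)" unfolding conj_inv_def by simp
  show ?thesis
    by (rule ghost_inj[OF Delta_space[OF of_marks_burnside[OF ci]] zero_space])
      (simp add: ghost_Delta_of_marks[OF ci] ghost_zero)
qed

text \<open>Constancy along chains moves H to its residual and isomorphism invariance moves that to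
  W. Functions with both invariances are thus determined by their values on \<pi>-perfect
  representatives.\<close>

lemma iso_inv_eq:
  assumes m: "iso_inv m" "reach_inv m" and H: "subgroup H G" and W: "subgroup W G"
    and i: "G\<lparr>carrier := pi_residual G \<pi> H\<rparr> \<cong> G\<lparr>carrier := W\<rparr>"
  shows "m H = m W"
proof -
  have "m H = m (pi_residual G \<pi> H)" using m(2) H pi_residual_least(1)[OF H] unfolding reach_inv_def by blast
  also obtain L where L: "bifree G L" "Domain L = pi_residual G \<pi> H" "Range L = W"
    using iso_bifree[OF pi_residual_subgroup[OF H] W i] .
  then have "m (pi_residual G \<pi> H) = m W" using m(1) unfolding iso_inv_def by metis
  finally show ?thesis .
qed

section \<open>Orthogonality, completeness and primitivity for a set of representatives\<close>

context
  fixes Th :: "'a set set"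
  assumes Th: "\<And>W. W \<in> Th \<Longrightarrow> subgroup W G \<and> pi_perfect G \<pi> W"
    and Th_reps: "\<And>V. subgroup V G \<Longrightarrow> pi_perfect G \<pi> V \<Longrightarrow>
              \<exists>!W. W \<in> Th \<and> G\<lparr>carrier := V\<rparr> \<cong> G\<lparr>carrier := W\<rparr>"
begin

text \<open>The residual of H is \<pi>-perfect, hence isomorphic to exactly one representative. So
  the functions \<open>resid_char\<close> partition the subgroups of G.\<close>

lemma Th_cover:
  assumes "subgroup H G"
  obtains W where "W \<in> Th" "\<And>W'. W' \<in> Th \<Longrightarrow> resid_char W' H = (if W' = W then 1 else 0)"
proof -
  obtain W where W: "W \<in> Th" "G\<lparr>carrier := pi_residual G \<pi> H\<rparr> \<cong> G\<lparr>carrier := W\<rparr>"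
    and u: "\<And>W'. W' \<in> Th \<Longrightarrow> G\<lparr>carrier := pi_residual G \<pi> H\<rparr> \<cong> G\<lparr>carrier := W'\<rparr> \<Longrightarrow> W' = W"
    using Th_reps[OF pi_residual_subgroup[OF assms] pi_residual_perfect[OF assms]] by blast
  have "resid_char W' H = (if W' = W then 1 else 0)" if "W' \<in> Th" for W'
  proof (cases "W' = W")
    case True then show ?thesis unfolding resid_char_def using W(2) by simp
  next
    case False
    then have "\<not> G\<lparr>carrier := pi_residual G \<pi> H\<rparr> \<cong> G\<lparr>carrier := W'\<rparr>" using u[OF that] by blast
    then show ?thesis unfolding resid_char_def using False by simp
  qed
  then show ?thesis by (rule that[OF W(1)])
qed

text \<open>A \<pi>-perfect subgroup is its own residual, so W lies in the part labelled by
  W.\<close>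

lemma resid_char_Th:
  assumes W: "W \<in> Th" "W' \<in> Th" shows "resid_char W' W = (if W' = W then 1 else 0)"
proof -
  have w: "subgroup W G" "pi_perfect G \<pi> W" using Th[OF W(1)] by auto
  obtain V where V: "V \<in> Th" "\<And>W'. W' \<in> Th \<Longrightarrow> resid_char W' W = (if W' = V then 1 else 0)"
    using Th_cover[OF w(1)] by blast
  have "resid_char W W = 1" unfolding resid_char_def pi_perfect_residual[OF w] using iso_refl by auto
  then have "V = W" using V(2)[OF W(1)] by (metis zero_neq_one)
  then show ?thesis using V(2)[OF W(2)] by simp
qed

lemma block_idem_nonzero: assumes "W \<in> Th" shows "block_idem W \<noteq> (\<lambda>_. 0)"
proof
  assume z: "block_idem W = (\<lambda>_. 0)"
  have sg: "subgroup W G" using Th[OF assms] by simp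
  have "ghost_one (diag W) * resid_char W W = 0"
    using ghost_idem[OF diag_bifree[OF sg], of W] unfolding z ghost_zero Domain_diag by simp
  then show False using ghost_one_diag_nz[OF sg] resid_char_Th[OF assms assms] by simp
qed

lemma block_idem_orthogonal:
  assumes "W \<in> Th" "W' \<in> Th" "W \<noteq> W'" shows "bd_mult G (block_idem W) (block_idem W') = (\<lambda>_. 0)"
proof (rule ghost_inj[OF bd_mult_space zero_space])
  fix L assume L: "bifree G L"
  obtain V where V: "\<And>W'. W' \<in> Th \<Longrightarrow> resid_char W' (Domain L) = (if W' = V then 1 else 0)"
    using Th_cover[OF Domain_subgroup[OF bifree_subgroup[OF L]]] by blast
  show "ghost (bd_mult G (block_idem W) (block_idem W')) L = ghost (\<lambda>_. 0) L"
    unfolding ghost_idem_mult[OF L] ghost_zero V[OF assms(1)] V[OF assms(2)] using assms(3) by auto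
qed

lemma block_idem_sum: "(\<lambda>L. \<Sum>W\<in>Th. block_idem W L) = bd_one G"
proof (rule ghost_inj)
  have fT: "finite Th" using Th fin_subgroups by (metis (mono_tags, lifting) finite_subset mem_Collect_eq subsetI)
  show "(bd_one G :: ('a \<times> 'a) set \<Rightarrow> 'k) \<in> bd_space G" unfolding bd_one_Delta(1) by (rule Delta_space[OF bd_one_Delta(2)])
  have "bifree G L" if nz: "(\<Sum>W\<in>Th. block_idem W L) \<noteq> 0" for L
  proof (rule ccontr)
    assume "\<not> bifree G L"
    then have "\<forall>W\<in>Th. block_idem W L = 0" using block_idem_space unfolding bd_space_def by blast
    then show False using nz by simp
  qed
  moreover have "(\<Sum>W\<in>Th. block_idem W L) = (\<Sum>W\<in>Th. block_idem W M)" if c: "conjugate GG L M" for L M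
  proof (rule sum.cong[OF refl])
    fix W show "block_idem W L = block_idem W M" using block_idem_space[of W] c unfolding bd_space_def by blast
  qed
  ultimately show "(\<lambda>L. \<Sum>W\<in>Th. block_idem W L) \<in> bd_space G" unfolding bd_space_def by blast
  fix L assume L: "bifree G L"
  have dL: "subgroup (Domain L) G" using Domain_subgroup[OF bifree_subgroup[OF L]] .
  obtain V where V: "V \<in> Th" "\<And>W'. W' \<in> Th \<Longrightarrow> resid_char W' (Domain L) = (if W' = V then 1 else 0)"
    using Th_cover[OF dL] by blast
  have "ghost (\<lambda>L. \<Sum>W\<in>Th. block_idem W L) L = (\<Sum>W\<in>Th. ghost (block_idem W) L)"
    unfolding ghost_def D.fmark_def sum_divide_distrib[symmetric] sum_distrib_right by (subst sum.swap) (rule refl)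
  also have "\<dots> = (\<Sum>W\<in>Th. if W = V then ghost_one L else 0)"
    by (rule sum.cong[OF refl]) (simp add: ghost_idem[OF L] V(2))
  also have "\<dots> = ghost_one L" using fT V(1) by (simp add: sum.delta')
  also have "\<dots> = ghost (bd_one G) L"
    unfolding bd_one_Delta(1) ghost_Delta[OF bd_one_Delta(2) L] bd_one_Delta(3)[OF dL] by simp
  finally show "ghost (\<lambda>L. \<Sum>W\<in>Th. block_idem W L) L = ghost (bd_one G) L" .
qed

lemma prim_idem_central:
  "prim_idem G (bd_center G R) e \<longleftrightarrow> central_idempotent e \<and> e \<noteq> (\<lambda>_. 0)
    \<and> \<not> (\<exists>f g. central_idempotent f \<and> central_idempotent g \<and> f \<noteq> (\<lambda>_. 0) \<and> g \<noteq> (\<lambda>_. 0)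
          \<and> bd_mult G f g = (\<lambda>_. 0) \<and> e = (\<lambda>L. f L + g L))"
  unfolding prim_idem_def central_idempotent_def by blast

text \<open>A nonzero mark at some H is carried by the two invariances to the representative of its
  residual.\<close>

lemma central_nonzero:
  assumes m: "iso_inv m" "reach_inv m" and nz: "Delta G (S.of_marks m) \<noteq> (\<lambda>_. 0)"
  obtains W where "W \<in> Th" "m W \<noteq> 0" "\<exists>H. subgroup H G \<and> m H \<noteq> 0 \<and> resid_char W H = 1"
proof -
  have c0: "conj_inv (\<lambda>_. 0)" unfolding conj_inv_def by simp
  have "\<not> (\<forall>U. subgroup U G \<longrightarrow> m U = 0)"
    using Delta_of_marks_eq_iff[OF iso_inv_conj_inv[OF m(1)] c0] nz unfolding of_marks_zero by blast
  then obtain H where H: "subgroup H G" "m H \<noteq> 0" by blast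
  obtain W where W: "W \<in> Th" "\<And>W'. W' \<in> Th \<Longrightarrow> resid_char W' H = (if W' = W then 1 else 0)"
    using Th_cover[OF H(1)] by blast
  have one: "resid_char W H = 1" using W(2)[OF W(1)] by simp
  then have "G\<lparr>carrier := pi_residual G \<pi> H\<rparr> \<cong> G\<lparr>carrier := W\<rparr>"
    unfolding resid_char_def by (metis zero_neq_one)
  then have "m H = m W" using iso_inv_eq[OF m H(1)] Th[OF W(1)] by blast
  then show ?thesis using that[OF W(1)] H one by metis
qed

text \<open>In a splitting f + g the marks of f and g have product 0 and sum
  \<open>resid_char W\<close>. Each of them is nonzero at some representative V, and there
  \<open>resid_char W\<close> is nonzero as well, which forces V = W. Both would then be nonzero at
  W, against the product being 0.\<close>

lemma block_idem_primitive: assumes W: "W \<in> Th" shows "prim_idem G (bd_center G R) (block_idem W)"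
  unfolding prim_idem_central
proof (intro conjI block_idem_central block_idem_nonzero[OF W] notI)
  assume "\<exists>f g. central_idempotent f \<and> central_idempotent g \<and> f \<noteq> (\<lambda>_. 0) \<and> g \<noteq> (\<lambda>_. 0)
          \<and> bd_mult G f g = (\<lambda>_. 0) \<and> block_idem W = (\<lambda>L. f L + g L)"
  then obtain f g where fg: "central_idempotent f" "central_idempotent g" "f \<noteq> (\<lambda>_. 0)" "g \<noteq> (\<lambda>_. 0)"
      "bd_mult G f g = (\<lambda>_. 0)" "block_idem W = (\<lambda>L. f L + g L)" by blast
  obtain m where m: "iso_inv m" "reach_inv m" "\<And>U. m U \<in> {0, 1}" "f = Delta G (S.of_marks m)"
    using central_idempotent_structure[OF fg(1)] by blast
  obtain m' where m': "iso_inv m'" "reach_inv m'" "\<And>U. m' U \<in> {0, 1}" "g = Delta G (S.of_marks m')"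
    using central_idempotent_structure[OF fg(2)] by blast
  note ci = iso_inv_conj_inv[OF m(1)] iso_inv_conj_inv[OF m'(1)]
  have prod: "m U * m' U = 0" and sum: "resid_char W U = m U + m' U" if U: "subgroup U G" for U
  proof -
    have "ghost_one (diag U) * (m U * m' U) = 0"
      using Delta_mult[OF ci diag_bifree[OF U]] fg(5) ghost_zero unfolding m(4) m'(4) Domain_diag by simp
    then show "m U * m' U = 0" using ghost_one_diag_nz[OF U] by simp
    have "ghost_one (diag U) * resid_char W U = ghost_one (diag U) * m U + ghost_one (diag U) * m' U"
      using ghost_idem[OF diag_bifree[OF U], of W] ghost_Delta_of_marks[OF ci(1) diag_bifree[OF U]]
        ghost_Delta_of_marks[OF ci(2) diag_bifree[OF U]]
      unfolding fg(6) ghost_add m(4) m'(4) Domain_diag by simp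
    then have "ghost_one (diag U) * resid_char W U = ghost_one (diag U) * (m U + m' U)" by (simp add: distrib_left)
    then show "resid_char W U = m U + m' U" using ghost_one_diag_nz[OF U] by (metis mult_left_cancel)
  qed
  have at_W: "\<mu> W \<noteq> 0"
    if \<mu>: "iso_inv \<mu>" "reach_inv \<mu>" "Delta G (S.of_marks \<mu>) \<noteq> (\<lambda>_. 0)"
      and le: "\<And>U. subgroup U G \<Longrightarrow> \<mu> U \<noteq> 0 \<Longrightarrow> resid_char W U \<noteq> 0" for \<mu>
  proof -
    obtain V where V: "V \<in> Th" "\<mu> V \<noteq> 0" using central_nonzero[OF \<mu>] by metis
    have "resid_char W V \<noteq> 0" using le[OF _ V(2)] Th[OF V(1)] by blast
    then have "W = V" using resid_char_Th[OF V(1) W] by (metis (full_types))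
    then show ?thesis using V(2) by simp
  qed
  have "m W \<noteq> 0"
  proof (rule at_W[OF m(1,2)])
    show "Delta G (S.of_marks m) \<noteq> (\<lambda>_. 0)" using fg(3) m(4) by simp
    show "resid_char W U \<noteq> 0" if "subgroup U G" "m U \<noteq> 0" for U
      using sum[OF that(1)] prod[OF that(1)] that(2) by simp
  qed
  moreover have "m' W \<noteq> 0"
  proof (rule at_W[OF m'(1,2)])
    show "Delta G (S.of_marks m') \<noteq> (\<lambda>_. 0)" using fg(4) m'(4) by simp
    show "resid_char W U \<noteq> 0" if "subgroup U G" "m' U \<noteq> 0" for U
      using sum[OF that(1)] prod[OF that(1)] that(2) by simp
  qed
  ultimately show False using prod[of W] Th[OF W] by simp
qed

text \<open>A central idempotent e with mark 1 at W splits as \<open>block_idem W\<close> plus the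
  central idempotent g whose marks are those of e away from the part labelled by W. Primitivity of e
  leaves only g = 0.\<close>

lemma primitive_is_idem:
  assumes e: "prim_idem G (bd_center G R) e" shows "e \<in> block_idem ` Th"
proof -
  have ce: "central_idempotent e" and nz: "e \<noteq> (\<lambda>_. 0)" using e unfolding prim_idem_central by auto
  obtain m where m: "iso_inv m" "reach_inv m" "\<And>U. m U \<in> {0, 1}" "e = Delta G (S.of_marks m)"
    using central_idempotent_structure[OF ce] by blast
  note ci = iso_inv_conj_inv[OF m(1)]
  obtain W where W: "W \<in> Th" "m W \<noteq> 0" using central_nonzero[OF m(1,2)] nz m(4) by metis
  have mW: "m W = 1" using W(2) m(3)[of W] by auto
  have sgW: "subgroup W G" using Th[OF W(1)] by simp
  define m' where "m' = (\<lambda>U. m U * (1 - resid_char W U))"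
  have rc: "resid_char W U = 1 \<or> resid_char W U = 0" for U unfolding resid_char_def by simp
  have i': "iso_inv m'" using m(1) resid_char_iso_inv[of W] unfolding iso_inv_def m'_def by simp
  have r': "reach_inv m'" unfolding reach_inv_def
  proof (intro allI impI)
    fix U N assume "subgroup U G" "reach \<pi> U N"
    then have "m U = m N" "resid_char W U = resid_char W N"
      using m(2) resid_char_reach_inv[of W] unfolding reach_inv_def by blast+
    then show "m' U = m' N" unfolding m'_def by simp
  qed
  have v': "m' U \<in> {0, 1}" for U unfolding m'_def using m(3)[of U] rc[of U] by auto
  note ci' = iso_inv_conj_inv[OF i']
  define g where "g = Delta G (S.of_marks m')"
  have cg: "central_idempotent g" unfolding g_def using central_idempotent_Delta[OF i' r' v'] .
  have gs: "g \<in> bd_space G" unfolding g_def using Delta_space[OF of_marks_burnside[OF ci']] .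
  have mU: "m U = resid_char W U + m' U" if U: "subgroup U G" for U
  proof (cases "resid_char W U = 1")
    case True
    then have "G\<lparr>carrier := pi_residual G \<pi> U\<rparr> \<cong> G\<lparr>carrier := W\<rparr>"
      unfolding resid_char_def by (metis zero_neq_one)
    then have "m U = 1" using iso_inv_eq[OF m(1,2) U sgW] mW by simp
    then show ?thesis unfolding m'_def True by simp
  next
    case False
    then show ?thesis unfolding m'_def using rc[of U] by simp
  qed
  have sum: "e = (\<lambda>L. block_idem W L + g L)"
  proof (rule ghost_inj)
    show "e \<in> bd_space G" unfolding m(4) using Delta_space[OF of_marks_burnside[OF ci]] .
    show "(\<lambda>L. block_idem W L + g L) \<in> bd_space G"
      unfolding bd_space_def
    proof (intro CollectI conjI allI impI)
      fix L assume "block_idem W L + g L \<noteq> 0"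
      then have "block_idem W L \<noteq> 0 \<or> g L \<noteq> 0" by auto
      then show "bifree G L" using block_idem_space[of W] gs unfolding bd_space_def by blast
    next
      fix L M assume c: "conjugate GG L M"
      have "block_idem W L = block_idem W M" "g L = g M" using block_idem_space[of W] gs c unfolding bd_space_def by blast+
      then show "block_idem W L + g L = block_idem W M + g M" by simp
    qed
    fix L assume L: "bifree G L"
    show "ghost e L = ghost (\<lambda>L. block_idem W L + g L) L"
      unfolding ghost_add ghost_idem[OF L] unfolding m(4) g_def ghost_Delta_of_marks[OF ci L] ghost_Delta_of_marks[OF ci' L]
      using mU[OF Domain_subgroup[OF bifree_subgroup[OF L]]] by (simp add: distrib_left)
  qed
  have prod: "bd_mult G (block_idem W) g = (\<lambda>_. 0)"
  proof (rule ghost_inj[OF bd_mult_space zero_space])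
    fix L assume L: "bifree G L"
    show "ghost (bd_mult G (block_idem W) g) L = ghost (\<lambda>_. 0) L"
      unfolding block_idem_def g_def Delta_mult[OF resid_char_conj_inv ci' L] ghost_zero
      unfolding m'_def using rc[of "Domain L"] by auto
  qed
  have "g = (\<lambda>_. 0)"
    using e cg block_idem_central[of W] block_idem_nonzero[OF W(1)] prod sum unfolding prim_idem_central by blast
  then have "e = block_idem W" using sum by simp
  then show ?thesis using W(1) by blast
qed

end

end

theorem theorem3p8:
  fixes G :: "('g, 'b) monoid_scheme"
    and R :: "'k::field set"
    and \<pi> :: "nat set"
    and Sig :: "'g set set"
    and ThetaHat :: "'g set set"
  assumes grp: "group G" and fin: "finite (carrier G)"
    and R_sub: "0 \<in> R" "1 \<in> R" "\<And>x y. x \<in> R \<Longrightarrow> y \<in> R \<Longrightarrow> x + y \<in> R"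
        "\<And>x. x \<in> R \<Longrightarrow> - x \<in> R" "\<And>x y. x \<in> R \<Longrightarrow> y \<in> R \<Longrightarrow> x * y \<in> R"
    and K_frac: "\<And>x. \<exists>a\<in>R. \<exists>b\<in>R. b \<noteq> 0 \<and> x = a / b"
    and G_inv: "(of_nat (order G) :: 'k) \<noteq> 0"
    and Out_primes: "\<And>U p. subgroup U G \<Longrightarrow> prime p \<Longrightarrow> p dvd order_Out G U \<Longrightarrow>
          (\<lambda>r. of_nat p * r) ` R \<noteq> {0} \<and> (\<lambda>r. of_nat p * r) ` R \<noteq> R"
    and pi_def: "\<pi> = {p. prime p \<and> p dvd order G \<and> \<not> (\<exists>r\<in>R. of_nat p * r = 1)}"
    and Sigma_reps: "\<forall>U\<in>Sig. subgroup U G"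
        "\<And>U. subgroup U G \<Longrightarrow> \<exists>!V. V \<in> Sig \<and> conjugate G U V"
    and ThetaHat_reps: "ThetaHat \<subseteq> {V \<in> Sig. pi_perfect G \<pi> V}"
        "\<And>V. subgroup V G \<Longrightarrow> pi_perfect G \<pi> V \<Longrightarrow>
              \<exists>!W. W \<in> ThetaHat \<and> G\<lparr>carrier := V\<rparr> \<cong> G\<lparr>carrier := W\<rparr>"
  shows "(\<forall>W\<in>ThetaHat. prim_idem G (bd_center G R) (Delta G (eps_hat G \<pi> Sig W :: 'g set \<Rightarrow> 'k)))
       \<and> (\<forall>W\<in>ThetaHat. \<forall>W'\<in>ThetaHat. W \<noteq> W' \<longrightarrow>
             bd_mult G (Delta G (eps_hat G \<pi> Sig W :: 'g set \<Rightarrow> 'k)) (Delta G (eps_hat G \<pi> Sig W' :: 'g set \<Rightarrow> 'k)) = (\<lambda>_. 0))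
       \<and> (\<lambda>L. \<Sum>W\<in>ThetaHat. Delta G (eps_hat G \<pi> Sig W :: 'g set \<Rightarrow> 'k) L) = bd_one G
       \<and> inj_on (\<lambda>W. Delta G (eps_hat G \<pi> Sig W :: 'g set \<Rightarrow> 'k)) ThetaHat
       \<and> {e. prim_idem G (bd_center G R) e} = (\<lambda>W. Delta G (eps_hat G \<pi> Sig W :: 'g set \<Rightarrow> 'k)) ` ThetaHat"
proof -
  interpret integral_burnside G "TYPE('k)" R \<pi>
  proof (intro integral_burnside.intro double_burnside.intro fin_group.intro fin_group_axioms.intro
      double_burnside_axioms.intro integral_burnside_axioms.intro)
    show "group G" by (rule grp)
    show "finite (carrier G)" by (rule fin)
    show "(of_nat (order G) :: 'k) \<noteq> 0" by (rule G_inv)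
    show "0 \<in> R" "1 \<in> R" by (fact R_sub)+
    show "\<pi> = {p. prime p \<and> p dvd order G \<and> \<not> (\<exists>r\<in>R. of_nat p * r = 1)}" by (rule pi_def)
  qed (fact R_sub K_frac Out_primes)+
  have Th: "subgroup W G \<and> pi_perfect G \<pi> W" if "W \<in> ThetaHat" for W
    using ThetaHat_reps(1) Sigma_reps(1) that by blast
  have eq: "Delta G (eps_hat G \<pi> Sig W :: 'g set \<Rightarrow> 'k) = block_idem W" for W
    unfolding block_idem_def by (rule arg_cong[OF eps_hat_eq[OF Sigma_reps]])
  \<comment> \<open>Equal idempotents at distinct indices would be orthogonal to themselves, hence
    zero.\<close>
  have inj: "inj_on block_idem ThetaHat"
  proof (rule inj_onI, rule ccontr)
    fix W W' assume W: "W \<in> ThetaHat" "W' \<in> ThetaHat" "block_idem W = block_idem W'" "W \<noteq> W'"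
    have "bd_mult G (block_idem W) (block_idem W) = (\<lambda>_. 0)"
      using block_idem_orthogonal[OF Th ThetaHat_reps(2) W(1,2,4)] W(3) by simp
    moreover have "bd_mult G (block_idem W) (block_idem W) = block_idem W"
      using block_idem_central[of W] unfolding central_idempotent_def bd_idem_def by blast
    ultimately show False using block_idem_nonzero[OF Th ThetaHat_reps(2) W(1)] by simp
  qed
  show ?thesis unfolding eq
  proof (intro conjI ballI impI)
    show "prim_idem G (bd_center G R) (block_idem W)" if "W \<in> ThetaHat" for W
      by (rule block_idem_primitive[OF Th ThetaHat_reps(2) that])
    show "bd_mult G (block_idem W) (block_idem W') = (\<lambda>_. 0)" if "W \<in> ThetaHat" "W' \<in> ThetaHat" "W \<noteq> W'" for W W'
      by (rule block_idem_orthogonal[OF Th ThetaHat_reps(2) that])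
    show "(\<lambda>L. \<Sum>W\<in>ThetaHat. block_idem W L) = bd_one G" by (rule block_idem_sum[OF Th ThetaHat_reps(2)])
    show "inj_on block_idem ThetaHat" by (rule inj)
    show "{e. prim_idem G (bd_center G R) e} = block_idem ` ThetaHat"
      using block_idem_primitive[OF Th ThetaHat_reps(2)] primitive_is_idem[OF Th ThetaHat_reps(2)] by blast
  qed
qed

end
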